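(* Let $s\in\mathbb{R}$. If $q\in(0,\infty)$ and $r\in(1,\infty)$, or if $q=\infty$ and $r\in[1,\infty)$, then $$CMO^{s,q}_r(\mathbb{R}^n)=\dot{B}^{s,r/q}_{q,q}(\mathbb{R}^n)=\dot{F}^{s+n(r-1)/q}_{\infty,\infty}(\mathbb{R}^n)$$ with equivalent norms, and, if $q<\infty$, these spaces also equal $\dot{F}^{s,r/q}_{q,q}(\mathbb{R}^n)$ with equivalent norms.
   Context: $\mathcal{S}(\mathbb{R}^n)$ is the Schwartz space; $\mathcal{S}_\infty(\mathbb{R}^n)$ is the subspace of all $\varphi\in\mathcal{S}(\mathbb{R}^n)$ with $\int_{\mathbb{R}^n}\varphi(x)x^\gamma\,dx=0$ for all multi-indices $\gamma$, with the topology inherited from $\mathcal{S}(\mathbb{R}^n)$; $\mathcal{S}'_\infty(\mathbb{R}^n)$ is its topological dual (equivalently, $\mathcal{S}'(\mathbb{R}^n)$ modulo polynomials). $\mathcal{Q}$ is the set of all dyadic cubes $Q_{jk}=2^{-j}([0,1)^n+k)$, $j\in\mathbb{Z}$, $k\in\mathbb{Z}^n$. For $Q=Q_{jk}\in\mathcal{Q}$, $|Q|$ is its Lebesgue measure, $x_Q=2^{-j}k$, $\ell(Q)$ its side-length, $j_Q=-\log_2\ell(Q)$, and $\chi_Q$ its characteristic function. Sums over $Q\subset P$ run over dyadic cubes contained in $P$. Convention: $a/q=0$ for real $a$ if $q=\infty$. Fix $\varphi\in\mathcal{S}(\mathbb{R}^n)$ with $\mathrm{supp}\,\widehat{\varphi}\subset\{\xi:1/2\le|\xi|\le2\}$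 and $|\widehat{\varphi}(\xi)|\ge C>0$ when $3/5\le|\xi|\le5/3$. Put $\varphi_j(x)=2^{jn}\varphi(2^jx)$, $j\in\mathbb{Z}$, and $\varphi_Q(x)=|Q|^{-1/2}\varphi((x-x_Q)/\ell(Q))$, $Q\in\mathcal{Q}$. Generalized Carleson measure space ($s,r\in\mathbb{R}$, $q\in(0,\infty]$): $CMO^{s,q}_r(\mathbb{R}^n)$ is the set of $f\in\mathcal{S}'_\infty(\mathbb{R}^n)$ with $$\|f\|_{CMO^{s,q}_r(\mathbb{R}^n)}=\sup_{P\in\mathcal{Q}}\left\{|P|^{-r}\int_P\sum_{Q\subset P}\left[|Q|^{-s/n-1/2}|\langle f,\varphi_Q\rangle|\chi_Q(x)\right]^qdx\right\}^{1/q}<\infty,$$ with the usual modification when $q=\infty$, i.e. the norm is then $\sup_{P\in\mathcal{Q}}\sup_{Q\subset P}|Q|^{-s/n-1/2}|\langle f,\varphi_Q\rangle|$. For $s\in\mathbb{R}$, $\tau\in[0,\infty)$, $q\in(0,\infty]$: the Triebel-Lizorkin-type space $\dot{F}^{s,\tau}_{p,q}(\mathbb{R}^n)$ ($p\in(0,\infty)$) is the set of $f\in\mathcal{S}'_\infty(\mathbb{R}^n)$ with $$\|f\|_{\dot{F}^{s,\tau}_{p,q}(\mathbb{R}^n)}=\sup_{P\in\mathcal{Q}}\frac1{|P|^{\tau}}\left\{\int_P\left[\sum_{j=j_P}^\infty 2^{jsq}|\varphi_j\ast f(x)|^q\right]^{p/q}dx\right\}^{1/p}<\infty,$$ and the Besov-type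 space $\dot{B}^{s,\tau}_{p,q}(\mathbb{R}^n)$ ($p\in(0,\infty]$) is the set of $f\in\mathcal{S}'_\infty(\mathbb{R}^n)$ with $$\|f\|_{\dot{B}^{s,\tau}_{p,q}(\mathbb{R}^n)}=\sup_{P\in\mathcal{Q}}\frac1{|P|^{\tau}}\left\{\sum_{j=j_P}^\infty 2^{jsq}\left[\int_P|\varphi_j\ast f(x)|^p\,dx\right]^{q/p}\right\}^{1/q}<\infty,$$ with the usual modifications when $p=\infty$ or $q=\infty$ (essential supremum over $P$; supremum over $j\ge j_P$). For $\sigma\in\mathbb{R}$, the classical homogeneous space $\dot{F}^{\sigma}_{\infty,\infty}(\mathbb{R}^n)=\dot{B}^{\sigma}_{\infty,\infty}(\mathbb{R}^n)$ consists of all $f\in\mathcal{S}'_\infty(\mathbb{R}^n)$ with $\sup_{j\in\mathbb{Z}}2^{j\sigma}\|\varphi_j\ast f\|_{L^\infty(\mathbb{R}^n)}<\infty$, this quantity being the norm. *)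

theory Defs
  imports "HOL-Probability.Essential_Supremum"
begin

section \<open>Schwartz functions\<close>

text \<open>Iterated partial derivatives are indexed by lists of coordinates; on smooth functions the
  order of the list is irrelevant, so these are the derivatives indexed by multi-indices.\<close>

definition partial_derivative :: "'n::finite \<Rightarrow> (real^'n \<Rightarrow> complex) \<Rightarrow> real^'n \<Rightarrow> complex" where
  "partial_derivative i f x = frechet_derivative f (at x) (axis i 1)"

primrec iterated_partial :: "'n::finite list \<Rightarrow> (real^'n \<Rightarrow> complex) \<Rightarrow> real^'n \<Rightarrow> complex" where
  "iterated_partial [] f = f"
| "iterated_partial (i # is) f = partial_derivative i (iterated_partial is f)"

definition schwartz :: "(real^'n::finite \<Rightarrow> complex) set" where
  "schwartz = {f. (\<forall>is x. iterated_partial is f differentiable (at x)) \<and>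
     (\<forall>N is. bdd_above (range (\<lambda>x. (1 + norm x) ^ N * norm (iterated_partial is f x))))}"

definition schwartz_seminorm :: "nat \<Rightarrow> 'n::finite list \<Rightarrow> (real^'n \<Rightarrow> complex) \<Rightarrow> real" where
  "schwartz_seminorm N is f = (SUP x. (1 + norm x) ^ N * norm (iterated_partial is f x))"

definition schwartz_topology :: "(real^'n::finite \<Rightarrow> complex) topology" where
  "schwartz_topology = topology_generated_by
     {{g \<in> schwartz. schwartz_seminorm N is (\<lambda>x. g x - f x) < e} | f N is e. f \<in> schwartz}"

lemma topspace_schwartz_topology: "topspace schwartz_topology = schwartz"
proof -
  have "g \<in> topspace schwartz_topology" if "g \<in> schwartz" for g :: "real^'n \<Rightarrow> complex"
  proof -
    have "g \<in> {h \<in> schwartz. schwartz_seminorm 0 [] (\<lambda>x. h x - g x) < 1}"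
      using that by (simp add: schwartz_seminorm_def)
    then show ?thesis
      using that unfolding schwartz_topology_def topology_generated_by_topspace by blast
  qed
  then show ?thesis
    by (auto simp: schwartz_topology_def topology_generated_by_topspace)
qed

definition monomial :: "('n::finite \<Rightarrow> nat) \<Rightarrow> real^'n \<Rightarrow> real" where
  "monomial \<gamma> x = (\<Prod>i\<in>UNIV. (x $ i) ^ \<gamma> i)"

definition schwartz_inf :: "(real^'n::finite \<Rightarrow> complex) set" where
  "schwartz_inf = {f \<in> schwartz. \<forall>\<gamma>. (LINT x|lborel. f x * of_real (monomial \<gamma> x)) = 0}"

text \<open>Functionals are made extensional so that equality of functionals is equality on
  \<^term>\<open>schwartz_inf\<close>.\<close>

definition schwartz_inf_dual :: "((real^'n::finite \<Rightarrow> complex) \<Rightarrow> complex) set" where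
  "schwartz_inf_dual = {u \<in> extensional schwartz_inf.
     (\<forall>f\<in>schwartz_inf. \<forall>g\<in>schwartz_inf. u (\<lambda>x. f x + g x) = u f + u g) \<and>
     (\<forall>c. \<forall>f\<in>schwartz_inf. u (\<lambda>x. c * f x) = c * u f) \<and>
     continuous_map (subtopology schwartz_topology schwartz_inf) euclidean u}"

section \<open>The fixed test function\<close>

text \<open>The angular-frequency normalisation matters: with it, the spectrum of an admissible function
  lies in the open cube of half-width \<open>pi\<close>, so that sampling on the integer lattice loses nothing.\<close>

definition fourier :: "(real^'n::finite \<Rightarrow> complex) \<Rightarrow> real^'n \<Rightarrow> complex" where
  "fourier f \<xi> = (LINT x|lborel. f x * cis (- (x \<bullet> \<xi>)))"

definition admissible :: "(real^'n::finite \<Rightarrow> complex) \<Rightarrow> bool" where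
  "admissible \<phi> \<longleftrightarrow> \<phi> \<in> schwartz \<and>
     closure {\<xi>. fourier \<phi> \<xi> \<noteq> 0} \<subseteq> {\<xi>. 1/2 \<le> norm \<xi> \<and> norm \<xi> \<le> 2} \<and>
     (\<exists>C>0. \<forall>\<xi>. 3/5 \<le> norm \<xi> \<and> norm \<xi> \<le> 5/3 \<longrightarrow> norm (fourier \<phi> \<xi>) \<ge> C)"

definition dilate :: "(real^'n::finite \<Rightarrow> complex) \<Rightarrow> int \<Rightarrow> real^'n \<Rightarrow> complex" where
  "dilate \<phi> j x = of_real (2 powr (real_of_int j * real CARD('n))) * \<phi> ((2 powr real_of_int j) *\<^sub>R x)"

definition convolve ::
  "(real^'n::finite \<Rightarrow> complex) \<Rightarrow> ((real^'n \<Rightarrow> complex) \<Rightarrow> complex) \<Rightarrow> real^'n \<Rightarrow> complex" where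
  "convolve \<psi> u x = u (\<lambda>y. \<psi> (x - y))"

section \<open>Dyadic cubes\<close>

text \<open>The pair \<open>(j, k)\<close> stands for the cube \<open>2\<^sup>-\<^sup>j ([0,1)\<^sup>n + k)\<close>; by \<open>inj_cube\<close> below, sums and
  suprema over cubes may be taken over such pairs.\<close>

type_synonym 'n dyadic = "int \<times> (int, 'n) vec"

definition side :: "'n::finite dyadic \<Rightarrow> real" where
  "side Q = 2 powr (- real_of_int (fst Q))"

definition corner :: "'n::finite dyadic \<Rightarrow> real^'n" where
  "corner Q = side Q *\<^sub>R (\<chi> i. real_of_int (snd Q $ i))"

definition cube :: "'n::finite dyadic \<Rightarrow> (real^'n) set" where
  "cube Q = {x. \<forall>i. corner Q $ i \<le> x $ i \<and> x $ i < corner Q $ i + side Q}"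

definition volume :: "'n::finite dyadic \<Rightarrow> real" where
  "volume Q = measure lborel (cube Q)"

definition subcubes :: "'n::finite dyadic \<Rightarrow> 'n dyadic set" where
  "subcubes P = {Q. cube Q \<subseteq> cube P}"

lemma side_pos: "side Q > 0"
  by (simp add: side_def)

lemma cube_eq_image:
  "cube (j, k) = (\<lambda>y. (2 powr (- real_of_int j)) *\<^sub>R (y + (\<chi> i. real_of_int (k $ i)))) `
     {y. \<forall>i. 0 \<le> y $ i \<and> y $ i < 1}" (is "?C = ?f ` ?U")
proof (intro equalityI subsetI)
  define a where "a = (2::real) powr (- real_of_int j)"
  have a: "a > 0" by (simp add: a_def)
  fix x assume x: "x \<in> ?C"
  define y where "y = (1 / a) *\<^sub>R x - (\<chi> i. real_of_int (k $ i))"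
  have "x = ?f y"
    using a by (simp add: y_def flip: a_def)
  moreover have "y \<in> ?U"
    using x a by (auto simp: y_def cube_def corner_def side_def a_def[symmetric] field_simps)
  ultimately show "x \<in> ?f ` ?U" by blast
next
  define a where "a = (2::real) powr (- real_of_int j)"
  have a: "a > 0" by (simp add: a_def)
  fix x assume "x \<in> ?f ` ?U"
  then show "x \<in> ?C"
    using a by (auto simp: cube_def corner_def side_def a_def[symmetric] algebra_simps)
qed

lemma inj_cube: "inj (cube :: 'n::finite dyadic \<Rightarrow> _)"
proof (rule injI)
  fix P Q :: "'n dyadic"
  assume eq: "cube P = cube Q"
  have self: "corner R \<in> cube R" for R :: "'n dyadic"
    using side_pos[of R] by (simp add: cube_def)
  have corner: "corner P = corner Q"
  proof (rule vec_eq_iff[THEN iffD2], rule allI, rule antisym)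
    fix i
    show "corner P $ i \<le> corner Q $ i" using self[of Q] eq by (auto simp: cube_def)
    show "corner Q $ i \<le> corner P $ i" using self[of P] eq by (auto simp: cube_def)
  qed
  have mem: "(\<chi> i. corner R $ i + t) \<in> cube R \<longleftrightarrow> 0 \<le> t \<and> t < side R"
    for R :: "'n dyadic" and t
    by (simp add: cube_def)
  have "t < side P \<longleftrightarrow> t < side Q" if "0 \<le> t" for t
    using mem[of P t] mem[of Q t] eq corner that by simp
  from this[of "side P"] this[of "side Q"] have side: "side P = side Q"
    using side_pos[of P] side_pos[of Q] by simp
  then have "- real_of_int (fst P) = - real_of_int (fst Q)"
    unfolding side_def using powr_inj[of 2] by simp
  then have "fst P = fst Q" by simp
  moreover have "snd P = snd Q"
    using corner side side_pos[of Q] by (simp add: corner_def vec_eq_iff)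
  ultimately show "P = Q" by (rule prod_eqI)
qed

text \<open>L2-normalised: \<open>\<phi>\<^sub>Q\<close>, in contrast to the L1-normalised \<^const>\<open>dilate\<close>.\<close>

definition wavelet :: "(real^'n::finite \<Rightarrow> complex) \<Rightarrow> 'n dyadic \<Rightarrow> real^'n \<Rightarrow> complex" where
  "wavelet \<phi> Q x = of_real (volume Q powr (-1/2)) * \<phi> ((1 / side Q) *\<^sub>R (x - corner Q))"

section \<open>Quasi-norms\<close>

text \<open>Only used with positive exponents.\<close>

definition epowr :: "ennreal \<Rightarrow> real \<Rightarrow> ennreal" where
  "epowr x a = (if x = \<infinity> then \<infinity> else ennreal (enn2real x powr a))"

definition ediv :: "real \<Rightarrow> ennreal \<Rightarrow> real" where
  "ediv a q = (if q = \<infinity> then 0 else a / enn2real q)"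

definition Lp_qnorm :: "ennreal \<Rightarrow> (real^'n::finite) set \<Rightarrow> (real^'n \<Rightarrow> ennreal) \<Rightarrow> ennreal" where
  "Lp_qnorm p A g =
     (if p = \<infinity> then esssup (restrict_space lborel A) g
      else epowr (\<integral>\<^sup>+x\<in>A. epowr (g x) (enn2real p) \<partial>lborel) (1 / enn2real p))"

definition lq_qnorm :: "ennreal \<Rightarrow> 'i set \<Rightarrow> ('i \<Rightarrow> ennreal) \<Rightarrow> ennreal" where
  "lq_qnorm q I a =
     (if q = \<infinity> then (SUP i\<in>I. a i)
      else epowr (\<integral>\<^sup>+i. epowr (a i) (enn2real q) \<partial>count_space I) (1 / enn2real q))"

definition cmo_norm :: "(real^'n::finite \<Rightarrow> complex) \<Rightarrow> real \<Rightarrow> ennreal \<Rightarrow> real \<Rightarrow>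
    ((real^'n \<Rightarrow> complex) \<Rightarrow> complex) \<Rightarrow> ennreal" where
  "cmo_norm \<phi> s q r f =
     (let c = (\<lambda>Q. volume Q powr (- s / real CARD('n) - 1/2) * norm (f (wavelet \<phi> Q)))
      in if q = \<infinity> then (SUP P. SUP Q\<in>subcubes P. ennreal (c Q))
         else (SUP P. epowr (ennreal (volume P powr (- r)) *
                 (\<integral>\<^sup>+x\<in>cube P. (\<integral>\<^sup>+Q. ennreal ((c Q * indicator (cube Q) x) powr enn2real q)
                    \<partial>count_space (subcubes P)) \<partial>lborel)) (1 / enn2real q)))"

definition band :: "(real^'n::finite \<Rightarrow> complex) \<Rightarrow> real \<Rightarrow> ((real^'n \<Rightarrow> complex) \<Rightarrow> complex) \<Rightarrow>
    int \<Rightarrow> real^'n \<Rightarrow> ennreal" where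
  "band \<phi> s f j x = ennreal (2 powr (real_of_int j * s) * norm (convolve (dilate \<phi> j) f x))"

definition tl_norm :: "(real^'n::finite \<Rightarrow> complex) \<Rightarrow> real \<Rightarrow> real \<Rightarrow> real \<Rightarrow> ennreal \<Rightarrow>
    ((real^'n \<Rightarrow> complex) \<Rightarrow> complex) \<Rightarrow> ennreal" where
  "tl_norm \<phi> s \<tau> p q f =
     (SUP P. ennreal (volume P powr (- \<tau>)) *
        Lp_qnorm (ennreal p) (cube P) (\<lambda>x. lq_qnorm q {fst P..} (\<lambda>j. band \<phi> s f j x)))"

definition besov_norm :: "(real^'n::finite \<Rightarrow> complex) \<Rightarrow> real \<Rightarrow> real \<Rightarrow> ennreal \<Rightarrow> ennreal \<Rightarrow>
    ((real^'n \<Rightarrow> complex) \<Rightarrow> complex) \<Rightarrow> ennreal" where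
  "besov_norm \<phi> s \<tau> p q f =
     (SUP P. ennreal (volume P powr (- \<tau>)) *
        lq_qnorm q {fst P..} (\<lambda>j. Lp_qnorm p (cube P) (band \<phi> s f j)))"

definition tl_inf_norm :: "(real^'n::finite \<Rightarrow> complex) \<Rightarrow> real \<Rightarrow>
    ((real^'n \<Rightarrow> complex) \<Rightarrow> complex) \<Rightarrow> ennreal" where
  "tl_inf_norm \<phi> \<sigma> f =
     (SUP j. ennreal (2 powr (real_of_int j * \<sigma>)) *
        esssup lborel (\<lambda>x. ennreal (norm (convolve (dilate \<phi> j) f x))))"

section \<open>The spaces\<close>

definition CMO :: "(real^'n::finite \<Rightarrow> complex) \<Rightarrow> real \<Rightarrow> ennreal \<Rightarrow> real \<Rightarrow>
    ((real^'n \<Rightarrow> complex) \<Rightarrow> complex) set" where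
  "CMO \<phi> s q r = {f \<in> schwartz_inf_dual. cmo_norm \<phi> s q r f < \<infinity>}"

definition TL_type :: "(real^'n::finite \<Rightarrow> complex) \<Rightarrow> real \<Rightarrow> real \<Rightarrow> real \<Rightarrow> ennreal \<Rightarrow>
    ((real^'n \<Rightarrow> complex) \<Rightarrow> complex) set" where
  "TL_type \<phi> s \<tau> p q = {f \<in> schwartz_inf_dual. tl_norm \<phi> s \<tau> p q f < \<infinity>}"

definition Besov_type :: "(real^'n::finite \<Rightarrow> complex) \<Rightarrow> real \<Rightarrow> real \<Rightarrow> ennreal \<Rightarrow> ennreal \<Rightarrow>
    ((real^'n \<Rightarrow> complex) \<Rightarrow> complex) set" where
  "Besov_type \<phi> s \<tau> p q = {f \<in> schwartz_inf_dual. besov_norm \<phi> s \<tau> p q f < \<infinity>}"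

definition TL_inf :: "(real^'n::finite \<Rightarrow> complex) \<Rightarrow> real \<Rightarrow>
    ((real^'n \<Rightarrow> complex) \<Rightarrow> complex) set" where
  "TL_inf \<phi> \<sigma> = {f \<in> schwartz_inf_dual. tl_inf_norm \<phi> \<sigma> f < \<infinity>}"

definition equivalent_norms_on :: "'a set \<Rightarrow> ('a \<Rightarrow> ennreal) \<Rightarrow> ('a \<Rightarrow> ennreal) \<Rightarrow> bool" where
  "equivalent_norms_on X N M \<longleftrightarrow>
     (\<exists>c C. 0 < c \<and> 0 < C \<and> (\<forall>f\<in>X. ennreal c * N f \<le> M f \<and> M f \<le> ennreal C * N f))"

end

theory Submission
  imports Defs
begin

text \<open>Put \<open>\<phi>~(x) = \<phi>(-x)\<close> and \<open>\<sigma> = s + n(r-1)/q\<close>. Up to normalisation, the coefficient of \<open>f\<close> against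
  \<open>\<phi>\<^sub>Q\<close> is the sample of \<open>\<phi>~\<^sub>j * f\<close> at the corner of \<open>Q\<close>. In the Carleson norm the cube \<open>P\<close> alone
  already controls its own coefficient, and since \<open>r > 1\<close> the subcubes of \<open>P\<close> only add a convergent
  geometric series; so the norm is equivalent to the supremum of \<open>2\<^sup>j\<^sup>\<sigma> |\<phi>~\<^sub>j * f|\<close> over the lattice
  points of all levels.

  Dividing Fourier transforms, a band-limited \<open>\<theta>\<close> is a sum of three dilates of \<open>m\<^sub>i * \<phi>\<close>, and because
  all spectra lie in the cube of half-width \<open>pi\<close>, Poisson summation turns each convolution into a
  lattice sum. This gives
  \<open>\<theta>\<^sub>j * f(x) = \<Sum>\<^sub>i \<Sum>\<^sub>k M\<^sub>i(2\<^sup>i\<^sup>+\<^sup>jx - k - t) (\<phi>\<^sub>i\<^sub>+\<^sub>j * f)(2\<^sup>-\<^sup>i\<^sup>-\<^sup>j(k + t))\<close> with rapidly decaying \<open>M\<^sub>i\<close>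
  and every shift \<open>t\<close>. The choice \<open>t = 0\<close> bounds \<open>\<theta>\<^sub>j * f\<close> by samples, while averaging over \<open>t\<close> bounds
  it by \<open>L\<^sup>q\<close> means over cubes, for any \<open>q > 0\<close>. Using this from \<open>\<phi>\<close> to \<open>\<phi>~\<close> and back closes a cycle of
  estimates through the Carleson, Besov-type and endpoint norms. The Triebel-Lizorkin-type norm with
  \<open>p = q\<close> equals the Besov-type norm by Tonelli's theorem.\<close>

section \<open>Lattice sums\<close>

text \<open>The functional \<open>f\<close> has no pointwise values, so no identity is computed on
  \<open>f\<close> itself. Each is proved for the test functions
  \<open>\<lambda>y. dilate \<theta> j (x - y)\<close> and carried over by continuity; this is why
  the lattice series must converge in every Schwartz seminorm and not only pointwise. Two test
  functions occur because convolution reflects its argument while pairing with a wavelet does not,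
  and no symmetry of \<open>\<phi>\<close> is assumed. Three dilates are needed because the spectra
  may fill the annulus from 1/2 to 2, while the lower bound holds only between 3/5 and 5/3; the two
  neighbouring octaves supply it near the edges. The radius 2 lies below pi, so one period cell
  holds the whole spectrum and its translates by the dual lattice miss it. Fourier inversion is
  itself drawn from Poisson summation, which rests on a uniqueness theorem for Fourier coefficients
  on the torus. The exponent \<open>\<sigma>\<close> is the one for which a function of size
  \<open>2 powr (- j * \<sigma>)\<close> at level j, weighted by \<open>2 powr (j * s)\<close> and
  raised to the power q, is of size |Q|^(r-1) on cubes Q of that level; integrating over P then
  gives |P|^r.\<close>

lemma nn_integral_affine:
  fixes f :: "'a::euclidean_space \<Rightarrow> ennreal"
  assumes [measurable]: "f \<in> borel_measurable borel" and c: "c \<noteq> 0"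
  shows "(\<integral>\<^sup>+x. f x \<partial>lborel) = ennreal (\<bar>c\<bar> ^ DIM('a)) * (\<integral>\<^sup>+x. f (t + c *\<^sub>R x) \<partial>lborel)"
  by (subst lborel_affine[OF c, of t])
     (simp add: nn_integral_density nn_integral_distr nn_integral_cmult)

lemma integrable_affine:
  fixes f :: "'a::euclidean_space \<Rightarrow> 'b :: {banach, second_countable_topology}"
  assumes f: "integrable lborel f" and c: "c \<noteq> 0"
  shows "integrable lborel (\<lambda>x. f (t + c *\<^sub>R x))"
proof -
  have [measurable]: "f \<in> borel_measurable borel"
    using f by (auto dest: borel_measurable_integrable)
  have "ennreal (\<bar>c\<bar> ^ DIM('a)) > 0" using c by simp
  then show ?thesis
    using f unfolding integrable_iff_bounded
    by (subst (asm) nn_integral_affine[where c=c and t=t])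
       (use c in \<open>auto simp: ennreal_mult_less_top\<close>)
qed

lemma integral_affine:
  fixes f :: "'a::euclidean_space \<Rightarrow> 'b :: {banach, second_countable_topology}"
  assumes c: "c \<noteq> 0" and f: "integrable lborel f"
  shows "(\<integral>x. f x \<partial>lborel) = (\<bar>c\<bar> ^ DIM('a)) *\<^sub>R (\<integral>x. f (t + c *\<^sub>R x) \<partial>lborel)"
proof -
  have [measurable]: "f \<in> borel_measurable borel"
    using f by (auto dest: borel_measurable_integrable)
  show ?thesis
    using f integrable_affine[OF f c, of t]
    by (subst lborel_affine[OF c, of t]) (simp add: integral_density integral_distr)
qed

section \<open>Half-open boxes and the volume of dyadic cubes\<close>

definition half_box :: "real^'n::finite \<Rightarrow> real \<Rightarrow> (real^'n) set" where
  "half_box a h = {x. \<forall>i. a $ i \<le> x $ i \<and> x $ i < a $ i + h}"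

lemma half_box_sets [measurable]: "half_box a h \<in> sets borel"
  unfolding half_box_def by measurable

text \<open>The half-open box is squeezed between the open and the closed box, which have the same
  measure.\<close>

lemma emeasure_half_box:
  fixes a :: "real^'n::finite"
  assumes "h > 0"
  shows "emeasure lborel (half_box a h) = ennreal (h ^ CARD('n))"
proof -
  define b where "b = (\<chi> i. a $ i + h)"
  have prod: "(\<Prod>c\<in>Basis. (b - a) \<bullet> c) = h ^ CARD('n)"
  proof -
    have "(\<Prod>c\<in>Basis. (b - a) \<bullet> c) = (\<Prod>c\<in>(Basis :: (real^'n) set). h)"
      by (rule prod.cong) (auto simp: Basis_vec_def b_def inner_axis)
    then show ?thesis by simp
  qed
  have le: "c \<in> Basis \<Longrightarrow> a \<bullet> c \<le> b \<bullet> c" for c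
    using assms by (auto simp: Basis_vec_def b_def inner_axis)
  have 1: "box a b \<subseteq> half_box a h" and 2: "half_box a h \<subseteq> cbox a b"
    using assms by (auto simp: half_box_def mem_box_cart b_def less_imp_le)
  have "emeasure lborel (box a b) \<le> emeasure lborel (half_box a h)"
    by (rule emeasure_mono[OF 1]) simp
  moreover have "emeasure lborel (half_box a h) \<le> emeasure lborel (cbox a b)"
    by (rule emeasure_mono[OF 2]) simp
  ultimately show ?thesis
    using le prod by (simp add: emeasure_lborel_box_eq emeasure_lborel_cbox_eq)
qed

lemma cube_half_box: "cube Q = half_box (corner Q) (side Q)"
  by (simp add: cube_def half_box_def)

lemma cube_sets [measurable]: "cube Q \<in> sets borel"
  by (simp add: cube_half_box)

lemma emeasure_cube: "emeasure lborel (cube (Q :: 'n::finite dyadic)) = ennreal (side Q ^ CARD('n))"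
  using emeasure_half_box[OF side_pos] by (simp add: cube_half_box)

lemma volume_eq: "volume (Q :: 'n::finite dyadic) = side Q ^ CARD('n)"
  using side_pos[of Q] by (simp add: volume_def measure_def emeasure_cube)

lemma volume_powr: "volume (Q :: 'n::finite dyadic) = 2 powr (- real_of_int (fst Q) * real CARD('n))"
  by (simp add: volume_eq side_def powr_power mult.commute)

abbreviation unit_cube :: "(real^'n::finite) set" where
  "unit_cube \<equiv> half_box 0 1"

lemma emeasure_unit_cube: "emeasure lborel (unit_cube :: (real^'n::finite) set) = 1"
  by (simp add: emeasure_half_box)

section \<open>The integer lattice, its enumeration, and unfolding of integrals over its
  cells\<close>

definition lat :: "int^'n::finite \<Rightarrow> real^'n" where
  "lat k = (\<chi> i. real_of_int (k $ i))"

lemma lat_nth [simp]: "lat k $ i = real_of_int (k $ i)"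
  by (simp add: lat_def)

text \<open>Lattice sums become series over \<open>nat\<close>, so that \<open>sums\<close>,
  \<open>suminf\<close> and the theorems exchanging a series with an integral apply
  directly.\<close>

definition lattice_enum :: "nat \<Rightarrow> int^'n::finite" where
  "lattice_enum = from_nat_into UNIV"

lemma infinite_lattice: "infinite (UNIV :: (int^'n::finite) set)"
proof
  assume "finite (UNIV :: (int^'n) set)"
  moreover have "inj (\<lambda>z::int. (\<chi> i. z) :: int^'n)"
    by (auto simp: inj_def vec_eq_iff)
  ultimately have "finite (UNIV :: int set)"
    using finite_imageD finite_subset subset_UNIV by blast
  then show False by simp
qed

lemma bij_lattice_enum: "bij (lattice_enum :: nat \<Rightarrow> int^'n::finite)"
  unfolding lattice_enum_def
  by (rule bij_betw_from_nat_into[OF _ infinite_lattice]) simp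

definition lpt :: "nat \<Rightarrow> real^'n::finite" where
  "lpt a = lat (lattice_enum a)"

text \<open>The only candidate is the vector of coordinatewise floors.\<close>

lemma ex1_lpt: "\<exists>!a. x - lpt a \<in> (unit_cube :: (real^'n::finite) set)"
proof -
  have iff: "x - lat k \<in> unit_cube \<longleftrightarrow> k = (\<chi> i. \<lfloor>x $ i\<rfloor>)" for k
    by (auto simp: half_box_def vec_eq_iff algebra_simps floor_eq_iff eq_commute[of _ "\<lfloor>_\<rfloor>"])
  obtain a where a: "lattice_enum a = (\<chi> i. \<lfloor>x $ i\<rfloor>)"
    using bij_lattice_enum by (metis bij_pointE)
  show ?thesis
    using a bij_lattice_enum unfolding lpt_def iff
    by (metis bij_pointE)
qed

text \<open>Translates of a half-open cube tile the space exactly, not merely up to null sets, so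
  just one term of the series survives.\<close>

lemma suminf_unit_cube_indicator:
  fixes x :: "real^'n::finite" and y :: ennreal
  shows "(\<Sum>a. indicator unit_cube (x - lpt a) * y) = y"
proof -
  obtain a0 where a0: "x - lpt a0 \<in> unit_cube" and u: "\<And>a. x - lpt a \<in> unit_cube \<Longrightarrow> a = a0"
    using ex1_lpt[of x] by blast
  have "(\<Sum>a. indicator unit_cube (x - lpt a) * y) = (\<Sum>a\<in>{a0}. indicator unit_cube (x - lpt a) * y)"
    by (rule suminf_finite) (use u in \<open>auto simp: indicator_def\<close>)
  then show ?thesis using a0 by simp
qed

lemma sums_unit_cube_indicator:
  fixes x :: "real^'n::finite" and y :: "'b::real_normed_vector"
  shows "(\<lambda>a. indicator unit_cube (x - lpt a) *\<^sub>R y) sums y"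
proof -
  obtain a0 where a0: "x - lpt a0 \<in> unit_cube" and u: "\<And>a. x - lpt a \<in> unit_cube \<Longrightarrow> a = a0"
    using ex1_lpt[of x] by blast
  have "(\<lambda>a. indicator unit_cube (x - lpt a) *\<^sub>R y) sums (\<Sum>a\<in>{a0}. indicator unit_cube (x - lpt a) *\<^sub>R y)"
    by (rule sums_finite) (use u in \<open>auto simp: indicator_def\<close>)
  then show ?thesis using a0 by simp
qed

lemma nn_integral_unfold:
  fixes g :: "real^'n::finite \<Rightarrow> ennreal"
  assumes [measurable]: "g \<in> borel_measurable borel"
  shows "(\<integral>\<^sup>+x. g x \<partial>lborel) = (\<Sum>a. \<integral>\<^sup>+x. indicator unit_cube x * g (x + lpt a) \<partial>lborel)"
proof -
  have "(\<integral>\<^sup>+x. g x \<partial>lborel) = (\<integral>\<^sup>+x. (\<Sum>a. indicator unit_cube (x - lpt a) * g x) \<partial>lborel)"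
    by (simp only: suminf_unit_cube_indicator)
  also have "\<dots> = (\<Sum>a. \<integral>\<^sup>+x. indicator unit_cube (x - lpt a) * g x \<partial>lborel)"
    by (rule nn_integral_suminf) simp
  also have "\<dots> = (\<Sum>a. \<integral>\<^sup>+x. indicator unit_cube x * g (x + lpt a) \<partial>lborel)"
  proof (rule arg_cong[where f=suminf], rule ext)
    fix a
    show "(\<integral>\<^sup>+x. indicator unit_cube (x - lpt a) * g x \<partial>lborel) = (\<integral>\<^sup>+x. indicator unit_cube x * g (x + lpt a) \<partial>lborel)"
      by (subst nn_integral_affine[where c=1 and t="lpt a"]) (simp_all add: add.commute)
  qed
  finally show ?thesis .
qed

lemma integral_unfold:
  fixes g :: "real^'n::finite \<Rightarrow> complex"
  assumes g: "integrable lborel g"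
  shows "(\<lambda>a. \<integral>x. indicator unit_cube x *\<^sub>R g (x + lpt a) \<partial>lborel) sums (\<integral>x. g x \<partial>lborel)"
proof -
  have [measurable]: "g \<in> borel_measurable borel"
    using g by (auto dest: borel_measurable_integrable)
  define f where "f a x = indicator unit_cube (x - lpt a) *\<^sub>R g x" for a :: nat and x :: "real^'n"
  have int: "integrable lborel (f a)" for a
    unfolding f_def by (rule Bochner_Integration.integrable_bound[OF g]) (auto simp: indicator_def)
  have nf: "norm (f a x) = indicator unit_cube (x - lpt a) *\<^sub>R norm (g x)" for a x
    by (simp add: f_def)
  have eq: "(\<Sum>a. f a x) = g x" for x
    unfolding f_def using sums_unit_cube_indicator[of x "g x"] by (simp add: sums_iff)
  \<comment> \<open>Tonelli on the norms supplies the absolute summability under which the signed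
    series may be integrated termwise.\<close>
  have fin: "(\<Sum>a. ennreal (\<integral>x. norm (f a x) \<partial>lborel)) < \<infinity>"
  proof -
    have "(\<Sum>a. ennreal (\<integral>x. norm (f a x) \<partial>lborel)) = (\<Sum>a. \<integral>\<^sup>+x. ennreal (norm (f a x)) \<partial>lborel)"
      by (simp add: nn_integral_eq_integral int)
    also have "\<dots> = (\<integral>\<^sup>+x. (\<Sum>a. ennreal (norm (f a x))) \<partial>lborel)"
      by (rule nn_integral_suminf[symmetric]) (auto simp: f_def)
    also have "\<dots> = (\<integral>\<^sup>+x. ennreal (norm (g x)) \<partial>lborel)"
    proof (rule nn_integral_cong)
      fix x
      have "ennreal (norm (f a x)) = indicator unit_cube (x - lpt a) * ennreal (norm (g x))" for a
        by (simp add: nf indicator_def)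
      then show "(\<Sum>a. ennreal (norm (f a x))) = ennreal (norm (g x))"
        by (simp only: suminf_unit_cube_indicator)
    qed
    finally show ?thesis using g by (simp add: integrable_iff_bounded)
  qed
  have "(\<lambda>a. integral\<^sup>L lborel (f a)) sums (\<integral>x. (\<Sum>a. f a x) \<partial>lborel)"
  proof (rule sums_integral[OF int])
    show "AE x in lborel. summable (\<lambda>a. norm (f a x))"
      unfolding nf using sums_unit_cube_indicator[of _ "norm (g _)"] by (auto simp: sums_iff)
    show "summable (\<lambda>a. \<integral>x. norm (f a x) \<partial>lborel)"
      by (rule summable_suminf_not_top) (use fin in auto)
  qed
  moreover have "integral\<^sup>L lborel (f a) = (\<integral>x. indicator unit_cube x *\<^sub>R g (x + lpt a) \<partial>lborel)" for a
    unfolding f_def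
    by (subst integral_affine[where c=1 and t="lpt a"]) (use int[unfolded f_def] in \<open>simp_all add: add.commute\<close>)
  ultimately show ?thesis by (simp add: eq)
qed

text \<open>A product of one-dimensional weights rather than a power of \<open>1 + norm x\<close>:
  its lattice sums factor over the coordinates, any decay of order twice the dimension is dominated
  by it, and bounded displacements change it only by a constant factor.\<close>

definition wt :: "real^'n::finite \<Rightarrow> real" where
  "wt x = (\<Prod>i\<in>UNIV. 1 / (1 + \<bar>x $ i\<bar>)\<^sup>2)"

lemma wt_pos: "wt x > 0"
  unfolding wt_def by (intro prod_pos) (auto intro!: divide_pos_pos zero_less_power)

lemma wt_measurable [measurable]: "wt \<in> borel_measurable borel"
  unfolding wt_def[abs_def] by measurable

lemma wt_le_1: "wt x \<le> 1"
  unfolding wt_def by (intro prod_le_1) (auto simp: field_simps intro!: one_le_power)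

lemma wt_minus_commute: "wt (x - y) = wt (y - x)"
  by (simp add: wt_def abs_minus_commute)

text \<open>Every coordinate is bounded by the norm, so each factor is at least the inverse square
  of \<open>1 + norm x\<close>. This is how rapid decay is converted into a bound by
  \<open>wt\<close>.\<close>

lemma wt_ge: "wt (x :: real^'n::finite) \<ge> 1 / (1 + norm x) ^ (2 * CARD('n))"
proof -
  have "(\<Prod>i\<in>(UNIV::'n set). 1 / (1 + norm x)\<^sup>2) \<le> wt x"
    unfolding wt_def
    by (intro prod_mono) (auto intro!: divide_left_mono power_mono mult_pos_pos zero_less_power
        component_le_norm_cart add_pos_nonneg)
  then show ?thesis by (simp add: power_one_over power_mult)
qed

text \<open>Moving a coordinate by at most 1 changes \<open>1 + \<bar>x $ i\<bar>\<close> by at most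
  the factor 2, hence its square by 4.\<close>

lemma wt_near:
  fixes x y :: "real^'n::finite"
  assumes "\<And>i. \<bar>x $ i - y $ i\<bar> \<le> 1"
  shows "wt x \<le> 4 ^ CARD('n) * wt y"
proof -
  have "wt x \<le> (\<Prod>i\<in>(UNIV::'n set). 4 * (1 / (1 + \<bar>y $ i\<bar>)\<^sup>2))"
    unfolding wt_def
  proof (intro prod_mono conjI)
    fix i
    have "1 + \<bar>y $ i\<bar> \<le> 2 * (1 + \<bar>x $ i\<bar>)"
      using assms[of i] abs_ge_zero[of "x $ i"] by (smt (verit))
    then have "(1 + \<bar>y $ i\<bar>)\<^sup>2 \<le> (2 * (1 + \<bar>x $ i\<bar>))\<^sup>2"
      by (intro power_mono) auto
    then show "1 / (1 + \<bar>x $ i\<bar>)\<^sup>2 \<le> 4 * (1 / (1 + \<bar>y $ i\<bar>)\<^sup>2)"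
      by (simp add: field_simps power2_eq_square add_pos_nonneg)
  qed simp
  also have "\<dots> = 4 ^ CARD('n) * wt y"
    by (simp add: wt_def prod.distrib power_one_over prod_dividef)
  finally show ?thesis .
qed

text \<open>The correction \<open>2 / (real N + 1)\<close> is there for the induction: the two new
  terms are at most 2/((N+1)(N+2)), which telescopes.\<close>

lemma sum_int_interval_le: "(\<Sum>b = - int N..int N. 1 / (1 + \<bar>real_of_int b\<bar>)\<^sup>2) \<le> 3 - 2 / (real N + 1)"
proof (induction N)
  case (Suc N)
  have "{- int (Suc N)..int (Suc N)} = insert (int (Suc N)) (insert (- int (Suc N)) {- int N..int N})"
    by auto
  then have "(\<Sum>b = - int (Suc N)..int (Suc N). 1 / (1 + \<bar>real_of_int b\<bar>)\<^sup>2)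
      = 2 / (real N + 2)\<^sup>2 + (\<Sum>b = - int N..int N. 1 / (1 + \<bar>real_of_int b\<bar>)\<^sup>2)"
    by (simp add: algebra_simps)
  also have "\<dots> \<le> 2 / ((real N + 1) * (real N + 2)) + (3 - 2 / (real N + 1))"
    by (intro add_mono Suc.IH) (auto simp: power2_eq_square intro!: divide_left_mono mult_right_mono)
  also have "\<dots> = 3 - 2 / (real (Suc N) + 1)"
    by (simp add: divide_simps) (simp add: algebra_simps)
  finally show ?case .
qed simp

lemma sum_int_le:
  fixes B :: "int set"
  assumes "finite B"
  shows "(\<Sum>b\<in>B. 1 / (1 + \<bar>real_of_int b\<bar>)\<^sup>2) \<le> 3"
proof -
  define N where "N = Max (insert 0 ((\<lambda>b. nat \<bar>b\<bar>) ` B))"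
  have "nat \<bar>b\<bar> \<le> N" if "b \<in> B" for b
    unfolding N_def using that assms by (intro Max_ge) auto
  then have "B \<subseteq> {- int N..int N}"
    by (force simp: nat_le_iff)
  then have "(\<Sum>b\<in>B. 1 / (1 + \<bar>real_of_int b\<bar>)\<^sup>2) \<le> (\<Sum>b = - int N..int N. 1 / (1 + \<bar>real_of_int b\<bar>)\<^sup>2)"
    by (intro sum_mono2) auto
  also have "\<dots> \<le> 3 - 2 / (real N + 1)" by (rule sum_int_interval_le)
  also have "\<dots> \<le> 3" by simp
  finally show ?thesis .
qed

text \<open>A finite set of lattice points lies in a power of the set \<open>B\<close> of all its
  coordinates, and over that power the sum factors into one-dimensional sums, each at most
  3.\<close>

lemma sum_wt_lat_le:
  fixes F :: "(int^'n::finite) set"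
  assumes "finite F"
  shows "(\<Sum>k\<in>F. wt (lat k)) \<le> 3 ^ CARD('n)"
proof -
  define B where "B = (\<Union>k\<in>F. range (\<lambda>i. k $ i))"
  have B: "finite B" using assms by (simp add: B_def)
  define P where "P = (PiE (UNIV :: 'n set) (\<lambda>_. B))"
  have inj: "inj_on (vec_nth :: int^'n \<Rightarrow> _) F" by (simp add: inj_on_def vec_nth_inject)
  have "(\<Sum>k\<in>F. wt (lat k)) = (\<Sum>g\<in>vec_nth ` F. \<Prod>i\<in>UNIV. 1 / (1 + \<bar>real_of_int (g i)\<bar>)\<^sup>2)"
    by (subst sum.reindex[OF inj]) (simp add: wt_def)
  also have "\<dots> \<le> (\<Sum>g\<in>P. \<Prod>i\<in>UNIV. 1 / (1 + \<bar>real_of_int (g i)\<bar>)\<^sup>2)"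
    by (rule sum_mono2) (auto simp: P_def B intro!: finite_PiE prod_nonneg, auto simp: B_def)
  also have "\<dots> = (\<Prod>i\<in>(UNIV :: 'n set). \<Sum>b\<in>B. 1 / (1 + \<bar>real_of_int b\<bar>)\<^sup>2)"
    unfolding P_def by (subst prod_sum_PiE) (auto simp: B)
  also have "\<dots> \<le> (\<Prod>i\<in>(UNIV :: 'n set). 3)"
    by (intro prod_mono) (auto intro!: sum_nonneg sum_int_le B)
  finally show ?thesis by simp
qed

text \<open>The constant is 12 = 4 * 3 per coordinate: 4 for replacing \<open>u\<close> by its
  integer part, 3 for the lattice sum that remains after reindexing. Uniformity in \<open>u\<close>
  is what later yields constants independent of the point and the scale.\<close>

lemma sum_wt_le:
  fixes u :: "real^'n::finite"
  shows "(\<Sum>a<m. wt (lpt a + u)) \<le> 12 ^ CARD('n)"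
proof -
  define v :: "int^'n" where "v = (\<chi> i. \<lfloor>u $ i\<rfloor>)"
  have "\<bar>(lpt a + u) $ i - lat (lattice_enum a + v) $ i\<bar> \<le> 1" for a i
    unfolding lpt_def lat_def v_def by simp linarith
  then have "(\<Sum>a<m. wt (lpt a + u)) \<le> (\<Sum>a<m. 4 ^ CARD('n) * wt (lat (lattice_enum a + v)))"
    by (intro sum_mono wt_near)
  also have "\<dots> = 4 ^ CARD('n) * (\<Sum>k\<in>(\<lambda>a. lattice_enum a + v) ` {..<m}. wt (lat k))"
    using bij_lattice_enum
    by (subst sum.reindex) (auto simp: inj_on_def bij_def sum_distrib_left)
  also have "\<dots> \<le> 4 ^ CARD('n) * 3 ^ CARD('n)"
    by (intro mult_left_mono sum_wt_lat_le) auto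
  also have "\<dots> = 12 ^ CARD('n)" by (simp flip: power_mult_distrib)
  finally show ?thesis .
qed

lemma summable_wt: "summable (\<lambda>a. wt (lpt a + u :: real^'n::finite))"
  by (rule summableI_nonneg_bounded[OF less_imp_le[OF wt_pos] sum_wt_le])

lemma suminf_wt_le: "(\<Sum>a. wt (lpt a + u :: real^'n::finite)) \<le> 12 ^ CARD('n)"
  by (rule suminf_le_const[OF summable_wt sum_wt_le])

lemma summable_wt_minus: "summable (\<lambda>a. wt (u - lpt a :: real^'n::finite))"
  using summable_wt[of "- u"] by (subst wt_minus_commute) simp

lemma wt_shift_unit_cube:
  fixes t u :: "real^'n::finite"
  assumes "t \<in> unit_cube"
  shows "wt (u + t) \<le> 4 ^ CARD('n) * wt u" "wt (u - t) \<le> 4 ^ CARD('n) * wt u"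
  using assms by (auto intro!: wt_near simp: half_box_def)  (smt (verit))+

text \<open>On a lattice cell the weight is comparable with its value at the corner of the cell, so
  the integral is dominated by a lattice sum.\<close>

lemma integrable_wt: "integrable lborel (wt :: real^'n::finite \<Rightarrow> real)"
proof -
  have "(\<integral>\<^sup>+x. ennreal (wt (x :: real^'n)) \<partial>lborel)
      = (\<Sum>a. \<integral>\<^sup>+x. indicator unit_cube (x :: real^'n) * ennreal (wt (x + lpt a)) \<partial>lborel)"
    by (rule nn_integral_unfold) simp
  also have "\<dots> \<le> (\<Sum>a. ennreal (4 ^ CARD('n) * wt (lpt a :: real^'n)))"
  proof (rule suminf_le)
    fix a
    have "(\<integral>\<^sup>+x. indicator unit_cube (x :: real^'n) * ennreal (wt (x + lpt a)) \<partial>lborel)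
        \<le> (\<integral>\<^sup>+x. ennreal (4 ^ CARD('n) * wt (lpt a :: real^'n)) * indicator unit_cube (x :: real^'n) \<partial>lborel)"
      using wt_shift_unit_cube(1)[of _ "lpt a :: real^'n"]
      by (intro nn_integral_mono) (auto simp: indicator_def add.commute intro!: ennreal_leI)
    also have "\<dots> = ennreal (4 ^ CARD('n) * wt (lpt a :: real^'n))"
      by (subst nn_integral_cmult_indicator) (auto simp: emeasure_unit_cube)
    finally show "(\<integral>\<^sup>+x. indicator unit_cube (x :: real^'n) * ennreal (wt (x + lpt a)) \<partial>lborel)
        \<le> ennreal (4 ^ CARD('n) * wt (lpt a :: real^'n))" .
  qed auto
  also have "\<dots> < \<infinity>"
    using summable_wt[of 0] wt_pos[THEN less_imp_le]
    by (subst suminf_ennreal2) (auto intro!: summable_mult mult_nonneg_nonneg)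
  finally show ?thesis
    by (simp add: integrable_iff_bounded abs_of_pos wt_pos)
qed

section \<open>Rapidly decreasing functions and their Fourier transforms\<close>

text \<open>Decay is kept apart from continuity: the sampling kernels are provided only with decay
  and measurability, whereas the Poisson argument is run for \<open>rapid\<close> functions.\<close>

definition rapid_decay :: "(real^'n::finite \<Rightarrow> complex) \<Rightarrow> bool" where
  "rapid_decay h \<longleftrightarrow> (\<forall>N. \<exists>C. \<forall>x. (1 + norm x) ^ N * norm (h x) \<le> C)"

definition rapid :: "(real^'n::finite \<Rightarrow> complex) \<Rightarrow> bool" where
  "rapid h \<longleftrightarrow> continuous_on UNIV h \<and> rapid_decay h"

lemma rapid_decayD:
  assumes "rapid_decay h"
  obtains C where "C > 0" "\<And>x. norm (h x) \<le> C / (1 + norm x) ^ N"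
proof -
  obtain C where C: "\<And>x. (1 + norm x) ^ N * norm (h x) \<le> C"
    using assms unfolding rapid_decay_def by blast
  have "norm (h x) \<le> (\<bar>C\<bar> + 1) / (1 + norm x) ^ N" for x
    using C[of x] by (simp add: field_simps add_pos_nonneg)
  then show ?thesis by (intro that[of "\<bar>C\<bar> + 1"]) auto
qed

lemma rapid_decay_wt:
  assumes "rapid_decay h"
  obtains C where "C > 0" "\<And>x. norm (h x) \<le> C * wt x"
proof -
  obtain C where "C > 0" and C: "\<And>x. norm (h x) \<le> C / (1 + norm x) ^ (2 * CARD('a))"
    using rapid_decayD[OF assms] by blast
  have "norm (h x) \<le> C * wt x" for x
    using C[of x] mult_left_mono[OF wt_ge[of x] less_imp_le[OF \<open>C > 0\<close>]] by simp
  then show ?thesis using that \<open>C > 0\<close> by blast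
qed

lemma rapid_continuous: "rapid h \<Longrightarrow> continuous_on UNIV h"
  by (simp add: rapid_def)

lemma rapid_measurable: "rapid h \<Longrightarrow> h \<in> borel_measurable borel"
  using borel_measurable_continuous_onI by (auto simp: rapid_def)

lemma rapid_wt:
  assumes "rapid h"
  obtains C where "C > 0" "\<And>x. norm (h x) \<le> C * wt x"
  using assms rapid_decay_wt unfolding rapid_def by blast

lemma rapid_integrable:
  assumes "rapid h"
  shows "integrable lborel h"
proof -
  obtain C where C: "C > 0" "\<And>x. norm (h x) \<le> C * wt x" using rapid_wt[OF assms] by blast
  have "integrable lborel (\<lambda>x. C * wt x)" using integrable_wt by (intro integrable_mult_right) auto
  then show ?thesis
  proof (rule Bochner_Integration.integrable_bound)
    show "h \<in> borel_measurable lborel" using rapid_measurable[OF assms] by simp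
    show "AE x in lborel. norm (h x) \<le> norm (C * wt x)"
      using C by (auto simp: abs_mult abs_of_pos wt_pos)
  qed
qed

lemma rapid_mult_bounded:
  assumes "rapid h" "continuous_on UNIV b" "\<And>x. norm (b x) \<le> B"
  shows "rapid (\<lambda>x. h x * b x)"
  unfolding rapid_def rapid_decay_def
proof (intro conjI allI)
  show "continuous_on UNIV (\<lambda>x. h x * b x)"
    using assms by (intro continuous_on_mult) (auto simp: rapid_def)
  fix N
  obtain C where C: "\<And>x. (1 + norm x) ^ N * norm (h x) \<le> C"
    using assms unfolding rapid_def rapid_decay_def by blast
  have "(1 + norm x) ^ N * norm (h x * b x) \<le> C * B" for x
  proof -
    have "(1 + norm x) ^ N * norm (h x * b x) = ((1 + norm x) ^ N * norm (h x)) * norm (b x)"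
      by (simp add: norm_mult)
    also have "\<dots> \<le> C * B"
      by (rule mult_mono[OF C assms(3)]) (auto intro: order_trans[OF _ C[of x]])
    finally show ?thesis .
  qed
  then show "\<exists>C. \<forall>x. (1 + norm x) ^ N * norm (h x * b x) \<le> C" by blast
qed

lemma rapid_mult_coord:
  assumes "rapid h"
  shows "rapid (\<lambda>x. of_real (x $ i) * h x)"
  unfolding rapid_def rapid_decay_def
proof (intro conjI allI)
  show "continuous_on UNIV (\<lambda>x. of_real (x $ i) * h x)"
    using assms by (intro continuous_intros) (auto simp: rapid_def)
  fix N
  obtain C where C: "\<And>x. (1 + norm x) ^ (Suc N) * norm (h x) \<le> C"
    using assms unfolding rapid_def rapid_decay_def by blast
  have "(1 + norm x) ^ N * norm (of_real (x $ i) * h x) \<le> C" for x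
  proof -
    have "(1 + norm x) ^ N * norm (of_real (x $ i) * h x) = \<bar>x $ i\<bar> * ((1 + norm x) ^ N * norm (h x))"
      by (simp add: norm_mult)
    also have "\<dots> \<le> (1 + norm x) * ((1 + norm x) ^ N * norm (h x))"
      using component_le_norm_cart[of x i] by (intro mult_right_mono) auto
    also have "\<dots> \<le> C" using C[of x] by (simp add: mult.assoc)
    finally show ?thesis .
  qed
  then show "\<exists>C. \<forall>x. (1 + norm x) ^ N * norm (of_real (x $ i) * h x) \<le> C" by blast
qed

text \<open>Decay passes through an affine map at a cost that is polynomial in the translation
  \<open>b\<close>. The explicit dependence on \<open>b\<close> matters when \<open>b\<close> runs
  through lattice points.\<close>

lemma norm_affine_le:
  fixes x b :: "'a::real_normed_vector"
  assumes "a \<noteq> 0"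
  shows "1 + norm x \<le> (1 + norm b) * (1 + 1 / \<bar>a\<bar>) * (1 + norm (b + a *\<^sub>R x))"
proof -
  define z where "z = b + a *\<^sub>R x"
  have "x = (1 / a) *\<^sub>R (z - b)" using assms by (simp add: z_def)
  then have "norm x = (1 / \<bar>a\<bar>) * norm (z - b)" by simp
  also have "\<dots> \<le> (1 / \<bar>a\<bar>) * (norm z + norm b)"
    by (intro mult_left_mono norm_triangle_ineq4) auto
  finally have "norm x \<le> (1 / \<bar>a\<bar>) * (norm z + norm b)" .
  moreover define c where "c = 1 / \<bar>a\<bar>"
  moreover have "1 + c * (norm z + norm b) \<le> (1 + norm b) * (1 + c) * (1 + norm z)"
  proof -
    have "c \<ge> 0" by (simp add: c_def)
    have "(1 + norm b) * (1 + c) * (1 + norm z) = 1 + c * (norm z + norm b)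
        + (norm z + norm b + c + norm b * norm z + norm b * norm z * c)"
      by (simp add: algebra_simps)
    moreover have "0 \<le> norm z + norm b + c + norm b * norm z + norm b * norm z * c"
      using \<open>c \<ge> 0\<close> by (intro add_nonneg_nonneg mult_nonneg_nonneg) auto
    ultimately show ?thesis by linarith
  qed
  ultimately show ?thesis unfolding z_def c_def by (metis add_left_mono order_trans)
qed

lemma rapid_affine:
  assumes "rapid h" "a \<noteq> 0"
  shows "rapid (\<lambda>x. h (b + a *\<^sub>R x))"
  unfolding rapid_def rapid_decay_def
proof (intro conjI allI)
  show "continuous_on UNIV (\<lambda>x. h (b + a *\<^sub>R x))"
    by (rule continuous_on_compose2[OF rapid_continuous[OF assms(1)]]) (auto intro!: continuous_intros)
  fix N
  obtain C where C: "\<And>x. (1 + norm x) ^ N * norm (h x) \<le> C"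
    using assms unfolding rapid_def rapid_decay_def by blast
  define D where "D = (1 + norm b) * (1 + 1 / \<bar>a\<bar>)"
  have D: "D \<ge> 0" unfolding D_def by (intro mult_nonneg_nonneg add_nonneg_nonneg) auto
  have "(1 + norm x) ^ N * norm (h (b + a *\<^sub>R x)) \<le> D ^ N * C" for x
  proof -
    have "(1 + norm x) ^ N * norm (h (b + a *\<^sub>R x))
        \<le> (D * (1 + norm (b + a *\<^sub>R x))) ^ N * norm (h (b + a *\<^sub>R x))"
      using norm_affine_le[OF assms(2), of x b] by (intro mult_right_mono power_mono) (auto simp: D_def)
    also have "\<dots> = D ^ N * ((1 + norm (b + a *\<^sub>R x)) ^ N * norm (h (b + a *\<^sub>R x)))"
      by (simp add: power_mult_distrib)
    also have "\<dots> \<le> D ^ N * C" by (intro mult_left_mono C zero_le_power D)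
    finally show ?thesis .
  qed
  then show "\<exists>C. \<forall>x. (1 + norm x) ^ N * norm (h (b + a *\<^sub>R x)) \<le> C" by blast
qed

lemma rapid_translate: "rapid h \<Longrightarrow> rapid (\<lambda>x. h (x + v))"
  using rapid_affine[of h 1 v] by (simp add: add.commute)

lemma rapid_mult_cis: "rapid h \<Longrightarrow> rapid (\<lambda>x. h x * cis (- (x \<bullet> \<xi>)))"
  by (rule rapid_mult_bounded[where B=1]) (auto intro!: continuous_intros)

lemma fourier_continuous:
  assumes "rapid h"
  shows "continuous_on UNIV (fourier h)"
  unfolding continuous_on_eq_continuous_at[OF open_UNIV] continuous_at_sequentially
proof (intro ballI allI impI)
  fix \<xi> :: "real^'a" and X assume X: "X \<longlonglongrightarrow> \<xi>"
  have [measurable]: "h \<in> borel_measurable borel" by (rule rapid_measurable[OF assms])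
  show "(fourier h \<circ> X) \<longlonglongrightarrow> fourier h \<xi>"
    unfolding comp_def fourier_def
  proof (rule integral_dominated_convergence[where w="\<lambda>x. norm (h x)"])
    show "integrable lborel (\<lambda>x. norm (h x))"
      using rapid_integrable[OF assms] by simp
    show "AE x in lborel. (\<lambda>i. h x * cis (- (x \<bullet> X i))) \<longlonglongrightarrow> h x * cis (- (x \<bullet> \<xi>))"
      using X by (auto simp: cis_conv_exp intro!: tendsto_intros)
  qed (auto simp: norm_mult rapid_measurable[OF rapid_mult_cis[OF assms]])
qed

section \<open>Fourier coefficients on the unit cube\<close>

definition character :: "int^'n::finite \<Rightarrow> real^'n \<Rightarrow> complex" where
  "character m u = cis (2 * pi * (u \<bullet> lat m))"

lemma character_0 [simp]: "character 0 u = 1"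
  by (simp add: character_def inner_vec_def)

lemma norm_character [simp]: "norm (character m u) = 1"
  by (simp add: character_def)

lemma continuous_on_character [continuous_intros]:
  "continuous_on UNIV (character m)"
  unfolding character_def cis_conv_exp by (intro continuous_intros)

lemma character_measurable [measurable]: "character m \<in> borel_measurable borel"
  by (rule borel_measurable_continuous_onI[OF continuous_on_character])

lemma character_add: "character m (u + v) = character m u * character m v"
  by (simp add: character_def cis_mult inner_simps algebra_simps)

lemma inner_lat: "lat k \<bullet> lat m = real_of_int (\<Sum>i\<in>UNIV. k $ i * m $ i)"
  by (simp add: inner_vec_def)

lemma character_lat [simp]: "character m (lat k) = 1"
proof -
  have "cis (2 * pi * real_of_int n) = 1" for n
    using cis_multiple_2pi[of "real_of_int n"] by (simp add: mult.commute)
  then show ?thesis unfolding character_def inner_lat .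
qed

lemma character_add_lpt [simp]: "character m (u + lpt a) = character m u"
  by (simp add: character_add lpt_def)

text \<open>Translating the unit cube inside the torus by half a period of the character changes the sign
  of the integral.\<close>

lemma integral_character_unit_cube:
  fixes m :: "int^'n::finite"
  assumes "m \<noteq> 0"
  shows "(\<integral>u. indicator unit_cube u *\<^sub>R character m u \<partial>lborel) = 0"
proof -
  obtain i where i: "m $ i \<noteq> 0" using assms by (metis vec_eq_iff zero_index)
  define h where "h = 1 / (2 * real_of_int \<bar>m $ i\<bar>)"
  have "real_of_int \<bar>m $ i\<bar> \<ge> 1" using i by linarith
  then have h: "0 < h" "h < 1" by (auto simp: h_def field_simps)
  define v where "v = axis i h"
  define J where "J = (\<integral>u. indicator unit_cube u *\<^sub>R character m u \<partial>lborel)"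
  have [measurable]: "{x :: real^'n. h \<le> x $ i} \<in> sets borel" "{x :: real^'n. x $ i < h} \<in> sets borel"
    by measurable
  have iU: "integrable lborel (\<lambda>u. indicator unit_cube u *\<^sub>R (1::real))"
    by (simp add: emeasure_unit_cube)
  have int: "integrable lborel (\<lambda>u. indicator unit_cube u *\<^sub>R character m u)"
    by (rule Bochner_Integration.integrable_bound[OF iU]) auto
  have int1: "integrable lborel (\<lambda>u. indicator unit_cube u *\<^sub>R indicator {x. h \<le> x $ i} u *\<^sub>R character m u)"
    by (rule Bochner_Integration.integrable_bound[OF iU]) (auto simp: indicator_def)
  have int2: "integrable lborel (\<lambda>u. indicator unit_cube u *\<^sub>R indicator {x. x $ i < h} u *\<^sub>R character m u)"
    by (rule Bochner_Integration.integrable_bound[OF iU]) (auto simp: indicator_def)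
  let ?e = "axis i (1::real) :: real^'n"
  have e_lat: "?e = lat (axis i 1)"
    by (simp add: vec_eq_iff axis_def)
  have ce: "character m (u - ?e) = character m u" for u
    using character_add[of m "u - ?e" ?e] by (simp add: e_lat)
  have int2': "integrable lborel (\<lambda>u. indicator unit_cube (u - ?e) *\<^sub>R indicator {x. x $ i < h} (u - ?e) *\<^sub>R character m u)"
    using integrable_affine[OF int2, of 1 "- ?e"] by (simp add: ce)
  have intv: "integrable lborel (\<lambda>u. indicator unit_cube (u - v) *\<^sub>R character m u)"
    using integrable_affine[OF iU, of 1 "- v"]
    by (rule Bochner_Integration.integrable_bound) (auto simp: indicator_def)
  have "character m v * J = (\<integral>u. indicator unit_cube u *\<^sub>R character m (u + v) \<partial>lborel)"
    unfolding J_def by (subst integral_mult_right_zero[symmetric])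
      (auto intro!: Bochner_Integration.integral_cong simp: character_add)
  also have "\<dots> = (\<integral>u. indicator unit_cube (u - v) *\<^sub>R character m u \<partial>lborel)"
    using integral_affine[OF _ intv, of 1 v] by (simp add: add.commute)
  \<comment> \<open>The translated cube overhangs the unit cube by a slab of thickness
    \<open>h\<close> in direction \<open>i\<close>; moving this slab back by one lattice step fills
    the gap, and the character does not see the move.\<close>
  also have "\<dots> = (\<integral>u. indicator unit_cube u *\<^sub>R indicator {x. h \<le> x $ i} u *\<^sub>R character m u
      + indicator unit_cube (u - ?e) *\<^sub>R indicator {x. x $ i < h} (u - ?e) *\<^sub>R character m u \<partial>lborel)"
  proof (intro Bochner_Integration.integral_cong refl)
    fix x :: "real^'n"
    have A: "x - v \<in> unit_cube \<longleftrightarrow> (\<forall>j. j \<noteq> i \<longrightarrow> 0 \<le> x $ j \<and> x $ j < 1) \<and> h \<le> x $ i \<and> x $ i < 1 + h"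
      unfolding half_box_def v_def axis_def by (auto split: if_splits)
    have B: "x \<in> unit_cube \<longleftrightarrow> (\<forall>j. j \<noteq> i \<longrightarrow> 0 \<le> x $ j \<and> x $ j < 1) \<and> 0 \<le> x $ i \<and> x $ i < 1"
      unfolding half_box_def by auto
    have C: "x - ?e \<in> unit_cube \<longleftrightarrow> (\<forall>j. j \<noteq> i \<longrightarrow> 0 \<le> x $ j \<and> x $ j < 1) \<and> 1 \<le> x $ i \<and> x $ i < 2"
      unfolding half_box_def axis_def by (auto split: if_splits)
    have D: "(x - ?e) $ i = x $ i - 1" by simp
    show "indicator unit_cube (x - v) *\<^sub>R character m x = indicator unit_cube x *\<^sub>R indicator {x. h \<le> x $ i} x *\<^sub>R character m x
      + indicator unit_cube (x - ?e) *\<^sub>R indicator {x. x $ i < h} (x - ?e) *\<^sub>R character m x"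
      using h unfolding indicator_def A B C mem_Collect_eq D by auto
  qed
  also have "\<dots> = (\<integral>u. indicator unit_cube u *\<^sub>R indicator {x. h \<le> x $ i} u *\<^sub>R character m u \<partial>lborel)
      + (\<integral>u. indicator unit_cube (u - ?e) *\<^sub>R indicator {x. x $ i < h} (u - ?e) *\<^sub>R character m u \<partial>lborel)"
    by (rule Bochner_Integration.integral_add[OF int1 int2'])
  also have "(\<integral>u. indicator unit_cube (u - ?e) *\<^sub>R indicator {x. x $ i < h} (u - ?e) *\<^sub>R character m u \<partial>lborel)
      = (\<integral>u. indicator unit_cube u *\<^sub>R indicator {x. x $ i < h} u *\<^sub>R character m u \<partial>lborel)"
    using integral_affine[OF _ int2', of 1 ?e] ce[of "_ + ?e"] by (simp add: add.commute)
  also have "(\<integral>u. indicator unit_cube u *\<^sub>R indicator {x. h \<le> x $ i} u *\<^sub>R character m u \<partial>lborel) + \<dots>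
      = (\<integral>u. indicator unit_cube u *\<^sub>R indicator {x. h \<le> x $ i} u *\<^sub>R character m u
          + indicator unit_cube u *\<^sub>R indicator {x. x $ i < h} u *\<^sub>R character m u \<partial>lborel)"
    by (rule Bochner_Integration.integral_add[OF int1 int2, symmetric])
  also have "\<dots> = J"
    unfolding J_def by (intro Bochner_Integration.integral_cong refl) (auto simp: indicator_def)
  finally have eq: "character m v * J = J" .
  have "character m v = cis (2 * pi * (h * real_of_int (m $ i)))"
    by (simp add: character_def v_def inner_axis')
  also have "2 * pi * (h * real_of_int (m $ i)) = pi * sgn (real_of_int (m $ i))"
    using i by (auto simp: h_def sgn_if field_simps)
  also have "cis \<dots> = -1"
    using i by (auto simp: sgn_if complex_eq_iff)
  finally have "J = 0" using eq by simp
  then show ?thesis by (simp add: J_def)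
qed

text \<open>A trigonometric polynomial with values in \<open>[0,1]\<close> that equals 1 on the unit cube only at the
  centre, so that its powers concentrate there; a function all of whose Fourier coefficients vanish
  is orthogonal to them and must therefore vanish at the centre.\<close>

definition bump_poly :: "real^'n::finite \<Rightarrow> real" where
  "bump_poly u = 1/2 - (\<Sum>i\<in>UNIV. cos (2 * pi * u $ i)) / (2 * real CARD('n))"

lemma bump_poly_alt:
  "bump_poly (u :: real^'n::finite) = (\<Sum>i\<in>UNIV. (1 - cos (2 * pi * u $ i)) / 2) / real CARD('n)"
  by (simp add: bump_poly_def sum_subtractf flip: sum_divide_distrib) (simp add: diff_divide_distrib)

lemma bump_poly_bounds: "0 \<le> bump_poly (u :: real^'n::finite)" "bump_poly u \<le> 1"
proof -
  show "0 \<le> bump_poly u"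
    unfolding bump_poly_alt by (intro divide_nonneg_nonneg sum_nonneg) auto
  have "- cos x \<le> 1" for x :: real using cos_ge_minus_one[of x] by linarith
  then have "(\<Sum>i\<in>(UNIV::'n set). (1 - cos (2 * pi * u $ i)) / 2) \<le> (\<Sum>i\<in>(UNIV::'n set). 1)"
    by (intro sum_mono) simp
  then show "bump_poly u \<le> 1" unfolding bump_poly_alt by simp
qed

text \<open>The value 1 would force every cosine to be -1, which on the closed cube happens only at
  the centre. The closed cube is taken because the maximum away from the centre is attained on a
  compact set.\<close>

lemma bump_poly_lt_1:
  fixes u :: "real^'n::finite"
  assumes "\<And>i. 0 \<le> u $ i" "\<And>i. u $ i \<le> 1" "u \<noteq> (\<chi> i. 1/2)"
  shows "bump_poly u < 1"
proof -
  obtain j where j: "u $ j \<noteq> 1/2"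
  proof (rule ccontr)
    assume "\<not> thesis"
    then have "u $ j = 1/2" for j using that by blast
    then show False using assms(3) by (simp add: vec_eq_iff)
  qed
  have "cos (pi * u $ j) \<noteq> 0"
  proof
    assume "cos (pi * u $ j) = 0"
    then have eq: "cos (pi * u $ j) = cos (pi / 2)" by (simp only: cos_pi_half)
    have 0: "0 \<le> pi * u $ j" by (rule mult_nonneg_nonneg[OF pi_ge_zero assms(1)])
    have 1: "pi * u $ j \<le> pi"
      using mult_left_mono[OF assms(2)[of j] pi_ge_zero] by (simp only: mult_1_right)
    have 2: "0 \<le> pi / 2" "pi / 2 \<le> pi" by simp_all
    have "pi * u $ j = pi / 2" by (rule cos_inj_pi[OF 0 1 2 eq])
    then have "pi * u $ j = pi * (1/2)" by (simp only: times_divide_eq_right mult_1_right)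
    then show False using j mult_left_cancel[of pi "u $ j" "1/2"] pi_neq_zero by blast
  qed
  then have "(cos (pi * u $ j))\<^sup>2 > 0" by simp
  then have "cos (2 * (pi * u $ j)) > -1"
    unfolding cos_double_cos by linarith
  then have "cos (2 * pi * u $ j) > -1" by (simp only: mult.assoc)
  then have "(1 - cos (2 * pi * u $ j)) / 2 < 1" by simp
  moreover have "- cos x \<le> 1" for x :: real using cos_ge_minus_one[of x] by linarith
  then have "\<forall>i\<in>UNIV. (1 - cos (2 * pi * u $ i)) / 2 \<le> 1" by simp
  ultimately have "(\<Sum>i\<in>(UNIV::'n set). (1 - cos (2 * pi * u $ i)) / 2) < (\<Sum>i\<in>(UNIV::'n set). 1)"
    by (intro sum_strict_mono_ex1[OF finite]) blast+
  then show ?thesis unfolding bump_poly_alt by simp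
qed

lemma bump_poly_center: "bump_poly ((\<chi> i. 1/2) :: real^'n::finite) = 1"
  by (simp add: bump_poly_def)

lemma continuous_on_bump_poly: "continuous_on UNIV bump_poly"
  unfolding bump_poly_def by (intro continuous_intros) auto

text \<open>Multiplication by a cosine moves the frequency by a unit vector in both directions, so
  the span of the characters is preserved. Orthogonality to all characters thus passes to products
  with powers of \<open>bump_poly\<close>.\<close>

lemma bump_poly_character:
  fixes m :: "int^'n::finite"
  shows "of_real (bump_poly u) * character m u = character m u / 2
    - (\<Sum>i\<in>UNIV. character (m + axis i 1) u + character (m - axis i 1) u) / (4 * of_nat CARD('n))"
proof -
  have "character (m + axis i 1) u + character (m - axis i 1) u
      = 2 * of_real (cos (2 * pi * u $ i)) * character m u" for i
  proof -
    have l: "lat (m + axis i 1) = lat m + axis i 1" "lat (m - axis i 1) = lat m - axis i 1"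
      by (auto simp: vec_eq_iff axis_def)
    have "cis (a + b) + cis (a - b) = 2 * of_real (cos b) * cis a" for a b
      by (simp add: complex_eq_iff cos_add sin_add cos_diff sin_diff)
    then show ?thesis
      by (simp only: character_def l inner_add_right inner_diff_right inner_axis distrib_left right_diff_distrib)
        (simp add: mult.assoc)
  qed
  then have eq: "(\<Sum>i\<in>UNIV. character (m + axis i 1) u + character (m - axis i 1) u)
      = 2 * of_real (\<Sum>i\<in>UNIV. cos (2 * pi * u $ i)) * character m u"
    by (simp only: of_real_sum sum_distrib_left sum_distrib_right)
  show ?thesis
    unfolding eq bump_poly_def by (simp add: left_diff_distrib)
qed

text \<open>If \<open>H\<close> did not vanish at the centre, its integral against
  \<open>bump_poly ^ N\<close> would for large \<open>N\<close> be dominated by a neighbourhood of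
  the centre and could not be zero. A statement about one point is enough, because translations
  bring every other point there.\<close>

lemma fourier_uniqueness:
  fixes H :: "real^'n::finite \<Rightarrow> complex"
  assumes cont: "continuous_on UNIV H" and bd: "\<And>u. norm (H u) \<le> B"
    and zero: "\<And>m. (\<integral>u. indicator unit_cube u *\<^sub>R (H u * character m u) \<partial>lborel) = 0"
  shows "H (\<chi> i. 1/2) = 0"
proof (rule ccontr)
  define c :: "real^'n" where "c = (\<chi> i. 1/2)"
  assume "H (\<chi> i. 1/2) \<noteq> 0"
  then have Hc: "H c \<noteq> 0" by (simp add: c_def)
  have [measurable]: "H \<in> borel_measurable borel" "bump_poly \<in> borel_measurable (borel :: (real^'n) measure)"
    by (auto intro: borel_measurable_continuous_onI cont continuous_on_bump_poly)
  have iU: "integrable lborel (\<lambda>u. indicator unit_cube u *\<^sub>R (K::real))" for K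
    by (simp add: emeasure_unit_cube)
  have B: "B \<ge> 0" using bd[of 0] norm_ge_zero order_trans by blast
  have pN: "norm (of_real (bump_poly u) ^ N :: complex) \<le> 1" for u :: "real^'n" and N
    using bump_poly_bounds[of u] by (simp add: norm_power power_le_one)
  have int: "integrable lborel (\<lambda>u. indicator unit_cube u *\<^sub>R (H u * of_real (bump_poly u) ^ N * character m u))" for N m
  proof (rule Bochner_Integration.integrable_bound[OF iU[of B]])
    show "AE x in lborel. norm (indicator unit_cube x *\<^sub>R (H x * complex_of_real (bump_poly x) ^ N * character m x))
            \<le> norm (indicator unit_cube x *\<^sub>R B)"
    proof (intro always_eventually allI)
      fix x :: "real^'n"
      have "norm (H x) * norm (of_real (bump_poly x) ^ N :: complex) \<le> B * 1"
        using B by (intro mult_mono bd pN) auto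
      then show "norm (indicator unit_cube x *\<^sub>R (H x * complex_of_real (bump_poly x) ^ N * character m x))
            \<le> norm (indicator unit_cube x *\<^sub>R B)"
        using B by (auto simp: norm_mult indicator_def)
    qed
  qed simp
  have zeroN: "(\<integral>u. indicator unit_cube u *\<^sub>R (H u * of_real (bump_poly u) ^ N * character m u) \<partial>lborel) = 0" for N m
  proof (induction N arbitrary: m)
    case 0
    then show ?case using zero by simp
  next
    case (Suc N)
    let ?F = "\<lambda>m u. indicator unit_cube u *\<^sub>R (H u * of_real (bump_poly u) ^ N * character m u)"
    have "indicator unit_cube u *\<^sub>R (H u * of_real (bump_poly u) ^ Suc N * character m u)
      = ?F m u / 2 - (\<Sum>i\<in>UNIV. ?F (m + axis i 1) u + ?F (m - axis i 1) u) / (4 * of_nat CARD('n))" for u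
    proof -
      have "indicator unit_cube u *\<^sub>R (H u * of_real (bump_poly u) ^ Suc N * character m u)
        = indicator unit_cube u *\<^sub>R (H u * of_real (bump_poly u) ^ N * (of_real (bump_poly u) * character m u))"
        by (simp add: mult_ac)
      also have "\<dots> = ?F m u / 2 - (\<Sum>i\<in>UNIV. ?F (m + axis i 1) u + ?F (m - axis i 1) u) / (4 * of_nat CARD('n))"
        unfolding bump_poly_character
        by (cases "u \<in> unit_cube") (simp_all add: right_diff_distrib sum_distrib_left distrib_left)
      finally show ?thesis .
    qed
    then show ?case
      by (simp add: Bochner_Integration.integral_diff Bochner_Integration.integral_add int Suc.IH
          Bochner_Integration.integral_sum integrable_sum)
  qed
  \<comment> \<open>A unimodular factor that turns the value at the centre into a positive real
    number, so that the real part \<open>h\<close> can be estimated from below.\<close>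
  define \<alpha> where "\<alpha> = cnj (H c) / norm (H c)"
  define h where "h u = Re (\<alpha> * H u)" for u
  have \<alpha>: "norm \<alpha> = 1" using Hc by (simp add: \<alpha>_def norm_divide)
  have hc: "h c > 0"
  proof -
    have "\<alpha> * H c = of_real (norm (H c))"
      using Hc complex_norm_square[of "H c"] by (simp add: \<alpha>_def field_simps power2_eq_square)
    then show ?thesis using Hc by (simp add: h_def)
  qed
  have hB: "\<bar>h u\<bar> \<le> B" for u
    using abs_Re_le_cmod[of "\<alpha> * H u"] bd[of u] by (simp add: h_def norm_mult \<alpha>)
  have [measurable]: "h \<in> borel_measurable borel" unfolding h_def by measurable
  have hcont: "continuous_on UNIV h"
    unfolding h_def by (intro continuous_intros cont)
  have hz: "(\<integral>u. indicator unit_cube u * (h u * bump_poly u ^ N) \<partial>lborel) = 0"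
    and hint: "integrable lborel (\<lambda>u. indicator unit_cube u * (h u * bump_poly u ^ N))" for N
  proof -
    let ?F = "\<lambda>u. indicator unit_cube u *\<^sub>R (H u * of_real (bump_poly u) ^ N * character 0 u)"
    have lin: "bounded_linear (\<lambda>z. Re (\<alpha> * z))"
      by (intro bounded_linear_compose[OF bounded_linear_Re] bounded_linear_mult_right)
    have Re_complex_of_real_times: "Re (of_real a * z) = a * Re z" for a z by simp
    have eq: "Re (\<alpha> * ?F u) = indicator unit_cube u * (h u * bump_poly u ^ N)" for u
    proof -
      have "\<alpha> * ?F u = of_real (indicator unit_cube u * bump_poly u ^ N) * (\<alpha> * H u)"
        by (simp add: scaleR_conv_of_real mult_ac)
      then have "Re (\<alpha> * ?F u) = indicator unit_cube u * bump_poly u ^ N * Re (\<alpha> * H u)"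
        by (simp only: Re_complex_of_real_times)
      then show ?thesis by (simp add: h_def mult_ac)
    qed
    show "integrable lborel (\<lambda>u. indicator unit_cube u * (h u * bump_poly u ^ N))"
      using integrable_bounded_linear[OF lin int[of N 0]] by (simp only: eq)
    show "(\<integral>u. indicator unit_cube u * (h u * bump_poly u ^ N) \<partial>lborel) = 0"
      using integral_bounded_linear[OF lin int[of N 0]] zeroN[of N 0] by (simp only: eq) simp
  qed
  obtain \<delta> where \<delta>: "\<delta> > 0" "\<And>u. dist u c < \<delta> \<Longrightarrow> h u > h c / 2"
  proof -
    have "isCont h c" using hcont by (auto simp: continuous_on_eq_continuous_at)
    then have "(h \<longlongrightarrow> h c) (nhds c)" by (simp add: isCont_def tendsto_at_iff_tendsto_nhds)
    then have "\<forall>\<^sub>F u in nhds c. h u > h c / 2"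
      using hc by (intro order_tendstoD(1)) auto
    then show ?thesis using that unfolding eventually_nhds_metric by auto
  qed
  define K where "K = cbox (0::real^'n) 1 - ball c \<delta>"
  have "compact K" unfolding K_def by (intro compact_diff) auto
  obtain P1 where P1: "0 \<le> P1" "P1 < 1" "\<And>u. u \<in> K \<Longrightarrow> bump_poly u \<le> P1"
  proof (cases "K = {}")
    case True
    then show ?thesis using that[of 0] by auto
  next
    case False
    obtain x where x: "x \<in> K" "\<And>u. u \<in> K \<Longrightarrow> bump_poly u \<le> bump_poly x"
      using continuous_attains_sup[OF \<open>compact K\<close> False continuous_on_subset[OF continuous_on_bump_poly]] by blast
    have "bump_poly x < 1"
      using x(1) \<delta>(1) by (intro bump_poly_lt_1) (auto simp: K_def c_def[symmetric] mem_box_cart)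
    then show ?thesis using that[of "bump_poly x"] x bump_poly_bounds[of x] by auto
  qed
  \<comment> \<open>Strictly between \<open>P1\<close>, which bounds the polynomial away from the
    centre, and its value 1 at the centre: the ratio \<open>P1 / P2\<close> below 1 drives the
    contradiction.\<close>
  define P2 where "P2 = (1 + P1) / 2"
  have P2: "P1 < P2" "P2 < 1" "0 < P2" using P1 by (auto simp: P2_def)
  obtain \<rho> where \<rho>: "\<rho> > 0" "\<rho> \<le> \<delta>" "\<rho> \<le> 1/2" "\<And>u. dist u c < \<rho> \<Longrightarrow> bump_poly u > P2"
  proof -
    have bc: "bump_poly c = 1" unfolding c_def by (rule bump_poly_center)
    have "isCont bump_poly c" using continuous_on_bump_poly by (auto simp: continuous_on_eq_continuous_at)
    then have "(bump_poly \<longlongrightarrow> bump_poly c) (nhds c)" by (simp add: isCont_def tendsto_at_iff_tendsto_nhds)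
    then have "\<forall>\<^sub>F u in nhds c. bump_poly u > P2"
      using P2(2) bc by (intro order_tendstoD(1)[of _ "bump_poly c"]) simp_all
    then obtain d where "d > 0" "\<And>u. dist u c < d \<Longrightarrow> bump_poly u > P2"
      unfolding eventually_nhds_metric by auto
    then show ?thesis using that[of "min d (min \<delta> (1/2))"] \<delta>(1) by auto
  qed
  have ballU: "ball c \<rho> \<subseteq> unit_cube"
  proof
    fix u assume "u \<in> ball c \<rho>"
    then have "norm (u - c) < 1/2" using \<rho>(3) by (auto simp: dist_norm norm_minus_commute)
    then have "\<bar>(u - c) $ i\<bar> < 1/2" for i using component_le_norm_cart[of "u - c" i] by linarith
    then have "\<bar>u $ i - 1/2\<bar> < 1/2" for i by (simp add: c_def)
    then have "0 \<le> u $ i \<and> u $ i < 1" for i using \<open>\<bar>u $ i - 1/2\<bar> < 1/2\<close> unfolding abs_less_iff by linarith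
    then show "u \<in> unit_cube" by (auto simp: half_box_def)
  qed
  define V where "V = measure lborel (ball c \<rho>)"
  have V: "V > 0" unfolding V_def using \<rho>(1) content_ball_pos by blast
  \<comment> \<open>Three regions: on the small ball the integrand is at least
    \<open>h c / 2 * P2 ^ N\<close>, between the two balls it is nonnegative, and outside the larger
    ball it is at least \<open>- (B * P1 ^ N)\<close>. The total integral is zero.\<close>
  have main: "h c / 2 * V \<le> B * (P1 / P2) ^ N" for N
  proof -
    have i1: "integrable lborel (\<lambda>u. indicator (ball c \<rho>) u * (h c / 2 * P2 ^ N))"
      using emeasure_lborel_ball_finite[of c \<rho>] by (intro integrable_mult_left) (auto simp: top.not_eq_extremum)
    have i2: "integrable lborel (\<lambda>u. indicator unit_cube u * (B * P1 ^ N))"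
      using iU[of "B * P1 ^ N"] unfolding real_scaleR_def .
    have "(\<integral>u. indicator (ball c \<rho>) u * (h c / 2 * P2 ^ N) - indicator unit_cube u * (B * P1 ^ N) \<partial>lborel)
       \<le> (\<integral>u. indicator unit_cube u * (h u * bump_poly u ^ N) \<partial>lborel)"
    proof (rule integral_mono[OF Bochner_Integration.integrable_diff[OF i1 i2] hint])
      fix u :: "real^'n"
      show "indicator (ball c \<rho>) u * (h c / 2 * P2 ^ N) - indicator unit_cube u * (B * P1 ^ N)
          \<le> indicator unit_cube u * (h u * bump_poly u ^ N)"
      proof (cases "u \<in> unit_cube")
        case False
        then show ?thesis using ballU by (auto simp: indicator_def)
      next
        case True
        have BP: "0 \<le> B * P1 ^ N" using B P1 by auto
        consider "u \<in> ball c \<rho>" | "u \<notin> ball c \<rho>" "u \<in> ball c \<delta>" | "u \<notin> ball c \<delta>" by blast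
        then show ?thesis
        proof cases
          case 1
          then have d: "dist u c < \<rho>" by (simp add: dist_commute)
          have "h c / 2 * P2 ^ N \<le> h u * bump_poly u ^ N"
            using \<delta>(2)[of u] \<rho>(4)[OF d] d \<rho>(2) P2 hc by (intro mult_mono power_mono) auto
          then show ?thesis using 1 True BP by simp
        next
          case 2
          then have "dist u c < \<delta>" by (simp add: dist_commute)
          then have "h u \<ge> 0" using \<delta>(2)[of u] hc by linarith
          then have "0 \<le> h u * bump_poly u ^ N" using bump_poly_bounds[of u] by auto
          then show ?thesis using 2 True BP by simp
        next
          case 3
          then have nb: "u \<notin> ball c \<rho>" using \<rho>(2) by auto
          have "u \<in> K" using 3 True by (auto simp: K_def half_box_def mem_box_cart less_imp_le)
          then have "bump_poly u \<le> P1" by (rule P1(3))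
          then have "\<bar>h u * bump_poly u ^ N\<bar> \<le> B * P1 ^ N"
            unfolding abs_mult using bump_poly_bounds[of u] B hB[of u]
            by (intro mult_mono) (auto intro!: power_mono simp: abs_of_nonneg)
          then show ?thesis using 3 nb True by (simp add: abs_le_iff)
        qed
      qed
    qed
    also have "\<dots> = 0" by (rule hz)
    finally have "(\<integral>u. indicator (ball c \<rho>) u * (h c / 2 * P2 ^ N) \<partial>lborel)
        - (\<integral>u. indicator unit_cube u * (B * P1 ^ N) \<partial>(lborel :: (real^'n) measure)) \<le> 0"
      unfolding Bochner_Integration.integral_diff[OF i1 i2] .
    moreover have "(\<integral>u. indicator (ball c \<rho>) u * (h c / 2 * P2 ^ N) \<partial>lborel) = V * (h c / 2 * P2 ^ N)"
      unfolding integral_mult_left_zero by (simp add: V_def)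
    moreover have "measure lborel (unit_cube :: (real^'n) set) = 1"
      by (simp add: measure_def emeasure_unit_cube)
    then have "(\<integral>u. indicator unit_cube u * (B * P1 ^ N) \<partial>(lborel :: (real^'n) measure)) = B * P1 ^ N"
      unfolding integral_mult_left_zero by simp
    ultimately have "V * (h c / 2 * P2 ^ N) \<le> B * P1 ^ N" by linarith
    then show ?thesis using P2 by (simp add: field_simps power_divide)
  qed
  have "(\<lambda>N. B * (P1 / P2) ^ N) \<longlonglongrightarrow> B * 0"
    using P1 P2 by (intro tendsto_intros LIMSEQ_power_zero) auto
  then have "h c / 2 * V \<le> B * 0" using main by (intro LIMSEQ_le_const) blast+
  then have "h c / 2 * V \<le> 0" by simp
  then show False using hc V by (simp add: mult_le_0_iff)
qed

section \<open>Poisson summation and Fourier inversion\<close>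

lemma sums_integral_unit_cube:
  fixes f :: "nat \<Rightarrow> real^'n::finite \<Rightarrow> complex"
  assumes m: "\<And>a. f a \<in> borel_measurable borel" and bd: "\<And>a u. u \<in> unit_cube \<Longrightarrow> norm (f a u) \<le> B a"
    and B: "summable B"
  shows "(\<lambda>a. \<integral>u. indicator unit_cube u *\<^sub>R f a u \<partial>lborel) sums
    (\<integral>u. indicator unit_cube u *\<^sub>R (\<Sum>a. f a u) \<partial>lborel)"
proof -
  have [measurable]: "f a \<in> borel_measurable borel" for a by (rule m)
  have B0: "B a \<ge> 0" for a
  proof -
    have "0 \<in> (unit_cube :: (real^'n) set)" by (simp add: half_box_def)
    then show ?thesis using order_trans[OF norm_ge_zero bd] by blast
  qed
  have iB: "integrable lborel (\<lambda>u::real^'n. indicator unit_cube u * B a)"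
    "(\<integral>u. indicator unit_cube u * B a \<partial>(lborel :: (real^'n) measure)) = B a" for a
    by (simp_all add: emeasure_unit_cube measure_def)
  have int: "integrable lborel (\<lambda>u. indicator unit_cube u *\<^sub>R f a u)" for a
    by (rule Bochner_Integration.integrable_bound[OF iB(1)[of a]])
       (use bd B0 in \<open>auto simp: indicator_def\<close>)
  have eq: "(\<Sum>a. indicator unit_cube u *\<^sub>R f a u) = indicator unit_cube u *\<^sub>R (\<Sum>a. f a u)" for u
    by (auto simp: indicator_def)
  have "(\<lambda>a. \<integral>u. indicator unit_cube u *\<^sub>R f a u \<partial>lborel) sums
      (\<integral>u. (\<Sum>a. indicator unit_cube u *\<^sub>R f a u) \<partial>lborel)"
  proof (rule sums_integral[OF int])
    show "AE u in lborel. summable (\<lambda>a. norm (indicator unit_cube u *\<^sub>R f a u))"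
    proof (intro always_eventually allI)
      fix u :: "real^'n"
      show "summable (\<lambda>a. norm (indicator unit_cube u *\<^sub>R f a u))"
        by (rule summable_comparison_test'[OF B, of 0]) (use bd B0 in \<open>auto simp: indicator_def\<close>)
    qed
    show "summable (\<lambda>a. \<integral>u. norm (indicator unit_cube u *\<^sub>R f a u) \<partial>lborel)"
    proof (rule summable_comparison_test'[OF B, of 0])
      fix a :: nat
      have "(\<integral>u. norm (indicator unit_cube u *\<^sub>R f a u) \<partial>lborel) \<le> (\<integral>u. indicator unit_cube u * B a \<partial>(lborel :: (real^'n) measure))"
        by (rule integral_mono[OF integrable_norm[OF int] iB(1)]) (use bd in \<open>auto simp: indicator_def\<close>)
      then show "norm (\<integral>u. norm (indicator unit_cube u *\<^sub>R f a u) \<partial>lborel) \<le> B a"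
        unfolding iB(2) by (simp only: real_norm_def abs_of_nonneg[OF integral_nonneg_AE[OF always_eventually[OF allI[OF norm_ge_zero]]]])
    qed
  qed
  then show ?thesis unfolding eq .
qed

text \<open>The periodisation \<open>S\<close> is continuous and its Fourier coefficients are
  integrals of \<open>\<psi>\<close> against characters. The nontrivial ones vanish by hypothesis,
  and subtracting the integral of \<open>\<psi>\<close> removes the trivial one, so uniqueness
  applies to the difference.\<close>

lemma poisson_center:
  fixes \<psi> :: "real^'n::finite \<Rightarrow> complex"
  assumes \<psi>: "rapid \<psi>" and zero: "\<And>m. m \<noteq> 0 \<Longrightarrow> (\<integral>x. \<psi> x * character m x \<partial>lborel) = 0"
  shows "(\<lambda>a. \<psi> (lpt a + (\<chi> i. 1/2))) sums (\<integral>x. \<psi> x \<partial>lborel)"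
proof -
  obtain C where C: "C > 0" "\<And>x. norm (\<psi> x) \<le> C * wt x" using rapid_wt[OF \<psi>] by blast
  have [measurable]: "\<psi> \<in> borel_measurable borel" by (rule rapid_measurable[OF \<psi>])
  have summ: "summable (\<lambda>a. \<psi> (lpt a + u))" for u
    by (rule summable_comparison_test'[OF summable_mult[OF summable_wt[of u], of C], of 0]) (use C in auto)
  define I where "I = (\<integral>x. \<psi> x \<partial>lborel)"
  define S where "S u = (\<Sum>a. \<psi> (lpt a + u))" for u
  have contS: "continuous_on UNIV S"
    unfolding continuous_on_eq_continuous_at[OF open_UNIV]
  proof
    fix u0 :: "real^'n"
    \<comment> \<open>The convergence is made uniform on balls of radius 1 only, the range of
      displacements for which the weights stay comparable; this is enough for continuity at
      \<open>u0\<close>.\<close>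
    have "uniform_limit (ball u0 1) (\<lambda>n u. \<Sum>a<n. \<psi> (lpt a + u)) S sequentially"
      unfolding S_def
    proof (rule Weierstrass_m_test)
      show "summable (\<lambda>a. C * (4 ^ CARD('n) * wt (lpt a + u0)))"
        by (intro summable_mult summable_wt)
      fix a and u :: "real^'n" assume u: "u \<in> ball u0 1"
      have "wt (lpt a + u) \<le> 4 ^ CARD('n) * wt (lpt a + u0)"
      proof (rule wt_near)
        fix i
        have "\<bar>(u - u0) $ i\<bar> \<le> norm (u - u0)" by (rule component_le_norm_cart)
        then show "\<bar>(lpt a + u) $ i - (lpt a + u0) $ i\<bar> \<le> 1"
          using u by (simp add: dist_norm norm_minus_commute)
      qed
      then have "C * wt (lpt a + u) \<le> C * (4 ^ CARD('n) * wt (lpt a + u0))"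
        using C(1) by (intro mult_left_mono) auto
      then show "norm (\<psi> (lpt a + u)) \<le> C * (4 ^ CARD('n) * wt (lpt a + u0))"
        using C(2)[of "lpt a + u"] by linarith
    qed
    then have "continuous_on (ball u0 1) S"
      by (rule uniform_limit_theorem[rotated])
         (auto intro!: always_eventually continuous_intros continuous_on_compose2[OF rapid_continuous[OF \<psi>]])
    then show "isCont S u0"
      by (simp add: continuous_on_eq_continuous_at)
  qed
  have Sbd: "norm (S u) \<le> C * 12 ^ CARD('n)" for u
  proof -
    have "norm (S u) \<le> (\<Sum>a. C * wt (lpt a + u))"
      unfolding S_def by (rule norm_suminf_le[OF C(2) summable_mult[OF summable_wt]])
    also have "\<dots> = C * (\<Sum>a. wt (lpt a + u))" by (rule suminf_mult[OF summable_wt])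
    also have "\<dots> \<le> C * 12 ^ CARD('n)" using C(1) suminf_wt_le by (intro mult_left_mono) auto
    finally show ?thesis .
  qed
  have [measurable]: "S \<in> borel_measurable borel" by (rule borel_measurable_continuous_onI[OF contS])
  have coeff: "(\<integral>u. indicator unit_cube u *\<^sub>R (S u * character m u) \<partial>lborel) = (\<integral>x. \<psi> x * character m x \<partial>lborel)" for m
  proof -
    have "integrable lborel (\<lambda>x. \<psi> x * character m x)"
      by (rule rapid_integrable[OF rapid_mult_bounded[OF \<psi> continuous_on_character, of _ 1]]) simp
    from integral_unfold[OF this]
    have "(\<lambda>a. \<integral>u. indicator unit_cube u *\<^sub>R (\<psi> (u + lpt a) * character m u) \<partial>lborel) sums (\<integral>x. \<psi> x * character m x \<partial>lborel)"
      by simp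
    moreover have "(\<lambda>a. \<integral>u. indicator unit_cube u *\<^sub>R (\<psi> (u + lpt a) * character m u) \<partial>lborel) sums
        (\<integral>u. indicator unit_cube u *\<^sub>R (\<Sum>a. \<psi> (u + lpt a) * character m u) \<partial>lborel)"
    proof (rule sums_integral_unit_cube[where B="\<lambda>a. C * (4 ^ CARD('n) * wt (lpt a + (0::real^'n)))"])
      show "summable (\<lambda>a. C * (4 ^ CARD('n) * wt (lpt a + (0::real^'n))))"
        by (intro summable_mult summable_wt)
      fix a and u :: "real^'n" assume u: "u \<in> unit_cube"
      have "C * wt (lpt a + u) \<le> C * (4 ^ CARD('n) * wt (lpt a :: real^'n))"
        using C(1) wt_shift_unit_cube(1)[OF u, of "lpt a"] by (intro mult_left_mono) auto
      from order_trans[OF C(2) this]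
      show "norm (\<psi> (u + lpt a) * character m u) \<le> C * (4 ^ CARD('n) * wt (lpt a + (0::real^'n)))"
        by (simp add: norm_mult add.commute)
    qed simp
    moreover have "(\<Sum>a. \<psi> (u + lpt a) * character m u) = S u * character m u" for u
      unfolding S_def using suminf_mult2[OF summ[of u], of "character m u"] by (simp add: add.commute)
    ultimately show ?thesis by (simp add: sums_iff)
  qed
  have iU: "integrable lborel (\<lambda>u. indicator unit_cube u *\<^sub>R (K::real))" for K
    by (simp add: emeasure_unit_cube)
  have int1: "integrable lborel (\<lambda>u. indicator unit_cube u *\<^sub>R (S u * character m u))" for m
    by (rule Bochner_Integration.integrable_bound[OF iU[of "C * 12 ^ CARD('n)"]])
       (use Sbd C(1) in \<open>auto simp: norm_mult indicator_def\<close>)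
  have int2: "integrable lborel (\<lambda>u. indicator unit_cube u *\<^sub>R character m u)" for m
    by (rule Bochner_Integration.integrable_bound[OF iU[of 1]]) (auto simp: indicator_def)
  have "S (\<chi> i. 1/2) - I = 0"
  proof (rule fourier_uniqueness[where H="\<lambda>u. S u - I" and B="C * 12 ^ CARD('n) + norm I"])
    show "continuous_on UNIV (\<lambda>u. S u - I)" by (intro continuous_intros contS)
    show "norm (S u - I) \<le> C * 12 ^ CARD('n) + norm I" for u
      using Sbd[of u] norm_triangle_ineq4[of "S u" I] by linarith
    fix m :: "int^'n"
    have "indicator unit_cube u *\<^sub>R ((S u - I) * character m u)
      = indicator unit_cube u *\<^sub>R (S u * character m u) - I * (indicator unit_cube u *\<^sub>R character m u)" for u
      by (auto simp: indicator_def algebra_simps)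
    then have "(\<integral>u. indicator unit_cube u *\<^sub>R ((S u - I) * character m u) \<partial>lborel)
      = (\<integral>x. \<psi> x * character m x \<partial>lborel) - I * (\<integral>u. indicator unit_cube u *\<^sub>R character m u \<partial>lborel)"
      by (simp only: Bochner_Integration.integral_diff[OF int1 integrable_mult_right[OF int2]]
          integral_mult_right_zero coeff)
    also have "\<dots> = 0"
    proof (cases "m = 0")
      case True
      then show ?thesis by (simp add: I_def measure_def emeasure_unit_cube)
    next
      case False
      then show ?thesis by (simp add: zero integral_character_unit_cube)
    qed
    finally show "(\<integral>u. indicator unit_cube u *\<^sub>R ((S u - I) * character m u) \<partial>lborel) = 0" .
  qed
  then show ?thesis using summ[of "\<chi> i. 1/2"] by (simp add: S_def I_def sums_iff)
qed

text \<open>The frequency enters by modulation and the shift by translation, chosen so that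
  \<open>u\<close> lands at the centre of the cube. The values of the transform at the other points
  of the dual lattice through \<open>\<xi>\<close> are its remaining Fourier coefficients.\<close>

lemma poisson_summation:
  fixes \<phi> :: "real^'n::finite \<Rightarrow> complex"
  assumes \<phi>: "rapid \<phi>" and zero: "\<And>m. m \<noteq> 0 \<Longrightarrow> fourier \<phi> (\<xi> + (2 * pi) *\<^sub>R lat m) = 0"
  shows "(\<lambda>a. \<phi> (lpt a + u) * cis (- ((lpt a + u) \<bullet> \<xi>))) sums fourier \<phi> \<xi>"
proof -
  define v :: "real^'n" where "v = u - (\<chi> i. 1/2)"
  define g where "g x = \<phi> x * cis (- (x \<bullet> \<xi>))" for x
  define \<psi> where "\<psi> x = g (x + v)" for x
  have g: "rapid g" unfolding g_def by (rule rapid_mult_cis[OF \<phi>])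
  then have \<psi>: "rapid \<psi>" unfolding \<psi>_def by (rule rapid_translate)
  have shift: "(\<integral>x. h (x + v) \<partial>lborel) = (\<integral>x. h x \<partial>lborel)" if "rapid h" for h
    using integral_affine[OF _ rapid_integrable[OF that], of 1 v] by (simp add: add.commute)
  have "(\<lambda>a. \<psi> (lpt a + (\<chi> i. 1/2))) sums (\<integral>x. \<psi> x \<partial>lborel)"
  proof (rule poisson_center[OF \<psi>])
    fix m :: "int^'n" assume m: "m \<noteq> 0"
    have r: "rapid (\<lambda>x. g x * character m x)"
      by (rule rapid_mult_bounded[OF g continuous_on_character, of _ 1]) simp
    have l: "lat (- m) = - lat m" by (simp add: vec_eq_iff)
    have "(\<integral>x. \<psi> x * character m x \<partial>lborel) = (\<integral>x. character m (- v) * (g (x + v) * character m (x + v)) \<partial>lborel)"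
    proof (intro Bochner_Integration.integral_cong refl)
      fix x
      have "character m x = character m (- v) * character m (x + v)"
        unfolding character_add[symmetric] by simp
      then show "\<psi> x * character m x = character m (- v) * (g (x + v) * character m (x + v))"
        by (simp add: \<psi>_def)
    qed
    also have "\<dots> = character m (- v) * (\<integral>x. g x * character m x \<partial>lborel)"
      using shift[OF r] by simp
    also have "(\<integral>x. g x * character m x \<partial>lborel) = fourier \<phi> (\<xi> + (2 * pi) *\<^sub>R lat (- m))"
      unfolding fourier_def
      by (intro Bochner_Integration.integral_cong refl)
         (simp add: g_def character_def mult.assoc cis_mult inner_add_right inner_diff_right l)
    also have "\<dots> = 0" using m by (intro zero) simp
    finally show "(\<integral>x. \<psi> x * character m x \<partial>lborel) = 0" by simp
  qed
  moreover have "(\<integral>x. \<psi> x \<partial>lborel) = fourier \<phi> \<xi>"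
    unfolding \<psi>_def shift[OF g] by (simp add: g_def[abs_def] fourier_def)
  moreover have "\<psi> (lpt a + (\<chi> i. 1/2)) = \<phi> (lpt a + u) * cis (- ((lpt a + u) \<bullet> \<xi>))" for a
  proof -
    have "lpt a + (\<chi> i. 1/2) + v = lpt a + u" by (simp add: v_def)
    then show ?thesis unfolding \<psi>_def g_def by (simp only:)
  qed
  ultimately show ?thesis by simp
qed

section \<open>Fourier inversion for band-limited functions\<close>

lemma integrable_compact_support:
  fixes F :: "real^'n::finite \<Rightarrow> complex"
  assumes cont: "continuous_on UNIV F" and supp: "\<And>\<xi>. norm \<xi> > R \<Longrightarrow> F \<xi> = 0"
  shows "integrable lborel F"
proof -
  have "compact (F ` cball 0 R)"
    by (intro compact_continuous_image continuous_on_subset[OF cont]) auto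
  then obtain B where B: "\<And>\<xi>. \<xi> \<in> cball 0 R \<Longrightarrow> norm (F \<xi>) \<le> B"
    by (meson bounded_iff compact_imp_bounded imageI)
  have "integrable lborel (\<lambda>\<xi>::real^'n. indicator (cball 0 R) \<xi> *\<^sub>R B)"
    using emeasure_lborel_cball_finite[of "0::real^'n" R]
    by (intro integrable_scaleR_left integrable_real_indicator) (auto simp: top.not_eq_extremum)
  then show ?thesis
  proof (rule Bochner_Integration.integrable_bound)
    show "F \<in> borel_measurable lborel" using borel_measurable_continuous_onI[OF cont] by simp
    show "AE \<xi> in lborel. norm (F \<xi>) \<le> norm (indicator (cball 0 R) \<xi> *\<^sub>R B)"
      using supp order_trans[OF B] by (intro always_eventually) (auto simp: indicator_def not_le)
  qed
qed

text \<open>Poisson summation expands the modulated transform on one period cell into a series of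
  characters with the samples of \<open>\<theta>\<close> as coefficients. Integrating over the cell
  leaves only the sample at \<open>x\<close>.\<close>

lemma fourier_inversion_bandlimited:
  fixes \<theta> :: "real^'n::finite \<Rightarrow> complex"
  assumes \<theta>: "rapid \<theta>" and supp: "\<And>\<xi>. norm \<xi> > 2 \<Longrightarrow> fourier \<theta> \<xi> = 0"
  shows "(\<integral>\<xi>. fourier \<theta> \<xi> * cis (x \<bullet> \<xi>) \<partial>lborel) = of_real ((2 * pi) ^ CARD('n)) * \<theta> x"
proof -
  define c :: "real^'n" where "c = (\<chi> i. 1/2)"
  define F where "F \<xi> = fourier \<theta> \<xi> * cis (x \<bullet> \<xi>)" for \<xi>
  have contF: "continuous_on UNIV F" unfolding F_def
    by (intro continuous_intros fourier_continuous[OF \<theta>])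
  have intF: "integrable lborel F"
    by (rule integrable_compact_support[OF contF, of 2]) (simp add: F_def supp)
  \<comment> \<open>Maps the unit cube onto the cube of half-width pi about the origin, which
    contains the ball of radius 2 and hence the spectrum.\<close>
  define y where "y v = (2 * pi) *\<^sub>R (v - c)" for v :: "real^'n"
  have yn: "norm (y v) > 2" if "\<bar>y v $ i\<bar> \<ge> pi" for v i
    using that component_le_norm_cart[of "y v" i] pi_gt3 by linarith
  have out: "F (y v) = 0" if "v \<notin> unit_cube" for v
  proof -
    from that obtain i where i: "v $ i < 0 \<or> 1 \<le> v $ i" by (auto simp: half_box_def not_le not_less)
    have "\<bar>v $ i - 1/2\<bar> \<ge> 1/2" using i by linarith
    then have "2 * pi * \<bar>v $ i - 1/2\<bar> \<ge> 2 * pi * (1/2)" by (intro mult_left_mono) auto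
    then have "\<bar>y v $ i\<bar> \<ge> pi" by (simp add: y_def c_def abs_mult)
    then show ?thesis using supp[OF yn] by (simp add: F_def)
  qed
  have inside: "(\<lambda>a. \<theta> (lpt a + x) * cis (- (lpt a \<bullet> y v))) sums F (y v)" if "v \<in> unit_cube" for v
  proof -
    have "(\<lambda>a. \<theta> (lpt a + x) * cis (- ((lpt a + x) \<bullet> y v))) sums fourier \<theta> (y v)"
    proof (rule poisson_summation[OF \<theta>])
      fix m :: "int^'n" assume "m \<noteq> 0"
      then obtain i where i: "m $ i \<noteq> 0" by (metis vec_eq_iff zero_index)
      \<comment> \<open>Two points of a half-open unit cube cannot differ by a nonzero lattice
        vector, so every alias of the frequency lies where the transform vanishes.\<close>
      have "v + lat m \<notin> unit_cube"
      proof
        assume *: "v + lat m \<in> unit_cube"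
        have "0 \<le> v $ i" "v $ i < 1" using that by (auto simp: half_box_def)
        moreover have "0 \<le> v $ i + real_of_int (m $ i)" "v $ i + real_of_int (m $ i) < 1"
          using * by (auto simp: half_box_def)
        ultimately have "real_of_int (m $ i) < 1" "real_of_int (m $ i) > -1" by linarith+
        then show False using i by linarith
      qed
      from out[OF this] have "fourier \<theta> (y (v + lat m)) = 0" by (simp add: F_def)
      then show "fourier \<theta> (y v + (2 * pi) *\<^sub>R lat m) = 0"
        by (simp add: y_def algebra_simps)
    qed
    from sums_mult2[OF this, of "cis (x \<bullet> y v)"]
    show ?thesis by (simp add: F_def mult.assoc cis_mult inner_add_left)
  qed
  have tm: "indicator unit_cube v *\<^sub>R (\<theta> (lpt a + x) * cis (- (lpt a \<bullet> y v)))
      = (\<theta> (lpt a + x) * character (lattice_enum a) c) * (indicator unit_cube v *\<^sub>R character (- lattice_enum a) v)" for a v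
  proof -
    have l: "lat (- k) = - lat k" for k :: "int^'n" by (simp add: vec_eq_iff)
    have "cis (- (lpt a \<bullet> y v)) = character (lattice_enum a) c * character (- lattice_enum a) v"
      by (simp add: character_def cis_mult lpt_def y_def l inner_diff_right inner_commute algebra_simps)
    then show ?thesis by simp
  qed
  obtain a0 where a0: "lattice_enum a0 = (0 :: int^'n)" and u: "\<And>a. lattice_enum a = (0 :: int^'n) \<Longrightarrow> a = a0"
    using bij_lattice_enum by (metis bij_pointE)
  have l0: "lpt a0 = (0 :: real^'n)" by (simp add: lpt_def a0 vec_eq_iff)
  obtain C where C: "C > 0" "\<And>x. norm (\<theta> x) \<le> C * wt x" using rapid_wt[OF \<theta>] by blast
  have "(\<lambda>a. \<integral>v. indicator unit_cube v *\<^sub>R (\<theta> (lpt a + x) * cis (- (lpt a \<bullet> y v))) \<partial>lborel) sums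
    (\<integral>v. indicator unit_cube v *\<^sub>R (\<Sum>a. \<theta> (lpt a + x) * cis (- (lpt a \<bullet> y v))) \<partial>lborel)"
  proof (rule sums_integral_unit_cube[where B="\<lambda>a. C * wt (lpt a + x)"])
    show "(\<lambda>v. \<theta> (lpt a + x) * cis (- (lpt a \<bullet> y v))) \<in> borel_measurable borel" for a
      unfolding y_def cis_conv_exp by (intro borel_measurable_continuous_onI continuous_intros)
  qed (use C in \<open>auto simp: norm_mult intro!: summable_mult summable_wt\<close>)
  also have "(\<integral>v. indicator unit_cube v *\<^sub>R (\<Sum>a. \<theta> (lpt a + x) * cis (- (lpt a \<bullet> y v))) \<partial>lborel)
      = (\<integral>v. F (y v) \<partial>lborel)"
    using inside out by (intro Bochner_Integration.integral_cong refl) (auto simp: indicator_def sums_iff)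
  finally have s1: "(\<lambda>a. \<integral>v. indicator unit_cube v *\<^sub>R (\<theta> (lpt a + x) * cis (- (lpt a \<bullet> y v))) \<partial>lborel) sums
      (\<integral>v. F (y v) \<partial>lborel)" .
  \<comment> \<open>Orthogonality of the characters: only the lattice point 0, enumerated by
    \<open>a0\<close>, contributes.\<close>
  have val: "(\<integral>v. indicator unit_cube v *\<^sub>R (\<theta> (lpt a + x) * cis (- (lpt a \<bullet> y v))) \<partial>lborel)
    = (if a = a0 then \<theta> x else 0)" for a
  proof (cases "a = a0")
    case True
    then show ?thesis by (simp add: l0 measure_def emeasure_unit_cube)
  next
    case False
    then have "- lattice_enum a \<noteq> (0 :: int^'n)" using u by auto
    from integral_character_unit_cube[OF this]
    have "(\<integral>v. indicator unit_cube v *\<^sub>R (\<theta> (lpt a + x) * cis (- (lpt a \<bullet> y v))) \<partial>lborel) = 0"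
      by (simp only: tm integral_mult_right_zero mult_zero_right)
    then show ?thesis using False by simp
  qed
  have "(\<lambda>a. if a = a0 then \<theta> x else 0) sums \<theta> x" by (rule sums_single)
  with s1 have eq: "(\<integral>v. F (y v) \<partial>lborel) = \<theta> x"
    unfolding val using sums_unique2 by blast
  have "(\<integral>\<xi>. F \<xi> \<partial>lborel) = (2 * pi) ^ CARD('n) *\<^sub>R (\<integral>v. F (- ((2 * pi) *\<^sub>R c) + (2 * pi) *\<^sub>R v) \<partial>lborel)"
    using integral_affine[OF _ intF, of "2 * pi" "- ((2 * pi) *\<^sub>R c)"] by simp
  also have "(\<lambda>v. F (- ((2 * pi) *\<^sub>R c) + (2 * pi) *\<^sub>R v)) = (\<lambda>v. F (y v))"
    by (simp add: y_def algebra_simps)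
  finally show ?thesis unfolding eq by (simp add: F_def[abs_def] scaleR_conv_of_real)
qed

section \<open>Smoothness along coordinate directions and decay of the inverse transform\<close>

definition dir_deriv :: "'a::real_normed_vector \<Rightarrow> ('a \<Rightarrow> complex) \<Rightarrow> 'a \<Rightarrow> complex" where
  "dir_deriv e g x = vector_derivative (\<lambda>t. g (x + t *\<^sub>R e)) (at 0)"

text \<open>Only pure derivatives along one fixed direction are recorded, since multiplying an
  inverse transform by a coordinate corresponds to differentiating in that direction. The set
  \<open>S\<close> is a parameter so that smoothness can be proved piecewise.\<close>

primrec smooth_dir :: "nat \<Rightarrow> 'a::real_normed_vector \<Rightarrow> 'a set \<Rightarrow> ('a \<Rightarrow> complex) \<Rightarrow> bool" where
  "smooth_dir 0 e S g \<longleftrightarrow> continuous_on S g"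
| "smooth_dir (Suc N) e S g \<longleftrightarrow> continuous_on S g \<and>
     (\<forall>x\<in>S. ((\<lambda>t. g (x + t *\<^sub>R e)) has_vector_derivative dir_deriv e g x) (at 0)) \<and>
     smooth_dir N e S (dir_deriv e g)"

lemma has_dir_deriv_cong:
  fixes x e :: "'a::real_normed_vector"
  assumes "open S" "x \<in> S" "\<And>y. y \<in> S \<Longrightarrow> g y = h y"
    and "((\<lambda>t. g (x + t *\<^sub>R e)) has_vector_derivative d) (at 0)"
  shows "((\<lambda>t. h (x + t *\<^sub>R e)) has_vector_derivative d) (at 0)"
proof -
  have "open ((\<lambda>t. x + t *\<^sub>R e) -` S)"
    by (rule open_vimage[OF assms(1)]) (intro continuous_intros)
  then show ?thesis
    by (rule has_vector_derivative_transform_within_open[OF assms(4)]) (simp_all add: assms(2,3))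
qed

lemma dir_derivI: "((\<lambda>t. g (x + t *\<^sub>R e)) has_vector_derivative d) (at 0) \<Longrightarrow> dir_deriv e g x = d"
  unfolding dir_deriv_def by (rule vector_derivative_at)

lemma smooth_dir_cong:
  assumes "open S" "\<And>x. x \<in> S \<Longrightarrow> g x = h x" "smooth_dir N e S g"
  shows "smooth_dir N e S h"
  using assms(2,3)
proof (induction N arbitrary: g h)
  case 0
  have "continuous_on S g = continuous_on S h" by (rule continuous_on_cong[OF refl 0(1)])
  then show ?case using 0 by simp
next
  case (Suc N)
  have sg: "smooth_dir N e S (dir_deriv e g)" "continuous_on S g"
    "\<forall>x\<in>S. ((\<lambda>t. g (x + t *\<^sub>R e)) has_vector_derivative dir_deriv e g x) (at 0)"
    using Suc.prems(2) unfolding smooth_dir.simps by blast+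
  have d: "((\<lambda>t. h (x + t *\<^sub>R e)) has_vector_derivative dir_deriv e g x) (at 0)" if "x \<in> S" for x
    by (rule has_dir_deriv_cong[OF assms(1) that Suc.prems(1) sg(3)[rule_format, OF that]])
  have eq: "dir_deriv e g x = dir_deriv e h x" if "x \<in> S" for x
    by (rule dir_derivI[OF d[OF that], symmetric])
  have "smooth_dir N e S (dir_deriv e h)"
    by (rule Suc.IH[OF eq sg(1)])
  moreover have "continuous_on S g = continuous_on S h" by (rule continuous_on_cong[OF refl Suc.prems(1)])
  then have "continuous_on S h" using sg(2) by simp
  moreover have "\<forall>x\<in>S. ((\<lambda>t. h (x + t *\<^sub>R e)) has_vector_derivative dir_deriv e h x) (at 0)"
    using d eq by metis
  ultimately show ?case unfolding smooth_dir.simps by blast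
qed

text \<open>An introduction rule in which any candidate \<open>g'\<close> on the open set may stand
  for \<open>dir_deriv\<close>; the closure properties below are instances of the product, chain and
  quotient rules fed into it.\<close>

lemma smooth_dir_SucI:
  assumes "open S" "continuous_on S g" "smooth_dir N e S g'"
    "\<And>x. x \<in> S \<Longrightarrow> ((\<lambda>t. g (x + t *\<^sub>R e)) has_vector_derivative g' x) (at 0)"
  shows "smooth_dir (Suc N) e S g"
proof -
  have eq: "dir_deriv e g x = g' x" if "x \<in> S" for x using assms(4)[OF that] by (rule dir_derivI)
  have "smooth_dir N e S (dir_deriv e g)"
    by (rule smooth_dir_cong[OF assms(1) _ assms(3)]) (simp add: eq)
  then show ?thesis using assms eq by simp
qed

lemma smooth_dir_continuous: "smooth_dir N e S g \<Longrightarrow> continuous_on S g"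
  by (cases N) auto

lemma smooth_dir_Suc_imp: "smooth_dir (Suc N) e S g \<Longrightarrow> smooth_dir N e S g"
proof (induction N arbitrary: g)
  case (Suc N)
  then have "smooth_dir N e S (dir_deriv e g)" by (metis smooth_dir.simps(2))
  with Suc.prems show ?case by simp
qed simp

lemma smooth_dir_const: "open S \<Longrightarrow> smooth_dir N e S (\<lambda>_. c)"
proof (induction N arbitrary: c)
  case (Suc N)
  show ?case
    by (rule smooth_dir_SucI[OF Suc.prems _ Suc.IH[OF Suc.prems, of 0]]) auto
qed simp

lemma smooth_dir_add:
  assumes "open S"
  shows "smooth_dir N e S g \<Longrightarrow> smooth_dir N e S h \<Longrightarrow> smooth_dir N e S (\<lambda>x. g x + h x)"
proof (induction N arbitrary: g h)
  case (Suc N)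
  show ?case
    by (rule smooth_dir_SucI[OF assms, of _ _ _ "\<lambda>x. dir_deriv e g x + dir_deriv e h x"])
       (use Suc in \<open>auto intro!: continuous_intros has_vector_derivative_add\<close>)
qed (auto intro: continuous_intros)

lemma smooth_dir_sum:
  assumes "open S" "\<And>i. i \<in> I \<Longrightarrow> smooth_dir N e S (g i)"
  shows "smooth_dir N e S (\<lambda>x. \<Sum>i\<in>I. g i x)"
  using assms(2)
proof (induction I rule: infinite_finite_induct)
  case (insert i I)
  then show ?case by (simp add: smooth_dir_add[OF assms(1)])
qed (auto intro: smooth_dir_const[OF assms(1)])

lemma smooth_dir_mult:
  assumes "open S"
  shows "smooth_dir N e S g \<Longrightarrow> smooth_dir N e S h \<Longrightarrow> smooth_dir N e S (\<lambda>x. g x * h x)"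
proof (induction N arbitrary: g h)
  case (Suc N)
  have gh: "smooth_dir N e S g" "smooth_dir N e S h" by (rule smooth_dir_Suc_imp[OF Suc.prems(1)], rule smooth_dir_Suc_imp[OF Suc.prems(2)])
  show ?case
  proof (rule smooth_dir_SucI[OF assms, of _ _ _ "\<lambda>x. g x * dir_deriv e h x + dir_deriv e g x * h x"])
    show "continuous_on S (\<lambda>x. g x * h x)" using Suc.prems by (auto intro: continuous_intros)
    show "smooth_dir N e S (\<lambda>x. g x * dir_deriv e h x + dir_deriv e g x * h x)"
      proof -
      have "smooth_dir N e S (dir_deriv e g)" "smooth_dir N e S (dir_deriv e h)" using Suc.prems by simp_all
      then show ?thesis by (rule smooth_dir_add[OF assms Suc.IH[OF gh(1)] Suc.IH[OF _ gh(2)], rotated])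
    qed
    fix x assume "x \<in> S"
    then have "((\<lambda>t. g (x + t *\<^sub>R e)) has_vector_derivative dir_deriv e g x) (at 0)"
      "((\<lambda>t. h (x + t *\<^sub>R e)) has_vector_derivative dir_deriv e h x) (at 0)"
      using Suc.prems by auto
    from has_vector_derivative_mult[OF this]
    show "((\<lambda>t. g (x + t *\<^sub>R e) * h (x + t *\<^sub>R e)) has_vector_derivative
        g x * dir_deriv e h x + dir_deriv e g x * h x) (at 0)" by simp
  qed
qed (auto intro: continuous_intros)

lemma smooth_dir_cnj:
  assumes "open S"
  shows "smooth_dir N e S g \<Longrightarrow> smooth_dir N e S (\<lambda>x. cnj (g x))"
proof (induction N arbitrary: g)
  case (Suc N)
  show ?case
    by (rule smooth_dir_SucI[OF assms, of _ _ _ "\<lambda>x. cnj (dir_deriv e g x)"])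
       (use Suc in \<open>auto intro!: continuous_intros bounded_linear.has_vector_derivative[OF bounded_linear_cnj]\<close>)
qed (auto intro: continuous_intros)

lemma smooth_dir_inverse:
  assumes "open S" "\<And>x. x \<in> S \<Longrightarrow> g x \<noteq> 0"
  shows "smooth_dir N e S g \<Longrightarrow> smooth_dir N e S (\<lambda>x. inverse (g x))"
proof (induction N)
  case (Suc N)
  have IH: "smooth_dir N e S (\<lambda>x. inverse (g x))"
    using Suc.IH smooth_dir_Suc_imp[OF Suc.prems] by blast
  show ?case
  proof (rule smooth_dir_SucI[OF assms(1), of _ _ _ "\<lambda>x. dir_deriv e g x * (- 1 * (inverse (g x) * inverse (g x)))"])
    show "continuous_on S (\<lambda>x. inverse (g x))" using Suc.prems assms(2) by (auto intro!: continuous_intros)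
    show "smooth_dir N e S (\<lambda>x. dir_deriv e g x * (- 1 * (inverse (g x) * inverse (g x))))"
      using Suc.prems IH by (intro smooth_dir_mult smooth_dir_const assms(1)) auto
    fix x assume x: "x \<in> S"
    then have d: "((\<lambda>t. g (x + t *\<^sub>R e)) has_vector_derivative dir_deriv e g x) (at 0)"
      using Suc.prems by auto
    have "(inverse has_field_derivative (- 1 * (inverse (g x) * inverse (g x)))) (at (g (x + 0 *\<^sub>R e)))"
      using assms(2)[OF x] by (auto intro!: derivative_eq_intros simp: power2_eq_square)
    from field_vector_diff_chain_at[OF d this]
    show "((\<lambda>t. inverse (g (x + t *\<^sub>R e))) has_vector_derivative
        dir_deriv e g x * (- 1 * (inverse (g x) * inverse (g x)))) (at 0)"
      by (simp add: comp_def)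
  qed
qed (use assms(2) in \<open>auto intro!: continuous_intros\<close>)

text \<open>Smoothness is local. This glues a quotient on the set where its denominator does not
  vanish to the zero function off the spectrum.\<close>

lemma smooth_dir_Un:
  assumes "open S" "open T"
  shows "smooth_dir N e S g \<Longrightarrow> smooth_dir N e T g \<Longrightarrow> smooth_dir N e (S \<union> T) g"
  by (induction N arbitrary: g) (auto intro: continuous_on_open_Un assms)

text \<open>The form with difference quotients is the one to which dominated convergence along
  sequences can be applied.\<close>

lemma has_vector_derivative_quotient:
  fixes f :: "real \<Rightarrow> 'a::real_normed_vector"
  shows "(f has_vector_derivative d) (at 0) \<longleftrightarrow> ((\<lambda>t. (1 / t) *\<^sub>R (f t - f 0)) \<longlongrightarrow> d) (at 0)"
proof -
  have "((\<lambda>t. (1 / t) *\<^sub>R (f t - f 0)) \<longlongrightarrow> d) (at 0)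
      \<longleftrightarrow> ((\<lambda>t. norm ((1 / t) *\<^sub>R (f t - f 0) - d)) \<longlongrightarrow> 0) (at 0)"
    by (simp add: tendsto_norm_zero_iff LIM_zero_iff)
  also have "\<dots> \<longleftrightarrow> ((\<lambda>t. norm (f (0 + t) - f 0 - t *\<^sub>R d) / norm t) \<longlongrightarrow> 0) (at 0)"
  proof (rule filterlim_cong[OF refl refl])
    show "\<forall>\<^sub>F t in at 0. norm ((1 / t) *\<^sub>R (f t - f 0) - d) = norm (f (0 + t) - f 0 - t *\<^sub>R d) / norm t"
    proof (rule eventually_at_filter[THEN iffD2], intro always_eventually allI impI)
      fix t :: real assume t: "t \<noteq> 0"
      have "(1 / t) *\<^sub>R (f t - f 0) - d = (1 / t) *\<^sub>R (f t - f 0 - t *\<^sub>R d)"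
        using t by (simp add: scaleR_right_diff_distrib)
      then show "norm ((1 / t) *\<^sub>R (f t - f 0) - d) = norm (f (0 + t) - f 0 - t *\<^sub>R d) / norm t"
        by simp
    qed
  qed
  also have "\<dots> \<longleftrightarrow> (f has_vector_derivative d) (at 0)"
    unfolding has_vector_derivative_def has_derivative_at by (simp add: bounded_linear_scaleR_left)
  finally show ?thesis by simp
qed

section \<open>Differentiating Fourier transforms under the integral\<close>

lemma norm_cis_minus_1_le: "norm (cis a - 1) \<le> \<bar>a\<bar>"
proof -
  have "(norm (cis a - 1))\<^sup>2 = (cos a - 1)\<^sup>2 + (sin a)\<^sup>2"
    by (simp add: cmod_power2)
  also have "\<dots> = 2 - 2 * cos a"
    using sin_cos_squared_add[of a] by (simp add: power2_eq_square algebra_simps)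
  also have "\<dots> = (2 * sin (a / 2))\<^sup>2"
    using cos_double_sin[of "a / 2"] by (simp add: power_mult_distrib)
  also have "\<dots> \<le> \<bar>a\<bar>\<^sup>2"
    using abs_sin_x_le_abs_x[of "a / 2"] by (intro abs_le_square_iff[THEN iffD1]) auto
  finally show ?thesis by (rule power2_le_imp_le) simp
qed

lemma has_vector_derivative_cis_linear:
  "((\<lambda>t. cis (a + t * b)) has_vector_derivative \<i> * of_real b * cis a) (at 0)"
  unfolding has_vector_derivative_def
  by (auto intro!: derivative_eq_intros simp: scaleR_conv_of_real)

text \<open>The difference quotients of the exponential are dominated by the modulus of the
  coordinate, and rapid decay of \<open>h\<close> keeps the product integrable.\<close>

lemma fourier_dir_deriv:
  fixes h :: "real^'n::finite \<Rightarrow> complex"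
  assumes h: "rapid h"
  shows "((\<lambda>t. fourier h (\<xi> + t *\<^sub>R axis i 1)) has_vector_derivative
    fourier (\<lambda>x. - \<i> * (of_real (x $ i) * h x)) \<xi>) (at 0)"
  unfolding has_vector_derivative_quotient tendsto_at_iff_sequentially comp_def
proof (intro allI impI)
  fix X :: "nat \<Rightarrow> real" assume X: "\<forall>i. X i \<in> UNIV - {0}" "X \<longlonglongrightarrow> 0"
  have rx: "rapid (\<lambda>x. of_real (x $ i) * h x)" by (rule rapid_mult_coord[OF h])
  note [measurable] = rapid_measurable[OF h]
  have hint: "integrable lborel (\<lambda>x. h x * cis (- (x \<bullet> \<xi>)))" for \<xi>
    by (rule rapid_integrable[OF rapid_mult_cis[OF h]])
  define s where "s n x = h x * cis (- (x \<bullet> \<xi>)) * ((1 / X n) *\<^sub>R (cis (- (X n * x $ i)) - 1))" for n x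
  have s_eq: "s n x = (1 / X n) *\<^sub>R (h x * cis (- (x \<bullet> (\<xi> + X n *\<^sub>R axis i 1))) - h x * cis (- (x \<bullet> \<xi>)))" for n x
  proof -
    have "cis (- (x \<bullet> (\<xi> + X n *\<^sub>R axis i 1))) = cis (- (x \<bullet> \<xi>)) * cis (- (X n * x $ i))"
      by (simp add: cis_mult inner_add_right inner_axis)
    then show ?thesis by (simp add: s_def algebra_simps)
  qed
  have "(\<lambda>n. \<integral>x. s n x \<partial>lborel) \<longlonglongrightarrow> (\<integral>x. - \<i> * (of_real (x $ i) * h x) * cis (- (x \<bullet> \<xi>)) \<partial>lborel)"
  proof (rule integral_dominated_convergence[where w="\<lambda>x. norm (of_real (x $ i) * h x)"])
    show "(\<lambda>x. - \<i> * (of_real (x $ i) * h x) * cis (- (x \<bullet> \<xi>))) \<in> borel_measurable lborel"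
      using rapid_measurable[OF rapid_mult_cis[OF rx, of \<xi>]] by (simp add: mult.assoc)
    show "s n \<in> borel_measurable lborel" for n
      unfolding s_eq[abs_def]
      using borel_measurable_integrable[OF hint[of "\<xi> + X n *\<^sub>R axis i 1"]] borel_measurable_integrable[OF hint[of \<xi>]]
      by measurable
    show "integrable lborel (\<lambda>x. norm (of_real (x $ i) * h x))"
      by (rule integrable_norm[OF rapid_integrable[OF rx]])
    show "AE x in lborel. (\<lambda>n. s n x) \<longlonglongrightarrow> - \<i> * (of_real (x $ i) * h x) * cis (- (x \<bullet> \<xi>))"
    proof (intro always_eventually allI)
      fix x
      have "((\<lambda>t. (1 / t) *\<^sub>R (cis (0 + t * (- (x $ i))) - cis (0 + 0 * (- (x $ i))))) \<longlongrightarrow> \<i> * of_real (- (x $ i)) * cis 0) (at 0)"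
        using has_vector_derivative_cis_linear[of 0 "- (x $ i)"] unfolding has_vector_derivative_quotient .
      then have "(\<lambda>n. (1 / X n) *\<^sub>R (cis (0 + X n * (- (x $ i))) - cis (0 + 0 * (- (x $ i))))) \<longlonglongrightarrow> \<i> * of_real (- (x $ i)) * cis 0"
        using X unfolding tendsto_at_iff_sequentially comp_def by blast
      then have "(\<lambda>n. (1 / X n) *\<^sub>R (cis (- (X n * x $ i)) - 1)) \<longlonglongrightarrow> - \<i> * of_real (x $ i)"
        by simp
      from tendsto_mult_left[OF this, of "h x * cis (- (x \<bullet> \<xi>))"]
      show "(\<lambda>n. s n x) \<longlonglongrightarrow> - \<i> * (of_real (x $ i) * h x) * cis (- (x \<bullet> \<xi>))"
        by (simp add: s_def mult_ac)
    qed
    show "AE x in lborel. norm (s n x) \<le> norm (of_real (x $ i) * h x)" for n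
    proof (intro always_eventually allI)
      fix x
      have X0: "X n \<noteq> 0" using X(1) by auto
      have "norm ((1 / X n) *\<^sub>R (cis (- (X n * x $ i)) - 1)) \<le> (1 / \<bar>X n\<bar>) * \<bar>- (X n * x $ i)\<bar>"
        using norm_cis_minus_1_le[of "- (X n * x $ i)"] by (simp only: norm_scaleR abs_divide abs_one) (intro mult_left_mono; simp)
      also have "\<dots> = \<bar>x $ i\<bar>" using X0 by (simp add: abs_mult)
      finally show "norm (s n x) \<le> norm (of_real (x $ i) * h x)"
        unfolding s_def norm_mult norm_cis mult_1_right norm_of_real real_norm_def
        by (subst mult.commute) (intro mult_right_mono norm_ge_zero)
    qed
  qed
  moreover have "(\<integral>x. s n x \<partial>lborel) = (1 / X n) *\<^sub>R (fourier h (\<xi> + X n *\<^sub>R axis i 1) - fourier h (\<xi> + 0 *\<^sub>R axis i 1))" for n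
    unfolding s_eq fourier_def using hint[of \<xi>] hint[of "\<xi> + X n *\<^sub>R axis i 1"] by (simp del: inner_add_right)
  ultimately show "(\<lambda>n. (1 / X n) *\<^sub>R (fourier h (\<xi> + X n *\<^sub>R axis i 1) - fourier h (\<xi> + 0 *\<^sub>R axis i 1)))
      \<longlonglongrightarrow> fourier (\<lambda>x. - \<i> * (of_real (x $ i) * h x)) \<xi>"
    by (simp add: fourier_def)
qed

lemma rapid_mult_const: "rapid h \<Longrightarrow> rapid (\<lambda>x. c * h x)"
  using rapid_mult_bounded[of h "\<lambda>_. c" "norm c"] by (simp add: mult.commute)

lemma smooth_dir_fourier:
  assumes "rapid h"
  shows "smooth_dir N (axis i 1) UNIV (fourier h)"
  using assms
proof (induction N arbitrary: h)
  case 0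
  then show ?case by (simp add: fourier_continuous)
next
  case (Suc N)
  show ?case
    by (rule smooth_dir_SucI[OF open_UNIV fourier_continuous[OF Suc.prems]
          Suc.IH[OF rapid_mult_const[OF rapid_mult_coord[OF Suc.prems]]] fourier_dir_deriv[OF Suc.prems]])
qed

text \<open>A transform that vanishes on an open set has zero derivatives there, and its derivative
  is, up to a constant, the transform of a coordinate times \<open>h\<close>.\<close>

lemma fourier_zero_moment_step:
  assumes h: "rapid h" and S: "open S" and z: "\<And>\<xi>. \<xi> \<in> S \<Longrightarrow> fourier h \<xi> = 0" and \<xi>: "\<xi> \<in> S"
  shows "fourier (\<lambda>x. of_real (x $ i) * h x) \<xi> = 0"
proof -
  have "((\<lambda>t. 0) has_vector_derivative fourier (\<lambda>x. - \<i> * (of_real (x $ i) * h x)) \<xi>) (at 0)"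
    using has_dir_deriv_cong[OF S \<xi> _ fourier_dir_deriv[OF h], of "\<lambda>_. 0"] z by simp
  then have "fourier (\<lambda>x. - \<i> * (of_real (x $ i) * h x)) \<xi> = 0"
    by (metis has_vector_derivative_const vector_derivative_at)
  then show ?thesis by (simp add: fourier_def mult.assoc)
qed

section \<open>Decay of inverse transforms of smooth, compactly supported multipliers\<close>

lemma dir_deriv_outside:
  assumes "\<And>y. norm y > R \<Longrightarrow> g y = 0" "norm x > R"
  shows "dir_deriv e g x = 0"
proof (rule dir_derivI)
  have o: "open {y::'a. norm y > R}" by (intro open_Collect_less continuous_intros)
  show "((\<lambda>t. g (x + t *\<^sub>R e)) has_vector_derivative 0) (at 0)"
    by (rule has_dir_deriv_cong[OF o, of _ "\<lambda>_. 0"]) (use assms in auto)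
qed

text \<open>Each difference quotient has integral zero by translation invariance, and the derivative
  is their dominated limit. The bound on \<open>norm e\<close> keeps all quotients supported in one
  fixed ball of radius \<open>R + 1\<close>.\<close>

lemma integral_dir_deriv_zero:
  fixes G :: "real^'n::finite \<Rightarrow> complex"
  assumes G: "smooth_dir (Suc 0) e UNIV G" and supp: "\<And>y. norm y > R \<Longrightarrow> G y = 0" and e: "norm e \<le> 1"
  shows "(\<integral>x. dir_deriv e G x \<partial>lborel) = 0"
proof -
  let ?D = "dir_deriv e G"
  have contG: "continuous_on UNIV G" and contD: "continuous_on UNIV ?D"
    and der: "\<And>x. ((\<lambda>t. G (x + t *\<^sub>R e)) has_vector_derivative ?D x) (at 0)"
    using G by auto
  have suppD: "norm y > R \<Longrightarrow> ?D y = 0" for y by (rule dir_deriv_outside[OF supp])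
  note [measurable] = borel_measurable_continuous_onI[OF contG] borel_measurable_continuous_onI[OF contD]
  obtain B where B: "\<And>x. norm (?D x) \<le> B" "B \<ge> 0"
  proof -
    have "compact (?D ` cball 0 R)"
      by (intro compact_continuous_image continuous_on_subset[OF contD]) auto
    then obtain B where B: "\<And>\<xi>. \<xi> \<in> cball 0 R \<Longrightarrow> norm (?D \<xi>) \<le> B"
      by (meson bounded_iff compact_imp_bounded imageI)
    have "norm (?D x) \<le> \<bar>B\<bar>" for x
      using B[of x] suppD[of x] by (cases "norm x \<le> R") auto
    then show ?thesis using that[of "\<bar>B\<bar>"] by auto
  qed
  \<comment> \<open>The hypothesis gives derivatives at parameter 0 only; moving the base point
    along the line yields them at every parameter, as the mean value inequality requires.\<close>
  have der': "((\<lambda>t. G (x + t *\<^sub>R e)) has_derivative (\<lambda>h. h *\<^sub>R ?D (x + t *\<^sub>R e))) (at t within UNIV)" for x t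
  proof -
    have 1: "((\<lambda>s. s - t) has_vector_derivative 1) (at t)"
      by (auto intro!: derivative_eq_intros)
    have 2: "((\<lambda>s. G ((x + t *\<^sub>R e) + s *\<^sub>R e)) has_vector_derivative ?D (x + t *\<^sub>R e)) (at (t - t))"
      using der by simp
    have "((\<lambda>s. G (x + t *\<^sub>R e + (s - t) *\<^sub>R e)) has_derivative (\<lambda>h. h *\<^sub>R ?D (x + t *\<^sub>R e))) (at t)"
      using vector_diff_chain_at[OF 1 2] by (simp add: comp_def has_vector_derivative_def)
    then show ?thesis by (simp add: algebra_simps)
  qed
  define s where "s n x = (real (Suc n)) *\<^sub>R (G (x + (1 / real (Suc n)) *\<^sub>R e) - G x)" for n x
  have sb: "norm (s n x) \<le> B" for n x
  proof -
    have "norm (G (x + (1 / real (Suc n)) *\<^sub>R e) - G (x + 0 *\<^sub>R e)) \<le> B * norm (1 / real (Suc n) - 0)"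
      by (rule differentiable_bound[where f="\<lambda>t. G (x + t *\<^sub>R e)" and B=B, OF convex_UNIV der'])
         (auto simp: onorm_scaleR_left onorm_id bounded_linear_ident intro: B)
    then show ?thesis unfolding s_def norm_scaleR by (simp del: of_nat_Suc add: field_simps)
  qed
  have int: "integrable lborel G" by (rule integrable_compact_support[OF contG supp])
  have int': "integrable lborel (\<lambda>x. G (x + v))" for v
    using integrable_affine[OF int, of 1 v] by (simp add: add.commute)
  have "(\<integral>x. G (x + v) \<partial>lborel) = (\<integral>x. G x \<partial>lborel)" for v
    using integral_affine[OF _ int, of 1 v] by (simp add: add.commute)
  then have "(\<integral>x. s n x \<partial>lborel) = 0" for n
    unfolding s_def integral_scaleR_right Bochner_Integration.integral_diff[OF int' int] by simp
  moreover have "(\<lambda>n. \<integral>x. s n x \<partial>lborel) \<longlonglongrightarrow> (\<integral>x. ?D x \<partial>lborel)"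
  proof (rule integral_dominated_convergence[where w="\<lambda>x. indicator (cball 0 (R + 1)) x *\<^sub>R B"])
    show "integrable lborel (\<lambda>x::real^'n. indicator (cball 0 (R + 1)) x *\<^sub>R B)"
      using emeasure_lborel_cball_finite[of "0::real^'n" "R + 1"]
      by (intro integrable_scaleR_left integrable_real_indicator) (auto simp: top.not_eq_extremum)
    show "s n \<in> borel_measurable lborel" for n unfolding s_def by measurable
    show "AE x in lborel. (\<lambda>n. s n x) \<longlonglongrightarrow> ?D x"
    proof (intro always_eventually allI)
      fix x
      have "((\<lambda>t. (1 / t) *\<^sub>R (G (x + t *\<^sub>R e) - G (x + 0 *\<^sub>R e))) \<longlongrightarrow> ?D x) (at 0)"
        using der[of x] unfolding has_vector_derivative_quotient .
      then have lim: "(\<lambda>n. (1 / X n) *\<^sub>R (G (x + X n *\<^sub>R e) - G (x + 0 *\<^sub>R e))) \<longlonglongrightarrow> ?D x"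
        if "\<forall>n. X n \<in> UNIV - {0}" "X \<longlonglongrightarrow> 0" for X
        using that unfolding tendsto_at_iff_sequentially comp_def by blast
      have "(\<lambda>n. 1 / real (Suc n)) \<longlonglongrightarrow> 0" by (rule lim_1_over_n[THEN LIMSEQ_Suc])
      from lim[OF _ this] have "(\<lambda>n. (1 / (1 / real (Suc n))) *\<^sub>R (G (x + (1 / real (Suc n)) *\<^sub>R e) - G (x + 0 *\<^sub>R e))) \<longlonglongrightarrow> ?D x"
        by auto
      then show "(\<lambda>n. s n x) \<longlonglongrightarrow> ?D x" by (simp add: s_def)
    qed
    show "AE x in lborel. norm (s n x) \<le> indicator (cball 0 (R + 1)) x *\<^sub>R B" for n
    proof (intro always_eventually allI)
      fix x
      show "norm (s n x) \<le> indicator (cball 0 (R + 1)) x *\<^sub>R B"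
      proof (cases "norm x \<le> R + 1")
        case False
        have "norm ((1 / real (Suc n)) *\<^sub>R e) \<le> 1 * 1"
          unfolding norm_scaleR using e by (intro mult_mono) (auto simp: field_simps)
        then have "norm (x + (1 / real (Suc n)) *\<^sub>R e) > R"
          using False norm_diff_ineq[of x "(1 / real (Suc n)) *\<^sub>R e"] by linarith
        then show ?thesis using False by (simp add: s_def supp)
      qed (use sb in \<open>simp add: indicator_def\<close>)
    qed
  qed simp
  ultimately show ?thesis by (simp add: LIMSEQ_const_iff)
qed

text \<open>Written without the normalising power of 2 pi; that constant is put into the multipliers
  where they are constructed.\<close>

definition inv_fourier :: "(real^'n::finite \<Rightarrow> complex) \<Rightarrow> real^'n \<Rightarrow> complex" where
  "inv_fourier m x = (\<integral>\<eta>. m \<eta> * cis (x \<bullet> \<eta>) \<partial>lborel)"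

text \<open>Integration by parts: the derivative of the product of \<open>m\<close> with the
  exponential integrates to zero.\<close>

lemma inv_fourier_dir_deriv:
  fixes m :: "real^'n::finite \<Rightarrow> complex"
  assumes m: "smooth_dir (Suc 0) e UNIV m" and supp: "\<And>y. norm y > R \<Longrightarrow> m y = 0" and e: "norm e \<le> 1"
  shows "inv_fourier (dir_deriv e m) x = - (\<i> * of_real (x \<bullet> e)) * inv_fourier m x"
proof -
  define G where "G \<eta> = m \<eta> * cis (x \<bullet> \<eta>)" for \<eta>
  define G' where "G' \<eta> = m \<eta> * (\<i> * of_real (x \<bullet> e) * cis (x \<bullet> \<eta>)) + dir_deriv e m \<eta> * cis (x \<bullet> \<eta>)" for \<eta>
  have contm: "continuous_on UNIV m" and contD: "continuous_on UNIV (dir_deriv e m)"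
    and der: "\<And>x. ((\<lambda>t. m (x + t *\<^sub>R e)) has_vector_derivative dir_deriv e m x) (at 0)"
    using m by auto
  have derG: "((\<lambda>t. G (\<eta> + t *\<^sub>R e)) has_vector_derivative G' \<eta>) (at 0)" for \<eta>
  proof -
    have "((\<lambda>t. cis (x \<bullet> (\<eta> + t *\<^sub>R e))) has_vector_derivative \<i> * of_real (x \<bullet> e) * cis (x \<bullet> \<eta>)) (at 0)"
      using has_vector_derivative_cis_linear[of "x \<bullet> \<eta>" "x \<bullet> e"] by (simp add: inner_add_right)
    from has_vector_derivative_mult[OF der[of \<eta>] this]
    show ?thesis unfolding G_def G'_def by simp
  qed
  have contG': "continuous_on UNIV G'"
    unfolding G'_def by (intro continuous_intros contm contD)
  have "smooth_dir (Suc 0) e UNIV G"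
    by (rule smooth_dir_SucI[OF open_UNIV _ _ derG])
       (auto simp: G_def[abs_def] contG' intro!: continuous_intros contm)
  from integral_dir_deriv_zero[OF this _ e, of R] have "(\<integral>\<eta>. dir_deriv e G \<eta> \<partial>lborel) = 0"
    by (simp add: G_def supp)
  moreover have "dir_deriv e G = G'" using dir_derivI[OF derG] by blast
  ultimately have 0: "(\<integral>\<eta>. G' \<eta> \<partial>lborel) = 0" by simp
  have i1: "integrable lborel (\<lambda>\<eta>. m \<eta> * cis (x \<bullet> \<eta>))"
    by (rule integrable_compact_support[of _ R]) (auto intro!: continuous_intros contm simp: supp)
  have i2: "integrable lborel (\<lambda>\<eta>. dir_deriv e m \<eta> * cis (x \<bullet> \<eta>))"
    by (rule integrable_compact_support[of _ R]) (auto intro!: continuous_intros contD simp: dir_deriv_outside[OF supp])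
  have "(\<lambda>\<eta>. G' \<eta>) = (\<lambda>\<eta>. (\<i> * of_real (x \<bullet> e)) * (m \<eta> * cis (x \<bullet> \<eta>)) + dir_deriv e m \<eta> * cis (x \<bullet> \<eta>))"
    by (simp add: G'_def fun_eq_iff algebra_simps)
  then have "(\<integral>\<eta>. G' \<eta> \<partial>lborel) = (\<i> * of_real (x \<bullet> e)) * inv_fourier m x + inv_fourier (dir_deriv e m) x"
    unfolding inv_fourier_def
    by (simp only: Bochner_Integration.integral_add[OF integrable_mult_right[OF i1] i2] integral_mult_right_zero)
  with 0 show ?thesis by (simp add: add_eq_0_iff)
qed

lemma inv_fourier_decay:
  fixes m :: "real^'n::finite \<Rightarrow> complex"
  assumes "smooth_dir N e UNIV m" "\<And>y. norm y > R \<Longrightarrow> m y = 0" "norm e \<le> 1"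
  shows "\<exists>C. \<forall>x. \<bar>x \<bullet> e\<bar> ^ N * norm (inv_fourier m x) \<le> C"
  using assms(1,2)
proof (induction N arbitrary: m)
  case 0
  have "norm (inv_fourier m x) \<le> (\<integral>\<eta>. norm (m \<eta>) \<partial>lborel)" for x
    unfolding inv_fourier_def by (rule order_trans[OF integral_norm_bound]) (simp add: norm_mult)
  then show ?case by auto
next
  case (Suc N)
  have "smooth_dir (Suc 0) e UNIV m" using Suc.prems(1) smooth_dir_continuous by auto
  note eq = inv_fourier_dir_deriv[OF this Suc.prems(2) assms(3)]
  have "\<exists>C. \<forall>x. \<bar>x \<bullet> e\<bar> ^ N * norm (inv_fourier (dir_deriv e m) x) \<le> C"
    using Suc.prems by (intro Suc.IH) (auto intro: dir_deriv_outside)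
  then show ?case by (simp add: eq norm_mult mult_ac)
qed

text \<open>The norm is at most the dimension times the largest coordinate, so decay of all orders
  along the axes gives decay in every direction. Taking the maximum with 1 lets a plain bound handle
  the points near the origin.\<close>

lemma rapid_decay_inv_fourier:
  fixes m :: "real^'n::finite \<Rightarrow> complex"
  assumes sm: "\<And>N i. smooth_dir N (axis i 1) UNIV m" and supp: "\<And>y. norm y > R \<Longrightarrow> m y = 0"
  shows "rapid_decay (inv_fourier m)"
  unfolding rapid_decay_def
proof
  fix N
  have "\<exists>C. \<forall>x. \<bar>x \<bullet> axis i 1\<bar> ^ N * norm (inv_fourier m x) \<le> C" for i
    by (rule inv_fourier_decay[OF sm supp]) auto
  then obtain C where C: "\<And>i x. \<bar>x $ i\<bar> ^ N * norm (inv_fourier m x) \<le> C i"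
    unfolding inner_axis by simp metis
  obtain C0 where C0: "\<And>x. norm (inv_fourier m x) \<le> C0"
    using inv_fourier_decay[of 0 "axis undefined 1" m R] sm supp by fastforce
  define n where "n = real CARD('n)"
  have "(1 + norm x) ^ N * norm (inv_fourier m x) \<le> (1 + n) ^ N * (C0 + (\<Sum>i\<in>UNIV. C i))" for x :: "real^'n"
  proof -
    define M where "M = Max (insert 1 (range (\<lambda>i. \<bar>x $ i\<bar>)))"
    have M: "1 \<le> M" "\<And>i. \<bar>x $ i\<bar> \<le> M" unfolding M_def by (rule Max_ge; simp)+
    have "norm x \<le> (\<Sum>i\<in>UNIV. \<bar>x $ i\<bar>)" by (rule norm_le_l1_cart)
    also have "\<dots> \<le> n * M" unfolding n_def using sum_bounded_above[of UNIV "\<lambda>i. \<bar>x $ i\<bar>" M] M by simp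
    finally have "(1 + norm x) ^ N \<le> ((1 + n) * M) ^ N"
      using M by (intro power_mono) (auto simp: algebra_simps)
    then have 1: "(1 + norm x) ^ N * norm (inv_fourier m x) \<le> (1 + n) ^ N * (M ^ N * norm (inv_fourier m x))"
      by (simp add: power_mult_distrib mult_right_mono flip: mult.assoc)
    have C_nonneg: "C i \<ge> 0" for i by (rule order_trans[OF _ C[of x i]]) simp
    have C0_nonneg: "C0 \<ge> 0" by (rule order_trans[OF norm_ge_zero C0])
    have "M \<in> insert 1 (range (\<lambda>i. \<bar>x $ i\<bar>))" unfolding M_def by (intro Max_in) auto
    then consider "M = 1" | i where "M = \<bar>x $ i\<bar>" by auto
    then have "M ^ N * norm (inv_fourier m x) \<le> C0 + (\<Sum>i\<in>UNIV. C i)"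
    proof cases
      case 1
      then show ?thesis using C0[of x] sum_nonneg[of UNIV C] C_nonneg by simp
    next
      case 2
      then show ?thesis using C[of x i] member_le_sum[of i UNIV C] C_nonneg C0_nonneg by simp
    qed
    then have "(1 + n) ^ N * (M ^ N * norm (inv_fourier m x)) \<le> (1 + n) ^ N * (C0 + (\<Sum>i\<in>UNIV. C i))"
      by (intro mult_left_mono) (auto simp: n_def)
    with 1 show ?thesis by linarith
  qed
  then show "\<exists>C. \<forall>x. (1 + norm x) ^ N * norm (inv_fourier m x) \<le> C" by blast
qed

section \<open>Sampling band-limited functions\<close>

lemma inv_fourier_measurable:
  fixes m :: "real^'n::finite \<Rightarrow> complex"
  assumes [measurable]: "m \<in> borel_measurable borel"
  shows "inv_fourier m \<in> borel_measurable borel"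
proof -
  have [measurable]: "cis \<in> borel_measurable borel"
    by (intro borel_measurable_continuous_onI continuous_intros)
  show ?thesis unfolding inv_fourier_def[abs_def] by measurable
qed

text \<open>Each term is an integral over the frequency. After the sum is moved inside, Poisson
  summation collapses it to \<open>fourier \<phi> \<eta>\<close> at every frequency where
  \<open>m\<close> can be nonzero.\<close>

lemma sampling_inv_fourier:
  fixes \<phi> m :: "real^'n::finite \<Rightarrow> complex"
  assumes \<phi>: "rapid \<phi>" and supp\<phi>: "\<And>\<xi>. norm \<xi> > 2 \<Longrightarrow> fourier \<phi> \<xi> = 0"
    and contm: "continuous_on UNIV m" and suppm: "\<And>\<eta>. norm \<eta> > 2 \<Longrightarrow> m \<eta> = 0"
  shows "(\<lambda>a. inv_fourier m (x - lpt a - u) * \<phi> (lpt a + u)) sums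
    (\<integral>\<eta>. m \<eta> * fourier \<phi> \<eta> * cis (x \<bullet> \<eta>) \<partial>lborel)"
proof -
  obtain C where C: "C > 0" "\<And>x. norm (\<phi> x) \<le> C * wt x" using rapid_wt[OF \<phi>] by blast
  define f where "f a \<eta> = m \<eta> * cis (x \<bullet> \<eta>) * (\<phi> (lpt a + u) * cis (- ((lpt a + u) \<bullet> \<eta>)))" for a \<eta>
  have intm: "integrable lborel m" by (rule integrable_compact_support[OF contm suppm])
  have nf: "norm (f a \<eta>) \<le> norm (m \<eta>) * (C * wt (lpt a + u))" for a \<eta>
    using C(2)[of "lpt a + u"] by (simp add: f_def norm_mult mult_left_mono)
  have contf: "continuous_on UNIV (f a)" for a
    unfolding f_def by (intro continuous_intros contm)
  have intf: "integrable lborel (f a)" for a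
    by (rule integrable_compact_support[OF contf, of 2]) (simp add: f_def suppm)
  have "(\<lambda>a. integral\<^sup>L lborel (f a)) sums (\<integral>\<eta>. (\<Sum>a. f a \<eta>) \<partial>lborel)"
  proof (rule sums_integral[OF intf])
    show "AE \<eta> in lborel. summable (\<lambda>a. norm (f a \<eta>))"
    proof (intro always_eventually allI)
      fix \<eta>
      show "summable (\<lambda>a. norm (f a \<eta>))"
        by (rule summable_comparison_test'[of "\<lambda>a. norm (m \<eta>) * (C * wt (lpt a + u))" 0])
           (auto intro!: summable_mult summable_wt nf)
    qed
    show "summable (\<lambda>a. \<integral>\<eta>. norm (f a \<eta>) \<partial>lborel)"
    proof (rule summable_comparison_test'[of "\<lambda>a. (\<integral>\<eta>. norm (m \<eta>) \<partial>lborel) * (C * wt (lpt a + u))" 0])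
      show "summable (\<lambda>a. (\<integral>\<eta>. norm (m \<eta>) \<partial>lborel) * (C * wt (lpt a + u)))"
        by (intro summable_mult summable_wt)
      fix a
      have "(\<integral>\<eta>. norm (f a \<eta>) \<partial>lborel) \<le> (\<integral>\<eta>. norm (m \<eta>) * (C * wt (lpt a + u)) \<partial>lborel)"
        by (rule integral_mono[OF integrable_norm[OF intf] integrable_mult_left[OF integrable_norm[OF intm]] nf])
      moreover have "0 \<le> (\<integral>\<eta>. norm (f a \<eta>) \<partial>lborel)" by (rule integral_nonneg_AE) simp
      ultimately show "norm (\<integral>\<eta>. norm (f a \<eta>) \<partial>lborel) \<le> (\<integral>\<eta>. norm (m \<eta>) \<partial>lborel) * (C * wt (lpt a + u))"
        by simp
    qed
  qed
  moreover have "integral\<^sup>L lborel (f a) = inv_fourier m (x - lpt a - u) * \<phi> (lpt a + u)" for a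
  proof -
    have "f a = (\<lambda>\<eta>. m \<eta> * cis ((x - lpt a - u) \<bullet> \<eta>) * \<phi> (lpt a + u))"
    proof
      fix \<eta>
      have "cis ((x - lpt a - u) \<bullet> \<eta>) = cis (x \<bullet> \<eta>) * cis (- ((lpt a + u) \<bullet> \<eta>))"
        by (simp add: cis_mult inner_simps algebra_simps)
      then show "f a \<eta> = m \<eta> * cis ((x - lpt a - u) \<bullet> \<eta>) * \<phi> (lpt a + u)"
        by (simp add: f_def)
    qed
    then show ?thesis by (simp add: inv_fourier_def)
  qed
  moreover have "(\<Sum>a. f a \<eta>) = m \<eta> * fourier \<phi> \<eta> * cis (x \<bullet> \<eta>)" for \<eta>
  proof (cases "norm \<eta> > 2")
    case True
    then show ?thesis by (simp add: f_def suppm)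
  next
    case False
    have "(\<lambda>a. \<phi> (lpt a + u) * cis (- ((lpt a + u) \<bullet> \<eta>))) sums fourier \<phi> \<eta>"
    proof (rule poisson_summation[OF \<phi> supp\<phi>])
      fix k :: "int^'n" assume "k \<noteq> 0"
      then obtain i where i: "k $ i \<noteq> 0" by (metis vec_eq_iff zero_index)
      have "1 \<le> \<bar>real_of_int (k $ i)\<bar>" using i by linarith
      also have "\<dots> \<le> norm (lat k)" using component_le_norm_cart[of "lat k" i] by simp
      \<comment> \<open>A nonzero vector of the dual lattice is longer than 4 = 2 + 2, so it carries
        every frequency of the ball of radius 2 out of the spectrum of
        \<open>\<phi>\<close>.\<close>
      finally have "2 * pi * 1 \<le> 2 * pi * norm (lat k)" by (intro mult_left_mono) auto
      moreover have "norm ((2 * pi) *\<^sub>R lat k) = 2 * pi * norm (lat k)" by simp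
      ultimately have "norm ((2 * pi) *\<^sub>R lat k) > 4" using pi_gt3 by linarith
      then show "2 < norm (\<eta> + (2 * pi) *\<^sub>R lat k)"
        using False norm_diff_ineq[of "(2 * pi) *\<^sub>R lat k" \<eta>] by (simp add: add.commute)
    qed
    from sums_mult[OF this, of "m \<eta> * cis (x \<bullet> \<eta>)"]
    show ?thesis unfolding f_def sums_iff by simp
  qed
  ultimately show ?thesis by simp
qed

lemma fourier_scaled:
  fixes h :: "real^'n::finite \<Rightarrow> complex"
  assumes h: "rapid h" and c: "c > 0"
  shows "fourier h (c *\<^sub>R \<eta>) = fourier (\<lambda>x. of_real ((1 / c) ^ CARD('n)) * h ((1 / c) *\<^sub>R x)) \<eta>"
proof -
  have eq: "((1 / c) *\<^sub>R x) \<bullet> (c *\<^sub>R \<eta>) = x \<bullet> \<eta>" for x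
    using c by simp
  have "fourier h (c *\<^sub>R \<eta>) = \<bar>1 / c\<bar> ^ CARD('n) *\<^sub>R
      (\<integral>x. h ((1 / c) *\<^sub>R x) * cis (- (((1 / c) *\<^sub>R x) \<bullet> (c *\<^sub>R \<eta>))) \<partial>lborel)"
    unfolding fourier_def
    using integral_affine[OF _ rapid_integrable[OF rapid_mult_cis[OF h, of "c *\<^sub>R \<eta>"]], of "1 / c" 0] c
    by simp
  also have "\<dots> = (\<integral>x. of_real ((1 / c) ^ CARD('n)) * h ((1 / c) *\<^sub>R x) * cis (- (x \<bullet> \<eta>)) \<partial>lborel)"
    using c unfolding eq scaleR_conv_of_real[of "\<bar>1 / c\<bar> ^ CARD('n)"] integral_mult_right_zero[symmetric]
    by (simp add: mult.assoc)
  finally show ?thesis by (simp add: fourier_def)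
qed

lemma smooth_dir_fourier_scaled:
  fixes h :: "real^'n::finite \<Rightarrow> complex"
  assumes h: "rapid h" and c: "c > 0"
  shows "smooth_dir N (axis i 1) UNIV (\<lambda>\<eta>. fourier h (c *\<^sub>R \<eta>))"
  unfolding fourier_scaled[OF assms]
  using rapid_affine[OF h, of "1 / c" 0] c by (intro smooth_dir_fourier rapid_mult_const) simp

text \<open>The denominator \<open>D\<close> in the proof is positive on the annulus because the sets
  \<open>3/5 \<le> 2\<^sup>-\<^sup>l|\<xi>| \<le> 5/3\<close>, \<open>l \<in> {-1,0,1}\<close>, cover it.\<close>

lemma band_limited_sampling:
  fixes \<phi> \<theta> :: "real^'n::finite \<Rightarrow> complex"
  assumes \<phi>: "rapid \<phi>" and \<theta>: "rapid \<theta>"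
    and supp\<phi>: "\<And>\<xi>. fourier \<phi> \<xi> \<noteq> 0 \<Longrightarrow> 1/2 \<le> norm \<xi> \<and> norm \<xi> \<le> 2"
    and supp\<theta>: "\<And>\<xi>. fourier \<theta> \<xi> \<noteq> 0 \<Longrightarrow> 1/2 \<le> norm \<xi> \<and> norm \<xi> \<le> 2"
    and lower: "\<And>\<xi>. 3/5 \<le> norm \<xi> \<Longrightarrow> norm \<xi> \<le> 5/3 \<Longrightarrow> fourier \<phi> \<xi> \<noteq> 0"
  obtains M :: "int \<Rightarrow> real^'n \<Rightarrow> complex" where "\<And>i. rapid_decay (M i)" "\<And>i. M i \<in> borel_measurable borel"
    "\<And>x u. (\<lambda>a. \<Sum>i\<in>{-1,0,1}. of_real ((2 powr real_of_int i) ^ CARD('n)) *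
        (M i ((2 powr real_of_int i) *\<^sub>R x - lpt a - u i) * \<phi> (lpt a + u i))) sums \<theta> x"
proof -
  let ?I = "{-1,0,1} :: int set"
  define p where "p i = 2 powr real_of_int i" for i :: int
  have p: "p i > 0" "p i * p (- i) = 1" for i by (auto simp: p_def powr_minus)
  define D where "D \<xi> = (\<Sum>l\<in>?I. fourier \<phi> (p (- l) *\<^sub>R \<xi>) * cnj (fourier \<phi> (p (- l) *\<^sub>R \<xi>)))" for \<xi>
  define K where "K = (complex_of_real ((2 * pi) ^ CARD('n)))"
  have K0: "K \<noteq> 0" by (simp add: K_def)
  \<comment> \<open>The factor \<open>cnj (fourier \<phi> \<eta>)\<close> makes the pieces add up:
    after undoing the dilations, \<open>m i\<close> times the transform of \<open>\<phi>\<close>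
    sums over \<open>i\<close> to the transform of \<open>\<theta>\<close> times
    \<open>D / D\<close>, up to the constant \<open>K\<close>. It also confines each multiplier to
    the ball of radius 2.\<close>
  define m where "m i \<eta> = inverse K * (fourier \<theta> (p i *\<^sub>R \<eta>) * cnj (fourier \<phi> \<eta>)) * inverse (D (p i *\<^sub>R \<eta>))" for i \<eta>
  have Dne: "D \<xi> \<noteq> 0" if "1/2 \<le> norm \<xi>" "norm \<xi> \<le> 2" for \<xi>
  proof -
    have "\<exists>l\<in>?I. fourier \<phi> (p (- l) *\<^sub>R \<xi>) \<noteq> 0"
    proof -
      consider "norm \<xi> < 3/5" | "3/5 \<le> norm \<xi>" "norm \<xi> \<le> 5/3" | "norm \<xi> > 5/3" by linarith
      then show ?thesis
      proof cases
        case 1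
        then have "fourier \<phi> (p (- (-1)) *\<^sub>R \<xi>) \<noteq> 0" using that by (intro lower) (auto simp: p_def)
        then show ?thesis by blast
      next
        case 2
        then have "fourier \<phi> (p (- 0) *\<^sub>R \<xi>) \<noteq> 0" by (intro lower) (auto simp: p_def)
        then show ?thesis by blast
      next
        case 3
        then have "fourier \<phi> (p (- 1) *\<^sub>R \<xi>) \<noteq> 0" using that by (intro lower) (auto simp: p_def powr_minus)
        then show ?thesis by blast
      qed
    qed
    then obtain l where l: "l \<in> ?I" "fourier \<phi> (p (- l) *\<^sub>R \<xi>) \<noteq> 0" by blast
    have "D \<xi> = of_real (\<Sum>l\<in>?I. (norm (fourier \<phi> (p (- l) *\<^sub>R \<xi>)))\<^sup>2)"
      unfolding D_def of_real_sum by (intro sum.cong refl) (simp only: complex_norm_square)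
    moreover have "(\<Sum>l\<in>?I. (norm (fourier \<phi> (p (- l) *\<^sub>R \<xi>)))\<^sup>2) > 0"
      by (rule sum_pos2[OF _ l(1)]) (use l(2) in auto)
    ultimately show ?thesis by (metis of_real_eq_0_iff less_irrefl)
  qed
  have suppm: "m i \<eta> = 0" if "norm \<eta> > 2" for i \<eta>
    using that supp\<phi>[of \<eta>] by (auto simp: m_def)
  have smD: "smooth_dir N (axis j 1) UNIV (\<lambda>\<eta>. D (p i *\<^sub>R \<eta>))" for N i and j :: 'n
    unfolding D_def scaleR_scaleR
    by (intro smooth_dir_sum smooth_dir_mult smooth_dir_cnj smooth_dir_fourier_scaled \<phi> open_UNIV mult_pos_pos p)
  have contD: "continuous_on UNIV (\<lambda>\<eta>. D (p i *\<^sub>R \<eta>))" for i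
    using smD[of 0] by simp
  have smooth_subset: "smooth_dir N e UNIV g \<Longrightarrow> open S \<Longrightarrow> smooth_dir N e S g" for N S g and e :: "real^'n"
    by (induction N arbitrary: g) (auto intro: continuous_on_subset)
  have smm: "smooth_dir N (axis j 1) UNIV (m i)" for N i and j :: 'n
  proof -
    \<comment> \<open>On \<open>S\<close> the quotient is smooth because its denominator does not
      vanish; on \<open>T\<close> the numerator is identically zero. They cover the space since
      \<open>D\<close> is nonzero on the annulus.\<close>
    define S where "S = {\<eta>. D (p i *\<^sub>R \<eta>) \<noteq> 0}"
    define T where "T = {\<eta> :: real^'n. norm (p i *\<^sub>R \<eta>) < 1/2} \<union> {\<eta>. norm (p i *\<^sub>R \<eta>) > 2}"
    have S: "open S" unfolding S_def by (intro open_Collect_neq contD continuous_intros)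
    have T: "open T" unfolding T_def by (intro open_Un open_Collect_less continuous_intros)
    have ST: "S \<union> T = UNIV"
    proof -
      have "\<eta> \<in> S" if "\<eta> \<notin> T" for \<eta>
        using that Dne[of "p i *\<^sub>R \<eta>"] by (simp add: S_def T_def not_less)
      then show ?thesis by blast
    qed
    have "smooth_dir N (axis j 1) S (m i)"
      unfolding m_def
    proof (intro smooth_dir_mult smooth_dir_const smooth_dir_cnj smooth_dir_inverse S)
      show "smooth_dir N (axis j 1) S (\<lambda>\<eta>. fourier \<theta> (p i *\<^sub>R \<eta>))"
        by (rule smooth_subset[OF smooth_dir_fourier_scaled[OF \<theta> p(1)] S])
      show "smooth_dir N (axis j 1) S (fourier \<phi>)"
        by (rule smooth_subset[OF smooth_dir_fourier[OF \<phi>] S])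
      show "smooth_dir N (axis j 1) S (\<lambda>\<eta>. D (p i *\<^sub>R \<eta>))" by (rule smooth_subset[OF smD S])
    qed (simp add: S_def)
    moreover have "smooth_dir N (axis j 1) T (m i)"
    proof (rule smooth_dir_cong[OF T _ smooth_dir_const[OF T, of N _ 0]])
      fix \<eta> assume "\<eta> \<in> T"
      then show "0 = m i \<eta>" using supp\<theta>[of "p i *\<^sub>R \<eta>"] by (auto simp: T_def m_def)
    qed
    ultimately show ?thesis using smooth_dir_Un[OF S T] ST by metis
  qed
  have contm: "continuous_on UNIV (m i)" for i using smm[of 0] by simp
  define T where "T i x = (\<integral>\<eta>. m i \<eta> * fourier \<phi> \<eta> * cis (x \<bullet> \<eta>) \<partial>lborel)" for i x
  have samp: "(\<lambda>a. inv_fourier (m i) (x - lpt a - u) * \<phi> (lpt a + u)) sums T i x" for i x u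
    unfolding T_def by (rule sampling_inv_fourier[OF \<phi> _ contm suppm]) (use supp\<phi> in force)
  have intT: "integrable lborel (\<lambda>\<eta>. m i \<eta> * fourier \<phi> \<eta> * cis (x \<bullet> \<eta>))" for i x
    by (rule integrable_compact_support[of _ 2])
       (auto intro!: continuous_intros contm fourier_continuous[OF \<phi>] simp: suppm)
  have decomp: "fourier \<theta> \<xi> = K * (\<Sum>i\<in>?I. m i (p (- i) *\<^sub>R \<xi>) * fourier \<phi> (p (- i) *\<^sub>R \<xi>))" for \<xi>
  proof -
    have "(\<Sum>i\<in>?I. m i (p (- i) *\<^sub>R \<xi>) * fourier \<phi> (p (- i) *\<^sub>R \<xi>))
      = (\<Sum>i\<in>?I. inverse K * fourier \<theta> \<xi> * inverse (D \<xi>) * (fourier \<phi> (p (- i) *\<^sub>R \<xi>) * cnj (fourier \<phi> (p (- i) *\<^sub>R \<xi>))))"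
      by (intro sum.cong refl) (simp add: m_def p mult_ac)
    also have "\<dots> = inverse K * fourier \<theta> \<xi> * inverse (D \<xi>) * D \<xi>"
      unfolding D_def by (rule sum_distrib_left[symmetric])
    finally show ?thesis
      using Dne[of \<xi>] supp\<theta>[of \<xi>] K0 by (cases "fourier \<theta> \<xi> = 0") auto
  qed
  have T_scaled: "integrable lborel (\<lambda>\<xi>. m i (p (- i) *\<^sub>R \<xi>) * fourier \<phi> (p (- i) *\<^sub>R \<xi>) * cis (x \<bullet> \<xi>))"
    "(\<integral>\<xi>. m i (p (- i) *\<^sub>R \<xi>) * fourier \<phi> (p (- i) *\<^sub>R \<xi>) * cis (x \<bullet> \<xi>) \<partial>lborel) = of_real (p i ^ CARD('n)) * T i (p i *\<^sub>R x)" for i x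
  proof -
    have eq: "(p i *\<^sub>R x) \<bullet> (p (- i) *\<^sub>R \<xi>) = x \<bullet> \<xi>" for \<xi>
      using p(2)[of i] by (simp add: mult.assoc[symmetric] mult.commute[of "p (- i)"])
    show int: "integrable lborel (\<lambda>\<xi>. m i (p (- i) *\<^sub>R \<xi>) * fourier \<phi> (p (- i) *\<^sub>R \<xi>) * cis (x \<bullet> \<xi>))"
      using integrable_affine[OF intT[of i "p i *\<^sub>R x"], of "p (- i)" 0] p(1)[of "- i"] by (simp only: add_0 eq)
    have "p (- i) * p i = 1" using p(2)[of i] by (simp add: mult.commute)
    then have e: "p (- i) *\<^sub>R (p i *\<^sub>R \<eta>) = \<eta>" "x \<bullet> (p i *\<^sub>R \<eta>) = (p i *\<^sub>R x) \<bullet> \<eta>" for \<eta> by simp_all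
    have "(\<integral>\<xi>. m i (p (- i) *\<^sub>R \<xi>) * fourier \<phi> (p (- i) *\<^sub>R \<xi>) * cis (x \<bullet> \<xi>) \<partial>lborel) = (p i ^ CARD('n)) *\<^sub>R T i (p i *\<^sub>R x)"
      using integral_affine[OF _ int, of "p i" 0] p(1)[of i] unfolding T_def add_0 e by simp
    then show "(\<integral>\<xi>. m i (p (- i) *\<^sub>R \<xi>) * fourier \<phi> (p (- i) *\<^sub>R \<xi>) * cis (x \<bullet> \<xi>) \<partial>lborel) = of_real (p i ^ CARD('n)) * T i (p i *\<^sub>R x)"
      by (simp only: scaleR_conv_of_real)
  qed
  have main: "\<theta> x = (\<Sum>i\<in>?I. of_real (p i ^ CARD('n)) * T i (p i *\<^sub>R x))" for x
  proof -
    have "K * \<theta> x = (\<integral>\<xi>. fourier \<theta> \<xi> * cis (x \<bullet> \<xi>) \<partial>lborel)"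
      unfolding K_def by (rule fourier_inversion_bandlimited[OF \<theta>, symmetric]) (use supp\<theta> in force)
    also have "\<dots> = (\<integral>\<xi>. K * (\<Sum>i\<in>?I. m i (p (- i) *\<^sub>R \<xi>) * fourier \<phi> (p (- i) *\<^sub>R \<xi>) * cis (x \<bullet> \<xi>)) \<partial>lborel)"
      by (simp only: decomp sum_distrib_right mult.assoc)
    also have "\<dots> = K * (\<Sum>i\<in>?I. of_real (p i ^ CARD('n)) * T i (p i *\<^sub>R x))"
      unfolding integral_mult_right_zero
      by (subst Bochner_Integration.integral_sum) (simp_all only: T_scaled)
    finally show ?thesis using K0 by simp
  qed
  show ?thesis
  proof (rule that[of "\<lambda>i. inv_fourier (m i)"])
    show "rapid_decay (inv_fourier (m i))" for i by (rule rapid_decay_inv_fourier[OF smm suppm])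
    show "inv_fourier (m i) \<in> borel_measurable borel" for i
      by (rule inv_fourier_measurable[OF borel_measurable_continuous_onI[OF contm]])
    fix x :: "real^'n" and u :: "int \<Rightarrow> real^'n"
    show "(\<lambda>a. \<Sum>i\<in>?I. of_real ((2 powr real_of_int i) ^ CARD('n)) *
        (inv_fourier (m i) ((2 powr real_of_int i) *\<^sub>R x - lpt a - u i) * \<phi> (lpt a + u i))) sums \<theta> x"
      unfolding main p_def[symmetric] by (intro sums_sum sums_mult samp)
  qed
qed

section \<open>The Schwartz space and the dual of its moment-free subspace\<close>

definition smooth :: "(real^'n::finite \<Rightarrow> complex) \<Rightarrow> bool" where
  "smooth f \<longleftrightarrow> (\<forall>is x. iterated_partial is f differentiable (at x))"

lemma schwartz_smooth: "f \<in> schwartz \<Longrightarrow> smooth f"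
  by (simp add: schwartz_def smooth_def)

lemma smoothD: "smooth f \<Longrightarrow> iterated_partial is f differentiable (at x)"
  by (simp add: smooth_def)

lemma schwartzI:
  assumes "smooth f" "\<And>N is. \<exists>C. \<forall>x. (1 + norm x) ^ N * norm (iterated_partial is f x) \<le> C"
  shows "f \<in> schwartz"
  using assms unfolding schwartz_def smooth_def by (auto simp: bdd_above_def)

lemma schwartz_seminorm_upper:
  assumes "f \<in> schwartz"
  shows "(1 + norm x) ^ N * norm (iterated_partial is f x) \<le> schwartz_seminorm N is f"
  unfolding schwartz_seminorm_def
  by (rule cSUP_upper) (use assms in \<open>auto simp: schwartz_def\<close>)

lemma schwartz_seminorm_least:
  assumes "\<And>x. (1 + norm x) ^ N * norm (iterated_partial is f x) \<le> C"
  shows "schwartz_seminorm N is f \<le> C"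
  unfolding schwartz_seminorm_def using assms by (intro cSUP_least) auto

lemma schwartz_seminorm_nonneg: "f \<in> schwartz \<Longrightarrow> 0 \<le> schwartz_seminorm N is f"
  by (rule order_trans[OF _ schwartz_seminorm_upper[of f 0]]) auto

lemma schwartz_rapid:
  assumes "f \<in> schwartz"
  shows "rapid f"
  unfolding rapid_def rapid_decay_def
proof (intro conjI allI)
  show "continuous_on UNIV f"
    using smoothD[OF schwartz_smooth[OF assms], of "[]"]
    by (auto simp: continuous_on_eq_continuous_at intro!: differentiable_imp_continuous_within)
  show "\<exists>C. \<forall>x. (1 + norm x) ^ N * norm (f x) \<le> C" for N
    using schwartz_seminorm_upper[OF assms, of _ N "[]"] by auto
qed

lemma has_derivative_partial:
  assumes "f differentiable (at x)"
  obtains f' where "(f has_derivative f') (at x)" "\<And>i. partial_derivative i f x = f' (axis i 1)"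
proof -
  have d: "(f has_derivative frechet_derivative f (at x)) (at x)"
    using assms by (simp add: frechet_derivative_works)
  then show ?thesis using that unfolding partial_derivative_def by blast
qed

lemma partial_derivative_eq: "(f has_derivative f') (at x) \<Longrightarrow> partial_derivative i f x = f' (axis i 1)"
  using frechet_derivative_at[of f f' x] by (simp add: partial_derivative_def)

lemma iterated_partial_affine:
  fixes f :: "real^'n::finite \<Rightarrow> complex"
  assumes f: "smooth f"
  shows "iterated_partial is (\<lambda>y. c * f (b + \<alpha> *\<^sub>R y)) = (\<lambda>y. c * of_real \<alpha> ^ length is * iterated_partial is f (b + \<alpha> *\<^sub>R y))"
    and "smooth (\<lambda>y. c * f (b + \<alpha> *\<^sub>R y))"
proof -
  have der: "((\<lambda>y. k * iterated_partial is f (b + \<alpha> *\<^sub>R y)) has_derivative (\<lambda>h. k * F (\<alpha> *\<^sub>R h))) (at y)"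
    if "(iterated_partial is f has_derivative F) (at (b + \<alpha> *\<^sub>R y))" for k F y "is"
    by (rule has_derivative_mult_right[OF has_derivative_compose[where f="\<lambda>y. b + \<alpha> *\<^sub>R y" and f'="\<lambda>h. \<alpha> *\<^sub>R h", OF _ that]])
       (auto intro!: derivative_eq_intros)
  show eq: "iterated_partial is (\<lambda>y. c * f (b + \<alpha> *\<^sub>R y)) = (\<lambda>y. c * of_real \<alpha> ^ length is * iterated_partial is f (b + \<alpha> *\<^sub>R y))" for "is"
  proof (induction "is")
    case (Cons i "is")
    show ?case
    proof
      fix y
      obtain F where F: "(iterated_partial is f has_derivative F) (at (b + \<alpha> *\<^sub>R y))"
          "partial_derivative i (iterated_partial is f) (b + \<alpha> *\<^sub>R y) = F (axis i 1)"
        using has_derivative_partial[OF smoothD[OF f]] by metis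
      have "F (\<alpha> *\<^sub>R axis i 1) = \<alpha> *\<^sub>R F (axis i 1)"
        using F(1) by (simp add: has_derivative_def bounded_linear.linear linear_scale)
      then have "F (\<alpha> *\<^sub>R axis i 1) = of_real \<alpha> * F (axis i 1)"
        unfolding scaleR_conv_of_real[where 'a=complex] .
      then show "iterated_partial (i # is) (\<lambda>y. c * f (b + \<alpha> *\<^sub>R y)) y
          = c * of_real \<alpha> ^ length (i # is) * iterated_partial (i # is) f (b + \<alpha> *\<^sub>R y)"
        by (simp add: Cons.IH partial_derivative_eq[OF der[OF F(1)]] F(2))
    qed
  qed simp
  show "smooth (\<lambda>y. c * f (b + \<alpha> *\<^sub>R y))"
    unfolding smooth_def eq
  proof (intro allI)
    fix "is" and y :: "real^'n"
    obtain F where "(iterated_partial is f has_derivative F) (at (b + \<alpha> *\<^sub>R y))"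
      using has_derivative_partial[OF smoothD[OF f]] by metis
    from der[OF this] show "(\<lambda>y. c * of_real \<alpha> ^ length is * iterated_partial is f (b + \<alpha> *\<^sub>R y)) differentiable at y"
      unfolding differentiable_def by blast
  qed
qed

text \<open>The point is the polynomial growth in \<open>b\<close>: seminorms of translates to far
  lattice points grow no faster than \<open>(1 + norm b) ^ N\<close>, which rapidly decaying
  coefficients can absorb.\<close>

lemma affine_schwartz_bound:
  fixes f :: "real^'n::finite \<Rightarrow> complex"
  assumes f: "f \<in> schwartz" and \<alpha>: "\<alpha> \<noteq> 0"
  shows "(1 + norm x) ^ N * norm (iterated_partial is (\<lambda>y. c * f (b + \<alpha> *\<^sub>R y)) x)
    \<le> norm c * \<bar>\<alpha>\<bar> ^ length is * (1 + 1 / \<bar>\<alpha>\<bar>) ^ N * schwartz_seminorm N is f * (1 + norm b) ^ N"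
proof -
  let ?z = "b + \<alpha> *\<^sub>R x"
  have "(1 + norm x) ^ N * norm (iterated_partial is (\<lambda>y. c * f (b + \<alpha> *\<^sub>R y)) x)
    = norm c * \<bar>\<alpha>\<bar> ^ length is * ((1 + norm x) ^ N * norm (iterated_partial is f ?z))"
    unfolding iterated_partial_affine(1)[OF schwartz_smooth[OF f]] by (simp add: norm_mult norm_power)
  also have "\<dots> \<le> norm c * \<bar>\<alpha>\<bar> ^ length is * (((1 + norm b) * (1 + 1 / \<bar>\<alpha>\<bar>) * (1 + norm ?z)) ^ N * norm (iterated_partial is f ?z))"
    using norm_affine_le[OF \<alpha>, of x b] by (intro mult_left_mono mult_right_mono power_mono) auto
  also have "\<dots> = norm c * \<bar>\<alpha>\<bar> ^ length is * ((1 + norm b) ^ N * (1 + 1 / \<bar>\<alpha>\<bar>) ^ N * ((1 + norm ?z) ^ N * norm (iterated_partial is f ?z)))"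
    by (simp add: power_mult_distrib mult.assoc)
  also have "\<dots> \<le> norm c * \<bar>\<alpha>\<bar> ^ length is * ((1 + norm b) ^ N * (1 + 1 / \<bar>\<alpha>\<bar>) ^ N * schwartz_seminorm N is f)"
    by (intro mult_left_mono schwartz_seminorm_upper f) auto
  finally show ?thesis by (simp add: mult_ac)
qed

lemma affine_schwartz:
  fixes f :: "real^'n::finite \<Rightarrow> complex"
  assumes f: "f \<in> schwartz" and \<alpha>: "\<alpha> \<noteq> 0"
  shows "(\<lambda>y. c * f (b + \<alpha> *\<^sub>R y)) \<in> schwartz"
  using affine_schwartz_bound[OF assms] iterated_partial_affine(2)[OF schwartz_smooth[OF f]]
  by (intro schwartzI) blast+

lemma iterated_partial_lincomb:
  fixes f g :: "real^'n::finite \<Rightarrow> complex"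
  assumes f: "smooth f" and g: "smooth g"
  shows "iterated_partial is (\<lambda>y. c * f y + d * g y) = (\<lambda>y. c * iterated_partial is f y + d * iterated_partial is g y)"
    and "smooth (\<lambda>y. c * f y + d * g y)"
proof -
  have der: "((\<lambda>y. c * iterated_partial is f y + d * iterated_partial is g y) has_derivative (\<lambda>h. c * F h + d * G h)) (at y)"
    if "(iterated_partial is f has_derivative F) (at y)" "(iterated_partial is g has_derivative G) (at y)" for F G y "is"
    by (intro has_derivative_add has_derivative_mult_right that)
  show eq: "iterated_partial is (\<lambda>y. c * f y + d * g y) = (\<lambda>y. c * iterated_partial is f y + d * iterated_partial is g y)" for "is"
  proof (induction "is")
    case (Cons i "is")
    show ?case
    proof
      fix y
      obtain F where F: "(iterated_partial is f has_derivative F) (at y)"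
          "partial_derivative i (iterated_partial is f) y = F (axis i 1)"
        using has_derivative_partial[OF smoothD[OF f]] by metis
      obtain G where G: "(iterated_partial is g has_derivative G) (at y)"
          "partial_derivative i (iterated_partial is g) y = G (axis i 1)"
        using has_derivative_partial[OF smoothD[OF g]] by metis
      show "iterated_partial (i # is) (\<lambda>y. c * f y + d * g y) y
          = c * iterated_partial (i # is) f y + d * iterated_partial (i # is) g y"
        by (simp add: Cons.IH partial_derivative_eq[OF der[OF F(1) G(1)]] F(2) G(2))
    qed
  qed simp
  show "smooth (\<lambda>y. c * f y + d * g y)"
    unfolding smooth_def eq
  proof (intro allI)
    fix "is" and y :: "real^'n"
    obtain F where F: "(iterated_partial is f has_derivative F) (at y)"
      using has_derivative_partial[OF smoothD[OF f]] by metis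
    obtain G where "(iterated_partial is g has_derivative G) (at y)"
      using has_derivative_partial[OF smoothD[OF g]] by metis
    from der[OF F this] show "(\<lambda>y. c * iterated_partial is f y + d * iterated_partial is g y) differentiable at y"
      unfolding differentiable_def by blast
  qed
qed

lemma lincomb_schwartz_bound:
  assumes f: "f \<in> schwartz" and g: "g \<in> schwartz"
  shows "(1 + norm x) ^ N * norm (iterated_partial is (\<lambda>y. c * f y + d * g y) x)
    \<le> norm c * schwartz_seminorm N is f + norm d * schwartz_seminorm N is g"
proof -
  have "(1 + norm x) ^ N * norm (iterated_partial is (\<lambda>y. c * f y + d * g y) x)
      \<le> (1 + norm x) ^ N * (norm c * norm (iterated_partial is f x) + norm d * norm (iterated_partial is g x))"
    unfolding iterated_partial_lincomb(1)[OF schwartz_smooth[OF f] schwartz_smooth[OF g]]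
    by (intro mult_left_mono order_trans[OF norm_triangle_ineq]) (auto simp: norm_mult)
  also have "\<dots> = norm c * ((1 + norm x) ^ N * norm (iterated_partial is f x)) + norm d * ((1 + norm x) ^ N * norm (iterated_partial is g x))"
    by (simp add: algebra_simps)
  also have "\<dots> \<le> norm c * schwartz_seminorm N is f + norm d * schwartz_seminorm N is g"
    by (intro add_mono mult_left_mono schwartz_seminorm_upper f g) auto
  finally show ?thesis .
qed

lemma lincomb_schwartz:
  assumes f: "f \<in> schwartz" and g: "g \<in> schwartz"
  shows "(\<lambda>y. c * f y + d * g y) \<in> schwartz"
  using lincomb_schwartz_bound[OF assms] iterated_partial_lincomb(2)[OF schwartz_smooth[OF f] schwartz_smooth[OF g]]
  by (intro schwartzI) blast+

lemma schwartz_diff: "f \<in> schwartz \<Longrightarrow> g \<in> schwartz \<Longrightarrow> (\<lambda>y. f y - g y) \<in> schwartz"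
  using lincomb_schwartz[of f g 1 "-1"] by simp

section \<open>Convergence in the Schwartz topology\<close>

lemma schwartz_seminorm_diff_triangle:
  assumes "f \<in> schwartz" "g \<in> schwartz" "h \<in> schwartz"
  shows "schwartz_seminorm N is (\<lambda>x. f x - h x)
    \<le> schwartz_seminorm N is (\<lambda>x. f x - g x) + schwartz_seminorm N is (\<lambda>x. g x - h x)"
  using lincomb_schwartz_bound[OF schwartz_diff[OF assms(1,2)] schwartz_diff[OF assms(2,3)], where c=1 and d=1]
  by (intro schwartz_seminorm_least) simp

text \<open>The seminorm balls, with arbitrary centres, form only a subbase, so neighbourhoods are
  treated by induction on how they are generated. For a single ball the triangle inequality makes up
  for its centre not being \<open>g\<close>.\<close>

lemma limitin_schwartz_topology:
  assumes f: "\<And>n::nat. f n \<in> schwartz" and g: "g \<in> schwartz"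
    and lim: "\<And>N is. (\<lambda>n. schwartz_seminorm N is (\<lambda>x. f n x - g x)) \<longlonglongrightarrow> 0"
  shows "limitin schwartz_topology f g sequentially"
  unfolding limitin_def
proof (intro conjI allI impI)
  show "g \<in> topspace schwartz_topology" using g by (simp add: topspace_schwartz_topology)
  fix U assume "openin schwartz_topology U \<and> g \<in> U"
  then have "generate_topology_on {{g \<in> schwartz. schwartz_seminorm N is (\<lambda>x. g x - f x) < e} | f N is e. f \<in> schwartz} U" "g \<in> U"
    by (auto simp: schwartz_topology_def openin_topology_generated_by_iff)
  then show "\<forall>\<^sub>F n in sequentially. f n \<in> U"
  proof (induction rule: generate_topology_on.induct)
    case (Int a b)
    then show ?case by (auto intro: eventually_conj)
  next
    case (UN K)
    then obtain k where k: "k \<in> K" "g \<in> k" by blast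
    then have "\<forall>\<^sub>F n in sequentially. f n \<in> k" using UN.IH by blast
    then show ?case by eventually_elim (use k in blast)
  next
    case (Basis s)
    then obtain h N "is" e where h: "h \<in> schwartz" and s: "s = {g \<in> schwartz. schwartz_seminorm N is (\<lambda>x. g x - h x) < e}"
      by auto
    have "schwartz_seminorm N is (\<lambda>x. g x - h x) < e" using Basis s by auto
    then have "\<forall>\<^sub>F n in sequentially. schwartz_seminorm N is (\<lambda>x. f n x - g x) < e - schwartz_seminorm N is (\<lambda>x. g x - h x)"
      by (intro order_tendstoD(2)[OF lim]) simp
    then show ?case
    proof eventually_elim
      case (elim n)
      then show ?case using schwartz_seminorm_diff_triangle[OF f[of n] g h, of N "is"] f[of n] s by auto
    qed
  qed auto
qed

section \<open>Moments of functions whose transform vanishes near the origin\<close>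

lemma monomial_bound: "\<bar>monomial \<gamma> x\<bar> \<le> (1 + norm x) ^ (\<Sum>i\<in>UNIV. \<gamma> i)"
proof -
  have "\<bar>monomial \<gamma> x\<bar> = (\<Prod>i\<in>UNIV. \<bar>x $ i\<bar> ^ \<gamma> i)"
    by (simp add: monomial_def abs_prod power_abs)
  also have "\<dots> \<le> (\<Prod>i\<in>UNIV. (1 + norm x) ^ \<gamma> i)"
    by (intro prod_mono conjI power_mono) (auto intro: order_trans[OF component_le_norm_cart])
  finally show ?thesis by (simp add: power_sum)
qed

lemma continuous_on_monomial: "continuous_on UNIV (monomial \<gamma>)"
  unfolding monomial_def by (intro continuous_intros)

lemma rapid_mult_monomial:
  assumes h: "rapid h"
  shows "rapid (\<lambda>x. h x * of_real (monomial \<gamma> x))"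
  unfolding rapid_def rapid_decay_def
proof (intro conjI allI)
  show "continuous_on UNIV (\<lambda>x. h x * of_real (monomial \<gamma> x))"
    by (intro continuous_intros rapid_continuous[OF h] continuous_on_monomial)
  fix N
  define K where "K = (\<Sum>i\<in>UNIV. \<gamma> i)"
  obtain C where C: "\<And>x. (1 + norm x) ^ (N + K) * norm (h x) \<le> C"
    using h unfolding rapid_def rapid_decay_def by blast
  have "(1 + norm x) ^ N * norm (h x * of_real (monomial \<gamma> x)) \<le> C" for x
  proof -
    have "(1 + norm x) ^ N * norm (h x * of_real (monomial \<gamma> x)) = \<bar>monomial \<gamma> x\<bar> * ((1 + norm x) ^ N * norm (h x))"
      by (simp add: norm_mult)
    also have "\<dots> \<le> (1 + norm x) ^ K * ((1 + norm x) ^ N * norm (h x))"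
      unfolding K_def by (intro mult_right_mono monomial_bound) auto
    also have "\<dots> \<le> C" using C[of x] by (simp add: power_add mult_ac)
    finally show ?thesis .
  qed
  then show "\<exists>C. \<forall>x. (1 + norm x) ^ N * norm (h x * of_real (monomial \<gamma> x)) \<le> C" by blast
qed

lemma moments_zero:
  assumes h: "rapid h" and S: "open S" "0 \<in> S" and z: "\<And>\<xi>. \<xi> \<in> S \<Longrightarrow> fourier h \<xi> = 0"
  shows "(\<integral>x. h x * of_real (monomial \<gamma> x) \<partial>lborel) = 0"
proof -
  \<comment> \<open>The claim on all of \<open>S\<close>, not only at the origin, is what can be
    differentiated once more when the degree of the monomial increases.\<close>
  have "\<forall>\<xi>\<in>S. fourier (\<lambda>x. h x * of_real (monomial \<gamma> x)) \<xi> = 0"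
  proof (induction "\<Sum>i\<in>UNIV. \<gamma> i" arbitrary: \<gamma>)
    case 0
    then have "monomial \<gamma> x = 1" for x by (simp add: monomial_def)
    then show ?case using z by simp
  next
    case (Suc n)
    then obtain i where i: "\<gamma> i > 0" by (metis neq0_conv sum.neutral nat.simps(3))
    define \<gamma>' where "\<gamma>' = \<gamma>(i := \<gamma> i - 1)"
    have "(\<Sum>j\<in>UNIV. \<gamma> j) = \<gamma> i + (\<Sum>j\<in>UNIV - {i}. \<gamma> j)" by (rule sum.remove) auto
    moreover have "(\<Sum>j\<in>UNIV. \<gamma>' j) = \<gamma>' i + (\<Sum>j\<in>UNIV - {i}. \<gamma>' j)" by (rule sum.remove) auto
    moreover have "(\<Sum>j\<in>UNIV - {i}. \<gamma>' j) = (\<Sum>j\<in>UNIV - {i}. \<gamma> j)"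
      by (intro sum.cong) (auto simp: \<gamma>'_def)
    ultimately have n: "n = (\<Sum>j\<in>UNIV. \<gamma>' j)" using i Suc.hyps(2) by (simp add: \<gamma>'_def)
    have mono: "monomial \<gamma> x = x $ i * monomial \<gamma>' x" for x
    proof -
      have "monomial \<gamma> x = (x $ i) ^ \<gamma> i * (\<Prod>j\<in>UNIV - {i}. (x $ j) ^ \<gamma> j)"
        unfolding monomial_def by (rule prod.remove) auto
      moreover have "monomial \<gamma>' x = (x $ i) ^ \<gamma>' i * (\<Prod>j\<in>UNIV - {i}. (x $ j) ^ \<gamma>' j)"
        unfolding monomial_def by (rule prod.remove) auto
      moreover have "(\<Prod>j\<in>UNIV - {i}. (x $ j) ^ \<gamma>' j) = (\<Prod>j\<in>UNIV - {i}. (x $ j) ^ \<gamma> j)"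
        by (intro prod.cong) (auto simp: \<gamma>'_def)
      moreover have "(x $ i) ^ \<gamma> i = x $ i * (x $ i) ^ \<gamma>' i"
        using i by (cases "\<gamma> i") (auto simp: \<gamma>'_def)
      ultimately show ?thesis by simp
    qed
    show ?case
    proof
      fix \<xi> assume "\<xi> \<in> S"
      from fourier_zero_moment_step[OF rapid_mult_monomial[OF h] S(1) _ this, of \<gamma>' i] Suc.hyps(1)[OF n]
      show "fourier (\<lambda>x. h x * of_real (monomial \<gamma> x)) \<xi> = 0" by (simp add: mono mult_ac)
    qed
  qed
  from this[rule_format, OF S(2)] show ?thesis by (simp add: fourier_def)
qed

lemma schwartz_infI:
  assumes "h \<in> schwartz" "open S" "0 \<in> S" "\<And>\<xi>. \<xi> \<in> S \<Longrightarrow> fourier h \<xi> = 0"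
  shows "h \<in> schwartz_inf"
  using moments_zero[OF schwartz_rapid[OF assms(1)] assms(2-4)] assms(1) by (simp add: schwartz_inf_def)

section \<open>Functionals on moment-free Schwartz functions: finite sums and series\<close>

lemma schwartz_inf_schwartz: "f \<in> schwartz_inf \<Longrightarrow> f \<in> schwartz"
  by (simp add: schwartz_inf_def)

lemma lincomb_schwartz_inf:
  assumes f: "f \<in> schwartz_inf" and g: "g \<in> schwartz_inf"
  shows "(\<lambda>y. c * f y + d * g y) \<in> schwartz_inf"
  unfolding schwartz_inf_def
proof (intro CollectI conjI allI)
  note fs = schwartz_inf_schwartz[OF f] schwartz_inf_schwartz[OF g]
  show "(\<lambda>y. c * f y + d * g y) \<in> schwartz" by (rule lincomb_schwartz[OF fs])
  fix \<gamma>
  note i = fs[THEN schwartz_rapid, THEN rapid_mult_monomial, THEN rapid_integrable, of \<gamma>]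
  have "(LINT x|lborel. (c * f x + d * g x) * of_real (monomial \<gamma> x))
     = (LINT x|lborel. c * (f x * of_real (monomial \<gamma> x)) + d * (g x * of_real (monomial \<gamma> x)))"
    by (simp add: algebra_simps)
  also have "\<dots> = c * (LINT x|lborel. f x * of_real (monomial \<gamma> x)) + d * (LINT x|lborel. g x * of_real (monomial \<gamma> x))"
    using i by (simp only: Bochner_Integration.integral_add integrable_mult_right integral_mult_right_zero)
  also have "\<dots> = 0" using f g by (simp add: schwartz_inf_def)
  finally show "(LINT x|lborel. (c * f x + d * g x) * of_real (monomial \<gamma> x)) = 0" .
qed

lemma schwartz_inf_zero:
  fixes f :: "real^'n::finite \<Rightarrow> complex"
  assumes "f \<in> schwartz_inf"
  shows "(\<lambda>y::real^'n. 0) \<in> schwartz_inf"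
  using lincomb_schwartz_inf[OF assms assms, of 0 0] by simp

lemma dual_lincomb:
  assumes u: "u \<in> schwartz_inf_dual" and f: "f \<in> schwartz_inf" and g: "g \<in> schwartz_inf"
  shows "u (\<lambda>y. c * f y + d * g y) = c * u f + d * u g"
proof -
  have "(\<lambda>y. c * f y) \<in> schwartz_inf" "(\<lambda>y. d * g y) \<in> schwartz_inf"
    using lincomb_schwartz_inf[OF f g, of c 0] lincomb_schwartz_inf[OF f g, of 0 d] by simp_all
  then show ?thesis using u f g by (simp add: schwartz_inf_dual_def)
qed

text \<open>Membership and value are proved together because the step for the value needs membership
  of the partial sum. The function \<open>g0\<close> supplies the zero function for the empty sum,
  as a multiple of itself.\<close>

lemma dual_sum:
  fixes g0 :: "real^'n::finite \<Rightarrow> complex" and h :: "'i \<Rightarrow> real^'n \<Rightarrow> complex"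
  assumes u: "u \<in> schwartz_inf_dual" and g: "g0 \<in> schwartz_inf" and h: "\<And>i. i \<in> I \<Longrightarrow> h i \<in> schwartz_inf" and I: "finite I"
  shows "(\<lambda>y. \<Sum>i\<in>I. c i * h i y) \<in> schwartz_inf \<and> u (\<lambda>y. \<Sum>i\<in>I. c i * h i y) = (\<Sum>i\<in>I. c i * u (h i))"
  using I h
proof (induction I rule: finite_induct)
  case empty
  then show ?case using dual_lincomb[OF u g g, of 0 0] schwartz_inf_zero[OF g] by simp
next
  case (insert i I)
  then have IH: "(\<lambda>y. \<Sum>i\<in>I. c i * h i y) \<in> schwartz_inf" "u (\<lambda>y. \<Sum>i\<in>I. c i * h i y) = (\<Sum>i\<in>I. c i * u (h i))"
    and hi: "h i \<in> schwartz_inf" by auto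
  show ?case
    using lincomb_schwartz_inf[OF hi IH(1), of "c i" 1] dual_lincomb[OF u hi IH(1), of "c i" 1] IH(2) insert
    by simp
qed

text \<open>On a coordinate line this is termwise differentiation of a series in one variable, with
  uniform convergence from the bounds for the next order. Smoothness of \<open>g\<close> identifies
  the derivative along the line with its partial derivative.\<close>

lemma iterated_partial_sums:
  fixes h :: "nat \<Rightarrow> real^'n::finite \<Rightarrow> complex"
  assumes h: "\<And>a. smooth (h a)" and g: "smooth g" and sums: "\<And>y. (\<lambda>a. h a y) sums g y"
    and bd: "\<And>is a y. norm (iterated_partial is (h a) y) \<le> B is a" and B: "\<And>is. summable (B is)"
  shows "(\<lambda>a. iterated_partial is (h a) y) sums iterated_partial is g y"
proof (induction "is" arbitrary: y)
  case Nil
  then show ?case using sums by simp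
next
  case (Cons i "is")
  have line: "((\<lambda>t. iterated_partial is f (y + t *\<^sub>R axis i 1)) has_derivative
      (\<lambda>\<tau>. \<tau> *\<^sub>R iterated_partial (i # is) f (y + t *\<^sub>R axis i 1))) (at t)" if f: "smooth f" for f y t
  proof -
    obtain F where F: "(iterated_partial is f has_derivative F) (at (y + t *\<^sub>R axis i 1))"
        "partial_derivative i (iterated_partial is f) (y + t *\<^sub>R axis i 1) = F (axis i 1)"
      using has_derivative_partial[OF smoothD[OF f]] by metis
    have "((\<lambda>t. iterated_partial is f (y + t *\<^sub>R axis i 1)) has_derivative (\<lambda>\<tau>. F (\<tau> *\<^sub>R axis i 1))) (at t)"
      by (rule has_derivative_compose[where f="\<lambda>t. y + t *\<^sub>R axis i 1" and f'="\<lambda>\<tau>. \<tau> *\<^sub>R axis i 1", OF _ F(1)]) (auto intro!: derivative_eq_intros)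
    moreover have "F (\<tau> *\<^sub>R axis i 1) = \<tau> *\<^sub>R F (axis i 1)" for \<tau>
      using F(1) by (simp add: has_derivative_def bounded_linear.linear linear_scale)
    ultimately show ?thesis using F(2) by simp
  qed
  define D where "D a t = iterated_partial (i # is) (h a) (y + t *\<^sub>R axis i 1)" for a t
  define S where "S t = (\<Sum>a. D a t)" for t
  have "uniform_limit UNIV (\<lambda>n t. \<Sum>a<n. D a t) S sequentially"
    unfolding S_def by (rule Weierstrass_m_test[of _ _ "B (i # is)"]) (auto simp: D_def bd B simp del: iterated_partial.simps)
  then have unif: "\<forall>\<^sub>F n in sequentially. \<forall>t\<in>UNIV. dist (\<Sum>a<n. D a t) (S t) < e" if "e > 0" for e
    using that by (simp add: uniform_limit_iff)
  have "\<exists>G. \<forall>t\<in>UNIV. (\<lambda>a. iterated_partial is (h a) (y + t *\<^sub>R axis i 1)) sums G t \<and> (G has_derivative (\<lambda>\<tau>. \<tau> *\<^sub>R S t)) (at t within UNIV)"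
  proof (rule has_derivative_series[OF convex_UNIV])
    show "((\<lambda>t. iterated_partial is (h a) (y + t *\<^sub>R axis i 1)) has_derivative (\<lambda>\<tau>. \<tau> *\<^sub>R D a t)) (at t within UNIV)" for a t
      unfolding D_def using line[OF h] by simp
    show "(\<lambda>a. iterated_partial is (h a) (y + 0 *\<^sub>R axis i 1)) sums iterated_partial is g (y + 0 *\<^sub>R axis i 1)"
      by (rule Cons.IH)
    fix e :: real assume "e > 0"
    from unif[OF this]
    show "\<forall>\<^sub>F n in sequentially. \<forall>t\<in>UNIV. \<forall>\<tau>. norm ((\<Sum>a<n. \<tau> *\<^sub>R D a t) - \<tau> *\<^sub>R S t) \<le> e * norm \<tau>"
    proof eventually_elim
      case (elim n)
      show ?case
      proof (intro ballI allI)
        fix t \<tau>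
        have "norm ((\<Sum>a<n. D a t) - S t) \<le> e" using elim by (auto simp: dist_norm less_imp_le)
        moreover have "(\<Sum>a<n. \<tau> *\<^sub>R D a t) - \<tau> *\<^sub>R S t = \<tau> *\<^sub>R ((\<Sum>a<n. D a t) - S t)"
          by (simp add: scaleR_right_diff_distrib scaleR_sum_right)
        ultimately show "norm ((\<Sum>a<n. \<tau> *\<^sub>R D a t) - \<tau> *\<^sub>R S t) \<le> e * norm \<tau>"
          by (simp add: mult_right_mono mult.commute[of e] mult_left_mono)
      qed
    qed
  qed simp
  then obtain G where G: "\<And>t. (\<lambda>a. iterated_partial is (h a) (y + t *\<^sub>R axis i 1)) sums G t"
      "\<And>t. (G has_derivative (\<lambda>\<tau>. \<tau> *\<^sub>R S t)) (at t)"
    by auto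
  have "G t = iterated_partial is g (y + t *\<^sub>R axis i 1)" for t
    using G(1) Cons.IH sums_unique2 by blast
  then have "G = (\<lambda>t. iterated_partial is g (y + t *\<^sub>R axis i 1))" by blast
  then have "(\<lambda>\<tau>. \<tau> *\<^sub>R S 0) = (\<lambda>\<tau>. \<tau> *\<^sub>R iterated_partial (i # is) g (y + 0 *\<^sub>R axis i 1))"
    using G(2)[of 0] line[OF g, of y 0] has_derivative_unique by blast
  from fun_cong[OF this, of 1] have S0: "S 0 = iterated_partial (i # is) g y" by simp
  have "summable (\<lambda>a. D a 0)"
    by (rule summable_comparison_test'[OF B[of "i # is"], of 0]) (use bd in \<open>simp add: D_def del: iterated_partial.simps\<close>)
  then have "(\<lambda>a. D a 0) sums S 0" unfolding S_def by (rule summable_sums)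
  then show ?case unfolding S0 by (simp add: D_def)
qed

text \<open>In each seminorm the remainder of the series is at most a tail of the summable series of
  seminorms. The partial sums therefore converge in the Schwartz topology, and continuity of
  \<open>u\<close> finishes.\<close>

lemma dual_series:
  assumes u: "u \<in> schwartz_inf_dual" and h: "\<And>a. h a \<in> schwartz_inf" and g: "g \<in> schwartz_inf"
    and sums: "\<And>y. (\<lambda>a. h a y) sums g y" and summ: "\<And>N is. summable (\<lambda>a. schwartz_seminorm N is (h a))"
  shows "(\<lambda>a. u (h a)) sums u g"
proof -
  note hs = schwartz_inf_schwartz[OF h] and gs = schwartz_inf_schwartz[OF g]
  have part: "(\<lambda>a. iterated_partial is (h a) y) sums iterated_partial is g y" for "is" y
    by (rule iterated_partial_sums[OF schwartz_smooth[OF hs] schwartz_smooth[OF gs] sums _ summ[of 0]])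
       (use schwartz_seminorm_upper[OF hs, of _ 0] in simp)
  define P where "P n y = (\<Sum>a<n. 1 * h a y)" for n y
  have P: "P n \<in> schwartz_inf" "u (P n) = (\<Sum>a<n. u (h a))" for n
    using dual_sum[OF u g, of "{..<n}" h "\<lambda>_. 1"] h by (simp_all add: P_def[abs_def])
  have itP: "iterated_partial is (P n) y = (\<Sum>a<n. iterated_partial is (h a) y)" for "is" n y
  proof (induction n arbitrary: y)
    case 0
    have "iterated_partial is (\<lambda>y. 0) y = (0::complex)"
      using iterated_partial_lincomb(1)[OF schwartz_smooth[OF gs] schwartz_smooth[OF gs], of "is" 0 0] by simp
    then show ?case by (simp add: P_def[abs_def])
  next
    case (Suc n)
    have "P (Suc n) = (\<lambda>y. 1 * P n y + 1 * h n y)" by (simp add: P_def fun_eq_iff)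
    then show ?case
      using Suc iterated_partial_lincomb(1)[OF schwartz_smooth[OF schwartz_inf_schwartz[OF P(1)[of n]]] schwartz_smooth[OF hs[of n]], of "is" 1 1]
      by simp
  qed
  have lim: "(\<lambda>n. schwartz_seminorm N is (\<lambda>x. P n x - g x)) \<longlonglongrightarrow> 0" for N "is"
  proof (rule tendsto_sandwich[OF _ _ tendsto_const])
    let ?s = "\<lambda>a. schwartz_seminorm N is (h a)"
    have ps: "P n \<in> schwartz" for n by (rule schwartz_inf_schwartz[OF P(1)])
    show "\<forall>\<^sub>F n in sequentially. 0 \<le> schwartz_seminorm N is (\<lambda>x. P n x - g x)"
      by (intro always_eventually allI schwartz_seminorm_nonneg schwartz_diff ps gs)
    show "\<forall>\<^sub>F n in sequentially. schwartz_seminorm N is (\<lambda>x. P n x - g x) \<le> (\<Sum>a. ?s (a + n))"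
    proof (intro always_eventually allI schwartz_seminorm_least)
      fix n x
      have d: "iterated_partial is (\<lambda>x. P n x - g x) x = iterated_partial is (P n) x - iterated_partial is g x"
        using iterated_partial_lincomb(1)[OF schwartz_smooth[OF ps[of n]] schwartz_smooth[OF gs], of "is" 1 "-1"] by simp
      have tail: "(\<lambda>a. iterated_partial is (h (a + n)) x) sums (iterated_partial is g x - (\<Sum>a<n. iterated_partial is (h a) x))"
        by (rule sums_split_initial_segment[OF part])
      have le: "(1 + norm x) ^ N * norm (iterated_partial is (h (a + n)) x) \<le> ?s (a + n)" for a
        by (rule schwartz_seminorm_upper[OF hs])
      have s': "(\<lambda>a. of_real ((1 + norm x) ^ N) * iterated_partial is (h (a + n)) x) sums
          (of_real ((1 + norm x) ^ N) * (iterated_partial is g x - (\<Sum>a<n. iterated_partial is (h a) x)))"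
        by (rule sums_mult[OF tail])
      have nn: "norm (of_real ((1 + norm x) ^ N) * z) = (1 + norm x) ^ N * norm z" for z :: complex
        by (simp add: norm_mult norm_power del: of_real_power of_real_add)
      have "(1 + norm x) ^ N * norm (iterated_partial is (\<lambda>x. P n x - g x) x)
          = norm (of_real ((1 + norm x) ^ N) * (iterated_partial is g x - (\<Sum>a<n. iterated_partial is (h a) x)))"
        unfolding nn d itP by (simp add: norm_minus_commute)
      also have "\<dots> = norm (\<Sum>a. of_real ((1 + norm x) ^ N) * iterated_partial is (h (a + n)) x)"
        using s' by (simp add: sums_iff)
      also have "\<dots> \<le> (\<Sum>a. ?s (a + n))"
        using le unfolding nn[symmetric] by (rule norm_suminf_le) (rule summable_ignore_initial_segment[OF summ])
      finally show "(1 + norm x) ^ N * norm (iterated_partial is (\<lambda>x. P n x - g x) x) \<le> (\<Sum>a. ?s (a + n))" .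
    qed
    show "(\<lambda>n. \<Sum>a. ?s (a + n)) \<longlonglongrightarrow> 0"
      by (rule suminf_exist_split2[OF summ])
  qed
  have "limitin schwartz_topology P g sequentially"
    by (rule limitin_schwartz_topology[OF schwartz_inf_schwartz[OF P(1)] gs lim])
  then have "limitin (subtopology schwartz_topology schwartz_inf) P g sequentially"
    using g P(1) by (simp add: limitin_subtopology)
  moreover have "continuous_map (subtopology schwartz_topology schwartz_inf) euclidean u"
    using u by (simp add: schwartz_inf_dual_def)
  ultimately have "limitin euclidean (u \<circ> P) (u g) sequentially"
    by (rule continuous_map_limit[rotated])
  then show ?thesis by (simp add: sums_def comp_def P)
qed

section \<open>The sampling formula for distributions\<close>

text \<open>The spectral condition without the lower bound: in the sampling formula only the
  function that is sampled must have a nonvanishing transform on the middle annulus, not the one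
  being reconstructed.\<close>

definition band_limited :: "(real^'n::finite \<Rightarrow> complex) \<Rightarrow> bool" where
  "band_limited \<phi> \<longleftrightarrow> \<phi> \<in> schwartz \<and> (\<forall>\<xi>. fourier \<phi> \<xi> \<noteq> 0 \<longrightarrow> 1/2 \<le> norm \<xi> \<and> norm \<xi> \<le> 2)"

lemma admissible_band_limited: "admissible \<phi> \<Longrightarrow> band_limited \<phi>"
  using closure_subset[of "{\<xi>. fourier \<phi> \<xi> \<noteq> 0}"] unfolding admissible_def band_limited_def by blast

lemma admissible_lower:
  assumes "admissible \<phi>" "3/5 \<le> norm \<xi>" "norm \<xi> \<le> 5/3"
  shows "fourier \<phi> \<xi> \<noteq> 0"
proof -
  obtain C where "C > 0" "norm (fourier \<phi> \<xi>) \<ge> C" using assms unfolding admissible_def by blast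
  then show ?thesis by auto
qed

lemma fourier_affine:
  fixes \<phi> :: "real^'n::finite \<Rightarrow> complex"
  assumes \<phi>: "rapid \<phi>" and \<alpha>: "\<alpha> \<noteq> 0"
  shows "fourier (\<lambda>y. \<phi> (b + \<alpha> *\<^sub>R y)) \<xi> = of_real ((1 / \<bar>\<alpha>\<bar>) ^ CARD('n)) * (cis ((1 / \<alpha>) * (b \<bullet> \<xi>)) * fourier \<phi> ((1 / \<alpha>) *\<^sub>R \<xi>))"
proof -
  let ?g = "\<lambda>z. \<phi> z * cis (- (z \<bullet> ((1 / \<alpha>) *\<^sub>R \<xi>)))"
  have eq: "\<phi> (b + \<alpha> *\<^sub>R y) * cis (- (y \<bullet> \<xi>)) = cis ((1 / \<alpha>) * (b \<bullet> \<xi>)) * ?g (b + \<alpha> *\<^sub>R y)" for y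
    using \<alpha> by (simp add: cis_mult inner_add_left mult.left_commute[of "cis _"] distrib_left)
  have int: "integrable lborel ?g" by (rule rapid_integrable[OF rapid_mult_cis[OF \<phi>]])
  have "fourier \<phi> ((1 / \<alpha>) *\<^sub>R \<xi>) = \<bar>\<alpha>\<bar> ^ CARD('n) *\<^sub>R (\<integral>y. ?g (b + \<alpha> *\<^sub>R y) \<partial>lborel)"
    unfolding fourier_def using integral_affine[OF \<alpha> int, of b] by simp
  moreover have "fourier (\<lambda>y. \<phi> (b + \<alpha> *\<^sub>R y)) \<xi> = cis ((1 / \<alpha>) * (b \<bullet> \<xi>)) * (\<integral>y. ?g (b + \<alpha> *\<^sub>R y) \<partial>lborel)"
    unfolding fourier_def eq integral_mult_right_zero ..
  ultimately show ?thesis using \<alpha> by (simp add: scaleR_conv_of_real power_divide)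
qed

text \<open>An affine image still has a spectral gap around the origin, of radius half of
  \<open>\<bar>\<alpha>\<bar>\<close>, so all its moments vanish.\<close>

lemma band_limited_affine_schwartz_inf:
  fixes \<phi> :: "real^'n::finite \<Rightarrow> complex"
  assumes \<phi>: "band_limited \<phi>" and \<alpha>: "\<alpha> \<noteq> 0"
  shows "(\<lambda>y. c * \<phi> (b + \<alpha> *\<^sub>R y)) \<in> schwartz_inf"
proof (rule schwartz_infI[where S="ball 0 (\<bar>\<alpha>\<bar> / 2)"])
  have \<phi>s: "\<phi> \<in> schwartz" using \<phi> by (simp add: band_limited_def)
  show "(\<lambda>y. c * \<phi> (b + \<alpha> *\<^sub>R y)) \<in> schwartz" by (rule affine_schwartz[OF \<phi>s \<alpha>])
  fix \<xi> :: "real^'n" assume "\<xi> \<in> ball 0 (\<bar>\<alpha>\<bar> / 2)"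
  then have "norm ((1 / \<alpha>) *\<^sub>R \<xi>) < 1/2" using \<alpha> by (simp add: field_simps)
  then have "fourier \<phi> ((1 / \<alpha>) *\<^sub>R \<xi>) = 0" using \<phi> unfolding band_limited_def by fastforce
  then have "fourier (\<lambda>y. \<phi> (b + \<alpha> *\<^sub>R y)) \<xi> = 0"
    by (simp add: fourier_affine[OF schwartz_rapid[OF \<phi>s] \<alpha>])
  then show "fourier (\<lambda>y. c * \<phi> (b + \<alpha> *\<^sub>R y)) \<xi> = 0"
    by (simp add: fourier_def mult.assoc)
qed (use \<alpha> in auto)

lemma dilate_shift:
  "dilate \<phi> j (x - y) = of_real (2 powr (real_of_int j * real CARD('n))) *
     \<phi> ((2 powr real_of_int j) *\<^sub>R x + (- (2 powr real_of_int j)) *\<^sub>R (y :: real^'n::finite))"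
  by (simp add: dilate_def scaleR_right_diff_distrib)

lemma dilate_shift_schwartz_inf:
  assumes "band_limited \<phi>"
  shows "(\<lambda>y. dilate \<phi> j (x - y)) \<in> schwartz_inf"
  unfolding dilate_shift by (rule band_limited_affine_schwartz_inf[OF assms]) simp

lemma powr_int_add: "2 powr real_of_int (i + j) = 2 powr real_of_int i * (2 powr real_of_int j :: real)"
  by (simp add: powr_add)

lemma powr_int_uminus: "2 powr real_of_int (- i) = 1 / (2 powr real_of_int i :: real)"
  by (simp add: powr_minus_divide)

lemma rapid_decay_wt_powr:
  fixes M :: "real^'n::finite \<Rightarrow> complex"
  assumes "rapid_decay M" "e > 0"
  obtains C where "C > 0" "\<And>x. norm (M x) \<le> C * wt x powr e"
proof -
  define K where "K = nat \<lceil>e\<rceil>"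
  have K: "e \<le> real K" unfolding K_def by linarith
  obtain C where C: "C > 0" "\<And>x. norm (M x) \<le> C / (1 + norm x) ^ (2 * CARD('n) * K)"
    using rapid_decayD[OF assms(1)] by blast
  have "norm (M x) \<le> C * wt x powr e" for x
  proof -
    have "1 / (1 + norm x) ^ (2 * CARD('n) * K) = (1 / (1 + norm x) ^ (2 * CARD('n))) ^ K"
      by (simp add: power_mult power_one_over)
    also have "\<dots> \<le> wt x ^ K" by (intro power_mono wt_ge) auto
    also have "\<dots> = wt x powr real K" using wt_pos[of x] by (simp add: powr_realpow)
    also have "\<dots> \<le> wt x powr e" using wt_pos[of x] wt_le_1[of x] K by (intro powr_mono') auto
    finally have "C * (1 / (1 + norm x) ^ (2 * CARD('n) * K)) \<le> C * wt x powr e"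
      using C(1) by (intro mult_left_mono) auto
    then show ?thesis using C(2)[of x] by simp
  qed
  then show ?thesis using that C(1) by blast
qed

text \<open>The sample point is the difference of \<open>z\<close> and the argument of the kernel,
  so growth in the former is paid for by decay in the latter. Decay of order \<open>N\<close> is
  spent on this, and the remaining order, twice the dimension, gives the summable weight.\<close>

lemma summable_decay_growth:
  fixes M :: "real^'n::finite \<Rightarrow> complex"
  assumes "rapid_decay M"
  shows "summable (\<lambda>a. norm (M (z - lpt a - t)) * (1 + norm (lpt a + t)) ^ N)"
proof -
  obtain C where C: "C > 0" "\<And>x. norm (M x) \<le> C / (1 + norm x) ^ (N + 2 * CARD('n))"
    using rapid_decayD[OF assms] by blast
  show ?thesis
  proof (rule summable_comparison_test'[of "\<lambda>a. C * (1 + norm z) ^ N * wt ((z - t) - lpt a)" 0])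
    show "summable (\<lambda>a. C * (1 + norm z) ^ N * wt ((z - t) - lpt a))"
      by (intro summable_mult summable_wt_minus)
    fix a :: nat
    define v where "v = z - lpt a - t"
    have "norm (lpt a + t) \<le> norm z + norm v"
      using norm_triangle_ineq4[of z v] by (simp add: v_def algebra_simps)
    then have "1 + norm (lpt a + t) \<le> (1 + norm z) * (1 + norm v)"
    proof -
      assume *: "norm (lpt a + t) \<le> norm z + norm v"
      have "(1 + norm z) * (1 + norm v) = 1 + norm z + norm v + norm z * norm v" by (simp add: algebra_simps)
      moreover have "0 \<le> norm z * norm v" by simp
      ultimately show ?thesis using * by linarith
    qed
    then have "(1 + norm (lpt a + t)) ^ N \<le> ((1 + norm z) * (1 + norm v)) ^ N"
      by (intro power_mono) auto
    then have "norm (M v) * (1 + norm (lpt a + t)) ^ N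
        \<le> C / (1 + norm v) ^ (N + 2 * CARD('n)) * ((1 + norm z) * (1 + norm v)) ^ N"
      using C by (intro mult_mono) (auto intro!: divide_nonneg_nonneg less_imp_le)
    also have "\<dots> = C * (1 + norm z) ^ N * (1 / (1 + norm v) ^ (2 * CARD('n)))"
    proof -
      have "(1 + norm v) ^ N \<noteq> 0" using norm_ge_zero[of v] by (intro power_not_zero) linarith
      then show ?thesis by (simp add: power_add power_mult_distrib)
    qed
    also have "\<dots> \<le> C * (1 + norm z) ^ N * wt v"
      using C(1) by (intro mult_left_mono wt_ge) auto
    finally show "norm (norm (M (z - lpt a - t)) * (1 + norm (lpt a + t)) ^ N) \<le> C * (1 + norm z) ^ N * wt ((z - t) - lpt a)"
      by (simp add: v_def algebra_simps)
  qed
qed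

text \<open>The kernels depend only on the two test functions. Independence of \<open>j\<close>
  makes all constants uniform in scale, and independence of \<open>t\<close> permits averaging over
  shifts. The normalising powers of 2 are absorbed by \<open>dilate\<close>.\<close>

definition sampling_kernels where
  "sampling_kernels \<phi> \<theta> M \<longleftrightarrow> (\<forall>i. rapid_decay (M i) \<and> M i \<in> borel_measurable borel) \<and>
    (\<forall>u\<in>schwartz_inf_dual. \<forall>j x t.
      (\<lambda>a. \<Sum>i\<in>{-1,0,1::int}. M i ((2 powr real_of_int (j + i)) *\<^sub>R x - lpt a - t) *
         convolve (dilate \<phi> (j + i)) u ((2 powr real_of_int (- (j + i))) *\<^sub>R (lpt a + t)))
      sums convolve (dilate \<theta> j) u x)"

text \<open>The formula for functions is read as an expansion of
  \<open>\<lambda>y. dilate \<theta> j (x - y)\<close> into translates of dilates of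
  \<open>\<phi>\<close>; convergence in all seminorms then allows \<open>u\<close> to be applied
  termwise.\<close>

lemma sampling_kernels_exist:
  fixes \<phi> \<theta> :: "real^'n::finite \<Rightarrow> complex"
  assumes \<phi>: "band_limited \<phi>" and \<theta>: "band_limited \<theta>"
    and lower: "\<And>\<xi>. 3/5 \<le> norm \<xi> \<Longrightarrow> norm \<xi> \<le> 5/3 \<Longrightarrow> fourier \<phi> \<xi> \<noteq> 0"
  shows "\<exists>M. sampling_kernels \<phi> \<theta> M"
proof -
  let ?I = "{-1,0,1} :: int set"
  define p where "p i = 2 powr real_of_int i" for i :: int
  have p: "p i > 0" for i by (simp add: p_def)
  have p_add: "p (i + j) = p i * p j" for i j unfolding p_def by (rule powr_int_add)
  have p_minus: "p (- i) = 1 / p i" for i unfolding p_def by (rule powr_int_uminus)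
  have p_card: "2 powr (real_of_int j * real CARD('n)) = p j ^ CARD('n)" for j
    by (simp add: p_def powr_power mult.commute)
  have \<phi>s: "\<phi> \<in> schwartz" and \<theta>s: "\<theta> \<in> schwartz" using \<phi> \<theta> by (auto simp: band_limited_def)
  have supp: "1/2 \<le> norm \<xi> \<and> norm \<xi> \<le> 2" if "fourier \<phi> \<xi> \<noteq> 0 \<or> fourier \<theta> \<xi> \<noteq> 0" for \<xi>
    using that \<phi> \<theta> unfolding band_limited_def by blast
  obtain M where M: "\<And>i. rapid_decay (M i)" "\<And>i. M i \<in> borel_measurable borel"
    and samp: "\<And>x u. (\<lambda>a. \<Sum>i\<in>?I. of_real (p i ^ CARD('n)) *
        (M i (p i *\<^sub>R x - lpt a - u i) * \<phi> (lpt a + u i))) sums \<theta> x"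
    unfolding p_def
  proof (rule band_limited_sampling[OF schwartz_rapid[OF \<phi>s] schwartz_rapid[OF \<theta>s] supp[OF disjI1] supp[OF disjI2] lower], goal_cases)
    case (5 M)
    show ?case by (rule that[unfolded p_def, OF 5(2-4)])
  qed
  have "(\<lambda>a. \<Sum>i\<in>?I. M i (p (j + i) *\<^sub>R x - lpt a - t) *
         convolve (dilate \<phi> (j + i)) u (p (- (j + i)) *\<^sub>R (lpt a + t))) sums convolve (dilate \<theta> j) u x"
    if u: "u \<in> schwartz_inf_dual" for u j x t
  proof -
    define c where "c i a = M i (p (j + i) *\<^sub>R x - lpt a - t)" for i a
    define k where "k i a y = dilate \<phi> (j + i) (p (- (j + i)) *\<^sub>R (lpt a + t) - y)" for i a y
    have k_in: "k i a \<in> schwartz_inf" for i a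
      unfolding k_def by (rule dilate_shift_schwartz_inf[OF \<phi>])
    have k_eq: "k i a = (\<lambda>y. of_real (p (j + i) ^ CARD('n)) * \<phi> ((lpt a + t) + (- p (j + i)) *\<^sub>R y))" for i a
    proof -
      have "p (j + i) *\<^sub>R (p (- (j + i)) *\<^sub>R (lpt a + t)) = lpt a + t"
        using p[of "j + i"] unfolding p_minus by simp
      then show ?thesis
        unfolding k_def dilate_shift p_card p_def[symmetric] by simp
    qed
    have g: "(\<lambda>y. dilate \<theta> j (x - y)) \<in> schwartz_inf" by (rule dilate_shift_schwartz_inf[OF \<theta>])
    have h: "(\<lambda>y. \<Sum>i\<in>?I. c i a * k i a y) \<in> schwartz_inf"
      "u (\<lambda>y. \<Sum>i\<in>?I. c i a * k i a y) = (\<Sum>i\<in>?I. c i a * u (k i a))" for a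
      using dual_sum[OF u g, of ?I "\<lambda>i. k i a" "\<lambda>i. c i a"] k_in by auto
    have "(\<lambda>a. u (\<lambda>y. \<Sum>i\<in>?I. c i a * k i a y)) sums u (\<lambda>y. dilate \<theta> j (x - y))"
    proof (rule dual_series[OF u h(1) g])
      fix y
      \<comment> \<open>A shift depending on both \<open>i\<close> and \<open>y\<close> cancels
        \<open>y\<close> in the argument of the kernel. The coefficients \<open>c i a\<close>
        thereby become constants, and the variable of the test function survives only in
        \<open>k i a\<close>.\<close>
      let ?v = "\<lambda>i. t - p (j + i) *\<^sub>R y"
      have "(\<lambda>a. of_real (p j ^ CARD('n)) * (\<Sum>i\<in>?I. of_real (p i ^ CARD('n)) *
          (M i (p i *\<^sub>R (p j *\<^sub>R (x - y)) - lpt a - ?v i) * \<phi> (lpt a + ?v i)))) sums (of_real (p j ^ CARD('n)) * \<theta> (p j *\<^sub>R (x - y)))"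
        by (rule sums_mult[OF samp])
      also have "of_real (p j ^ CARD('n)) * \<theta> (p j *\<^sub>R (x - y)) = dilate \<theta> j (x - y)"
        unfolding dilate_def p_card p_def ..
      also have "(\<lambda>a. of_real (p j ^ CARD('n)) * (\<Sum>i\<in>?I. of_real (p i ^ CARD('n)) *
          (M i (p i *\<^sub>R (p j *\<^sub>R (x - y)) - lpt a - ?v i) * \<phi> (lpt a + ?v i)))) = (\<lambda>a. \<Sum>i\<in>?I. c i a * k i a y)"
      proof
        fix a
        have "p i *\<^sub>R (p j *\<^sub>R (x - y)) - lpt a - ?v i = p (j + i) *\<^sub>R x - lpt a - t" for i
          by (simp add: p_add scaleR_right_diff_distrib mult.commute)
        moreover have "lpt a + ?v i = (lpt a + t) + (- p (j + i)) *\<^sub>R y" for i by simp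
        ultimately show "of_real (p j ^ CARD('n)) * (\<Sum>i\<in>?I. of_real (p i ^ CARD('n)) *
          (M i (p i *\<^sub>R (p j *\<^sub>R (x - y)) - lpt a - ?v i) * \<phi> (lpt a + ?v i))) = (\<Sum>i\<in>?I. c i a * k i a y)"
          unfolding sum_distrib_left c_def k_eq
          by (intro sum.cong refl) (simp only: p_add power_mult_distrib of_real_mult mult_ac)
      qed
      finally show "(\<lambda>a. \<Sum>i\<in>?I. c i a * k i a y) sums dilate \<theta> j (x - y)" .
    next
      fix N and "is" :: "'n list"
      \<comment> \<open>Everything except the growth in the lattice point. It depends on
        \<open>j\<close>, which is harmless: only summability is sought here, not a uniform
        bound.\<close>
      define E where "E i = p (j + i) ^ CARD('n) * \<bar>- p (j + i)\<bar> ^ length is * (1 + 1 / \<bar>- p (j + i)\<bar>) ^ N * schwartz_seminorm N is \<phi>" for i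
      have kb: "schwartz_seminorm N is (k i a) \<le> E i * (1 + norm (lpt a + t)) ^ N" for i a
      proof (rule schwartz_seminorm_least)
        fix y
        have nz: "- p (j + i) \<noteq> 0" using p[of "j + i"] by simp
        have "norm (complex_of_real (p (j + i) ^ CARD('n))) = p (j + i) ^ CARD('n)"
          using p[of "j + i"] by (simp add: norm_power)
        then show "(1 + norm y) ^ N * norm (iterated_partial is (k i a) y) \<le> E i * (1 + norm (lpt a + t)) ^ N"
          using affine_schwartz_bound[OF \<phi>s nz, of y N "is" "of_real (p (j + i) ^ CARD('n))" "lpt a + t"]
          unfolding k_eq E_def by simp
      qed
      have hb: "schwartz_seminorm N is (\<lambda>y. \<Sum>i\<in>?I. c i a * k i a y) \<le> (\<Sum>i\<in>?I. E i * (norm (c i a) * (1 + norm (lpt a + t)) ^ N))" for a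
      proof -
        have s1: "schwartz_seminorm N is (\<lambda>y. c' * f y + d' * g y) \<le> norm c' * schwartz_seminorm N is f + norm d' * schwartz_seminorm N is g"
          if "f \<in> schwartz" "g \<in> schwartz" for c' d' f and g :: "real^'n \<Rightarrow> complex"
          by (rule schwartz_seminorm_least[OF lincomb_schwartz_bound[OF that]])
        have ks: "k i a \<in> schwartz" for i by (rule schwartz_inf_schwartz[OF k_in])
        have l: "(\<lambda>y. c 0 a * k 0 a y + c 1 a * k 1 a y) \<in> schwartz" by (rule lincomb_schwartz[OF ks ks])
        have "(\<lambda>y. \<Sum>i\<in>?I. c i a * k i a y) = (\<lambda>y. c (-1) a * k (-1) a y + 1 * (c 0 a * k 0 a y + c 1 a * k 1 a y))"
          by (simp add: add.assoc)
        then have "schwartz_seminorm N is (\<lambda>y. \<Sum>i\<in>?I. c i a * k i a y)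
          \<le> norm (c (-1) a) * schwartz_seminorm N is (k (-1) a) + (norm (c 0 a) * schwartz_seminorm N is (k 0 a) + norm (c 1 a) * schwartz_seminorm N is (k 1 a))"
          using s1[OF ks[of "-1"] l, of "c (-1) a" 1] s1[OF ks[of 0] ks[of 1], of "c 0 a" "c 1 a"] by simp
        also have "\<dots> = (\<Sum>i\<in>?I. norm (c i a) * schwartz_seminorm N is (k i a))" by simp
        also have "\<dots> \<le> (\<Sum>i\<in>?I. norm (c i a) * (E i * (1 + norm (lpt a + t)) ^ N))"
          by (intro sum_mono mult_left_mono kb) auto
        finally show ?thesis by (simp only: mult_ac)
      qed
      show "summable (\<lambda>a. schwartz_seminorm N is (\<lambda>y. \<Sum>i\<in>?I. c i a * k i a y))"
      proof (rule summable_comparison_test'[of "\<lambda>a. \<Sum>i\<in>?I. E i * (norm (c i a) * (1 + norm (lpt a + t)) ^ N)" 0])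
        show "summable (\<lambda>a. \<Sum>i\<in>?I. E i * (norm (c i a) * (1 + norm (lpt a + t)) ^ N))"
          unfolding c_def by (intro summable_sum summable_mult summable_decay_growth M)
        show "norm (schwartz_seminorm N is (\<lambda>y. \<Sum>i\<in>?I. c i a * k i a y)) \<le> (\<Sum>i\<in>?I. E i * (norm (c i a) * (1 + norm (lpt a + t)) ^ N))" for a
          using hb[of a] schwartz_seminorm_nonneg[OF schwartz_inf_schwartz[OF h(1)[of a]], of N "is"] by simp
      qed
    qed
    then have "(\<lambda>a. \<Sum>i\<in>?I. c i a * u (k i a)) sums u (\<lambda>y. dilate \<theta> j (x - y))"
      by (simp only: h(2))
    then show ?thesis unfolding convolve_def c_def k_def[abs_def] .
  qed
  then show ?thesis unfolding sampling_kernels_def p_def[symmetric] using M by blast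
qed

section \<open>Pointwise bounds from samples and from averages\<close>

lemma norm_sums_le:
  fixes F :: "nat \<Rightarrow> complex"
  assumes "F sums s" "\<And>m. norm (\<Sum>a<m. F a) \<le> B"
  shows "norm s \<le> B"
proof -
  have "(\<lambda>m. norm (\<Sum>a<m. F a)) \<longlonglongrightarrow> norm s"
    using assms(1) unfolding sums_def by (rule tendsto_norm)
  then show ?thesis by (rule LIMSEQ_le_const2) (use assms(2) in blast)
qed

lemma sum_wt_minus_le:
  fixes z :: "real^'n::finite"
  shows "(\<Sum>a<m. wt (z - lpt a)) \<le> 12 ^ CARD('n)"
  using sum_wt_le[where u="- z"] by (subst wt_minus_commute) simp

lemma rapid_decay_family_bound:
  fixes M :: "int \<Rightarrow> real^'n::finite \<Rightarrow> complex"
  assumes "\<And>i. rapid_decay (M i)" "e > 0"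
  obtains C where "C > 0" "\<And>i x. i \<in> {-1,0,1} \<Longrightarrow> norm (M i x) \<le> C * wt x powr e"
proof -
  have "\<exists>C>0. \<forall>x. norm (M i x) \<le> C * wt x powr e" for i
    using rapid_decay_wt_powr[OF assms(1)[of i] assms(2)] by metis
  then obtain Cf where Cf: "\<And>i. Cf i > 0" "\<And>i x. norm (M i x) \<le> Cf i * wt x powr e" by metis
  have "norm (M i x) \<le> (Cf (-1) + Cf 0 + Cf 1) * wt x powr e" if "i \<in> {-1,0,1}" for i x
  proof -
    have "Cf i \<le> Cf (-1) + Cf 0 + Cf 1" using that Cf(1)[of 0] Cf(1)[of 1] Cf(1)[of "-1"] by auto
    then have "Cf i * wt x powr e \<le> (Cf (-1) + Cf 0 + Cf 1) * wt x powr e" by (intro mult_right_mono) auto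
    then show ?thesis using Cf(2)[of i x] by linarith
  qed
  moreover have "Cf (-1) + Cf 0 + Cf 1 > 0" using Cf(1)[of 0] Cf(1)[of 1] Cf(1)[of "-1"] by linarith
  ultimately show ?thesis using that by blast
qed

text \<open>The sampling formula with \<open>t = 0\<close> exhibits the convolution as a pointwise
  limit of finite combinations of translated and dilated measurable kernels.\<close>

lemma convolve_measurable:
  assumes "sampling_kernels \<phi> \<theta> M" "u \<in> schwartz_inf_dual"
  shows "convolve (dilate \<theta> j) u \<in> borel_measurable borel"
proof (rule borel_measurable_LIMSEQ_metric)
  let ?F = "\<lambda>a x. \<Sum>i\<in>{-1,0,1::int}. M i ((2 powr real_of_int (j + i)) *\<^sub>R x - lpt a - 0) *
         convolve (dilate \<phi> (j + i)) u ((2 powr real_of_int (- (j + i))) *\<^sub>R (lpt a + 0))"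
  have [measurable]: "M i \<in> borel_measurable borel" for i using assms(1) by (simp add: sampling_kernels_def)
  show "(\<lambda>x. \<Sum>a<n. ?F a x) \<in> borel_measurable borel" for n by measurable
  show "(\<lambda>n. \<Sum>a<n. ?F a x) \<longlonglongrightarrow> convolve (dilate \<theta> j) u x" for x
    using assms unfolding sampling_kernels_def sums_def by blast
qed

text \<open>With \<open>t = 0\<close> the kernels are absolutely summable over the lattice,
  uniformly in \<open>x\<close>. In the constant, 3 counts the neighbouring scales and the power of
  12 bounds each lattice sum.\<close>

lemma sampled_bound:
  fixes \<phi> \<theta> :: "real^'n::finite \<Rightarrow> complex"
  assumes M: "sampling_kernels \<phi> \<theta> M"
  obtains C where "C > 0" "\<And>u j x S. u \<in> schwartz_inf_dual \<Longrightarrow> 0 \<le> S \<Longrightarrow>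
    (\<And>i a. i \<in> {-1,0,1} \<Longrightarrow> norm (convolve (dilate \<phi> (j + i)) u ((2 powr real_of_int (- (j + i))) *\<^sub>R lpt a)) \<le> S) \<Longrightarrow>
    norm (convolve (dilate \<theta> j) u x) \<le> C * S"
proof -
  let ?I = "{-1,0,1} :: int set"
  have "rapid_decay (M i)" for i using M by (simp add: sampling_kernels_def)
  then obtain C where C: "C > 0" "\<And>i x. i \<in> ?I \<Longrightarrow> norm (M i x) \<le> C * wt x powr 1"
    by (rule rapid_decay_family_bound[of M 1]) auto
  have "norm (convolve (dilate \<theta> j) u x) \<le> (3 * C * 12 ^ CARD('n)) * S"
    if u: "u \<in> schwartz_inf_dual" and S: "0 \<le> S"
      and b: "\<And>i a. i \<in> ?I \<Longrightarrow> norm (convolve (dilate \<phi> (j + i)) u ((2 powr real_of_int (- (j + i))) *\<^sub>R lpt a)) \<le> S" for u j x S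
  proof (rule norm_sums_le)
    let ?F = "\<lambda>a. \<Sum>i\<in>?I. M i ((2 powr real_of_int (j + i)) *\<^sub>R x - lpt a - 0) *
         convolve (dilate \<phi> (j + i)) u ((2 powr real_of_int (- (j + i))) *\<^sub>R (lpt a + 0))"
    show "?F sums convolve (dilate \<theta> j) u x"
      using M u unfolding sampling_kernels_def by blast
    fix m
    have "norm (\<Sum>a<m. ?F a) \<le> (\<Sum>a<m. \<Sum>i\<in>?I. C * S * wt ((2 powr real_of_int (j + i)) *\<^sub>R x - lpt a))"
    proof (intro sum_norm_le)
      fix a i assume i: "i \<in> ?I"
      have "norm (M i ((2 powr real_of_int (j + i)) *\<^sub>R x - lpt a - 0)) * norm (convolve (dilate \<phi> (j + i)) u ((2 powr real_of_int (- (j + i))) *\<^sub>R (lpt a + 0)))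
        \<le> (C * wt ((2 powr real_of_int (j + i)) *\<^sub>R x - lpt a)) * S"
        using C(2)[OF i, of "(2 powr real_of_int (j + i)) *\<^sub>R x - lpt a"] b[OF i, of a] C(1) wt_pos[of "(2 powr real_of_int (j + i)) *\<^sub>R x - lpt a"]
        by (intro mult_mono) auto
      then show "norm (M i ((2 powr real_of_int (j + i)) *\<^sub>R x - lpt a - 0) * convolve (dilate \<phi> (j + i)) u ((2 powr real_of_int (- (j + i))) *\<^sub>R (lpt a + 0)))
        \<le> C * S * wt ((2 powr real_of_int (j + i)) *\<^sub>R x - lpt a)"
        unfolding norm_mult by (simp only: mult_ac)
    qed
    also have "\<dots> = (\<Sum>i\<in>?I. C * S * (\<Sum>a<m. wt ((2 powr real_of_int (j + i)) *\<^sub>R x - lpt a)))"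
      unfolding sum_distrib_left by (rule sum.swap)
    also have "\<dots> \<le> (\<Sum>i\<in>?I. C * S * 12 ^ CARD('n))"
      using C(1) S by (intro sum_mono mult_left_mono sum_wt_minus_le) auto
    also have "\<dots> = (3 * C * 12 ^ CARD('n)) * S" by simp
    finally show "norm (\<Sum>a<m. ?F a) \<le> (3 * C * 12 ^ CARD('n)) * S" .
  qed
  moreover have "3 * C * 12 ^ CARD('n) > 0" using C(1) by simp
  ultimately show ?thesis using that by blast
qed

text \<open>Turns an average over the shift \<open>t\<close> into a mean over the dyadic cube that
  \<open>lat k + t\<close> sweeps out after rescaling.\<close>

lemma nn_integral_unit_cube_cube:
  fixes F :: "real^'n::finite \<Rightarrow> ennreal"
  assumes [measurable]: "F \<in> borel_measurable borel"
  shows "(\<integral>\<^sup>+y. F y * indicator (cube (l, k)) y \<partial>lborel) = ennreal (volume (l, k)) *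
    (\<integral>\<^sup>+t. indicator unit_cube t * F ((2 powr real_of_int (- l)) *\<^sub>R (lat k + t)) \<partial>lborel)"
proof -
  define c where "c = 2 powr real_of_int (- l)"
  have c: "c > 0" by (simp add: c_def)
  have aux: "c * (a + b) < c * a + c \<longleftrightarrow> b < 1" for a b
    using c by (simp add: distrib_left)
  have mem: "c *\<^sub>R lat k + c *\<^sub>R t \<in> cube (l, k) \<longleftrightarrow> t \<in> unit_cube" for t
    using c by (simp add: cube_def half_box_def corner_def side_def distrib_left[symmetric] aux flip: c_def[simplified])
  have vol: "volume (l, k) = c ^ CARD('n)" by (simp add: volume_eq side_def c_def)
  show ?thesis
    using nn_integral_affine[of "\<lambda>y. F y * indicator (cube (l, k)) y" c "c *\<^sub>R lat k"] c
    unfolding vol c_def[symmetric] by (simp add: scaleR_right_distrib indicator_def mem mult.commute cong: if_cong)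
qed

text \<open>Writing the kernel as \<open>w \<cdot> w\<^sup>1\<^sup>/\<^sup>q\<close> and bounding \<open>w\<^sup>1\<^sup>/\<^sup>q |g|\<close> by the \<open>q\<close>-th root of
  \<open>\<Sum> w |g|\<^sup>q\<close> treats all \<open>q > 0\<close> at once, without subadditivity or Hoelder's inequality.\<close>

lemma averaged_bound:
  fixes \<phi> \<theta> :: "real^'n::finite \<Rightarrow> complex"
  assumes M: "sampling_kernels \<phi> \<theta> M" and M': "sampling_kernels \<phi>' \<phi> M'" and q: "q > 0"
  obtains C where "C > 0" "\<And>u j x S. u \<in> schwartz_inf_dual \<Longrightarrow> 0 \<le> S \<Longrightarrow>
    (\<And>i k. i \<in> {-1,0,1} \<Longrightarrow> (\<integral>\<^sup>+y\<in>cube (j + i, k). ennreal (norm (convolve (dilate \<phi> (j + i)) u y) powr q) \<partial>lborel)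
       \<le> ennreal (volume (j + i, k) * S)) \<Longrightarrow>
    norm (convolve (dilate \<theta> j) u x) powr q \<le> C * S"
proof -
  let ?I = "{-1,0,1} :: int set"
  define e where "e = 1 + 1 / q"
  have e: "e > 0" using q by (simp add: e_def add_pos_pos)
  have "rapid_decay (M i)" for i using M by (simp add: sampling_kernels_def)
  then obtain C where C: "C > 0" "\<And>i x. i \<in> ?I \<Longrightarrow> norm (M i x) \<le> C * wt x powr e"
    using e by (rule rapid_decay_family_bound[of M e]) auto
  \<comment> \<open>The power of 4 pays for removing the shift \<open>t\<close> from the argument of
    the weight.\<close>
  define D where "D = C * (4 ^ CARD('n)) powr e"
  have D: "D > 0" using C(1) by (simp add: D_def)
  define K where "K = 3 * D * 12 ^ CARD('n)"
  have K: "K > 0" using D by (simp add: K_def)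
  have "norm (convolve (dilate \<theta> j) u x) powr q \<le> (K powr q * (3 * 12 ^ CARD('n))) * S"
    if u: "u \<in> schwartz_inf_dual" and S: "0 \<le> S"
      and b: "\<And>i k. i \<in> ?I \<Longrightarrow> (\<integral>\<^sup>+y\<in>cube (j + i, k). ennreal (norm (convolve (dilate \<phi> (j + i)) u y) powr q) \<partial>lborel)
       \<le> ennreal (volume (j + i, k) * S)" for u j x S
  proof -
    define z where "z i = (2 powr real_of_int (j + i)) *\<^sub>R x" for i
    define w where "w i a = wt (z i - lpt a)" for i a
    define G where "G i a t = convolve (dilate \<phi> (j + i)) u ((2 powr real_of_int (- (j + i))) *\<^sub>R (lpt a + t))" for i a t
    define v where "v = norm (convolve (dilate \<theta> j) u x)"
    \<comment> \<open>Measurability of the sampled convolutions needs a formula that reconstructs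
      \<open>\<phi>\<close>; this is the purpose of \<open>M'\<close>.\<close>
    have [measurable]: "convolve (dilate \<phi> l) u \<in> borel_measurable borel" for l
      by (rule convolve_measurable[OF M' u])
    have [measurable]: "G i a \<in> borel_measurable borel" for i a
      unfolding G_def by measurable
    have w0: "w i a > 0" for i a by (simp add: w_def wt_pos)
    define A where "A t = (\<Sum>i\<in>?I. \<Sum>a. ennreal (w i a) * ennreal (norm (G i a t) powr q))" for t
    have ptw: "ennreal (v powr q) \<le> ennreal (K powr q) * A t" if t: "t \<in> unit_cube" for t
    proof (cases "A t")
      case (real A')
      have root: "w i a powr (1 / q) * norm (G i a t) \<le> A' powr (1 / q)" if "i \<in> ?I" for i a
      proof -
        have "ennreal (w i a) * ennreal (norm (G i a t) powr q) \<le> (\<Sum>a. ennreal (w i a) * ennreal (norm (G i a t) powr q))"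
          using sum_le_suminf[of "\<lambda>a. ennreal (w i a) * ennreal (norm (G i a t) powr q)" "{a}"] by simp
        also have "\<dots> \<le> A t"
          unfolding A_def using that by (intro member_le_sum) auto
        finally have "ennreal (w i a * norm (G i a t) powr q) \<le> ennreal A'"
          using real w0[of i a] by (simp add: ennreal_mult less_imp_le)
        then have "w i a * norm (G i a t) powr q \<le> A'" using real by simp
        then have "(w i a * norm (G i a t) powr q) powr (1 / q) \<le> A' powr (1 / q)"
          using q w0[of i a] by (intro powr_mono2) auto
        then show ?thesis using q w0[of i a] by (simp add: powr_mult powr_powr)
      qed
      have "v \<le> K * A' powr (1 / q)"
        unfolding v_def
      proof (rule norm_sums_le)
        let ?F = "\<lambda>a. \<Sum>i\<in>?I. M i ((2 powr real_of_int (j + i)) *\<^sub>R x - lpt a - t) *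
           convolve (dilate \<phi> (j + i)) u ((2 powr real_of_int (- (j + i))) *\<^sub>R (lpt a + t))"
        show "?F sums convolve (dilate \<theta> j) u x"
          using M u unfolding sampling_kernels_def by blast
        fix m
        have "norm (\<Sum>a<m. ?F a) \<le> (\<Sum>a<m. \<Sum>i\<in>?I. D * A' powr (1 / q) * w i a)"
        proof (intro sum_norm_le)
          fix a i assume i: "i \<in> ?I"
          have "norm (M i (z i - lpt a - t)) \<le> C * wt (z i - lpt a - t) powr e" by (rule C(2)[OF i])
          also have "\<dots> \<le> C * (4 ^ CARD('n) * w i a) powr e"
            using wt_shift_unit_cube(2)[OF t, of "z i - lpt a"] C(1) e wt_pos[of "z i - lpt a - t"]
            by (intro mult_left_mono powr_mono2) (auto simp: w_def less_imp_le)
          also have "\<dots> = D * w i a * w i a powr (1 / q)"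
            using w0[of i a] by (simp add: D_def powr_mult e_def powr_add)
          finally have "norm (M i (z i - lpt a - t)) * norm (G i a t) \<le> D * w i a * w i a powr (1 / q) * norm (G i a t)"
            by (rule mult_right_mono) simp
          also have "\<dots> = D * w i a * (w i a powr (1 / q) * norm (G i a t))" by simp
          also have "\<dots> \<le> D * w i a * A' powr (1 / q)"
            using root[OF i] D w0[of i a] by (intro mult_left_mono) auto
          finally show "norm (M i ((2 powr real_of_int (j + i)) *\<^sub>R x - lpt a - t) *
              convolve (dilate \<phi> (j + i)) u ((2 powr real_of_int (- (j + i))) *\<^sub>R (lpt a + t))) \<le> D * A' powr (1 / q) * w i a"
            unfolding norm_mult z_def G_def by (simp only: mult_ac)
        qed
        also have "\<dots> = (\<Sum>i\<in>?I. D * A' powr (1 / q) * (\<Sum>a<m. w i a))"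
          unfolding sum_distrib_left by (rule sum.swap)
        also have "\<dots> \<le> (\<Sum>i\<in>?I. D * A' powr (1 / q) * 12 ^ CARD('n))"
          using D unfolding w_def by (intro sum_mono mult_left_mono sum_wt_minus_le) auto
        also have "\<dots> = K * A' powr (1 / q)" by (simp add: K_def)
        finally show "norm (\<Sum>a<m. ?F a) \<le> K * A' powr (1 / q)" .
      qed
      then have "v powr q \<le> (K * A' powr (1 / q)) powr q"
        using q by (intro powr_mono2) (auto simp: v_def)
      also have "\<dots> = K powr q * A'" using q real K by (simp add: powr_mult powr_powr)
      finally show ?thesis using real K by (simp add: ennreal_mult[symmetric] ennreal_leI)
    next
      case top
      then show ?thesis using K by (simp add: ennreal_mult_top)
    qed
    have inner: "(\<integral>\<^sup>+t. indicator unit_cube t * ennreal (norm (G i a t) powr q) \<partial>lborel) \<le> ennreal S" if i: "i \<in> ?I" for i a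
    proof -
      let ?V = "volume (j + i, lattice_enum a :: int^'n)"
      have V: "?V > 0" by (simp add: volume_powr)
      have "ennreal ?V * (\<integral>\<^sup>+t. indicator unit_cube t * ennreal (norm (G i a t) powr q) \<partial>lborel)
          = (\<integral>\<^sup>+y\<in>cube (j + i, lattice_enum a). ennreal (norm (convolve (dilate \<phi> (j + i)) u y) powr q) \<partial>lborel)"
        unfolding G_def lpt_def by (subst nn_integral_unit_cube_cube) auto
      also have "\<dots> \<le> ennreal (?V * S)" by (rule b[OF i])
      also have "\<dots> = ennreal ?V * ennreal S" using V S by (simp add: ennreal_mult)
      finally show ?thesis using V by (simp add: ennreal_mult_le_mult_iff)
    qed
    \<comment> \<open>The left-hand side does not depend on \<open>t\<close> and the unit cube has
      measure 1, so integrating the pointwise bound over \<open>t\<close> costs nothing and turns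
      samples into means.\<close>
    have "ennreal (v powr q) = (\<integral>\<^sup>+t. ennreal (v powr q) * indicator (unit_cube :: (real^'n) set) t \<partial>lborel)"
      by (simp add: nn_integral_cmult_indicator emeasure_unit_cube)
    also have "\<dots> \<le> (\<integral>\<^sup>+t. ennreal (K powr q) * (\<Sum>i\<in>?I. \<Sum>a. ennreal (w i a) * (indicator unit_cube t * ennreal (norm (G i a t) powr q))) \<partial>lborel)"
      using ptw unfolding A_def by (intro nn_integral_mono) (auto simp: indicator_def)
    also have "\<dots> = ennreal (K powr q) * (\<Sum>i\<in>?I. \<Sum>a. ennreal (w i a) * (\<integral>\<^sup>+t. indicator unit_cube t * ennreal (norm (G i a t) powr q) \<partial>lborel))"
    proof -
      let ?f = "\<lambda>i a t. ennreal (w i a) * (indicator unit_cube t * ennreal (norm (G i a t) powr q))"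
      have m: "?f i a \<in> borel_measurable lborel" for i a by measurable
      have ms: "(\<lambda>t. \<Sum>a. ?f i a t) \<in> borel_measurable lborel" for i by (intro borel_measurable_suminf_order m)
      have "(\<integral>\<^sup>+t. ennreal (K powr q) * (\<Sum>i\<in>?I. \<Sum>a. ?f i a t) \<partial>lborel)
          = ennreal (K powr q) * (\<integral>\<^sup>+t. (\<Sum>i\<in>?I. \<Sum>a. ?f i a t) \<partial>lborel)"
        by (intro nn_integral_cmult borel_measurable_sum ms)
      also have "(\<integral>\<^sup>+t. (\<Sum>i\<in>?I. \<Sum>a. ?f i a t) \<partial>lborel) = (\<Sum>i\<in>?I. \<integral>\<^sup>+t. (\<Sum>a. ?f i a t) \<partial>lborel)"
        by (intro nn_integral_sum ms)
      also have "\<dots> = (\<Sum>i\<in>?I. \<Sum>a. \<integral>\<^sup>+t. ?f i a t \<partial>lborel)"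
        by (intro sum.cong refl nn_integral_suminf m)
      moreover have cm: "(\<integral>\<^sup>+t. ?f i a t \<partial>lborel) = ennreal (w i a) * (\<integral>\<^sup>+t. indicator unit_cube t * ennreal (norm (G i a t) powr q) \<partial>lborel)" for i a
        by (rule nn_integral_cmult) measurable
      ultimately show ?thesis by (simp only: cm)
    qed
    also have "\<dots> \<le> ennreal (K powr q) * (\<Sum>i\<in>?I. ennreal (12 ^ CARD('n) * S))"
    proof (intro mult_left_mono sum_mono)
      fix i assume i: "i \<in> ?I"
      show "(\<Sum>a. ennreal (w i a) * (\<integral>\<^sup>+t. indicator unit_cube t * ennreal (norm (G i a t) powr q) \<partial>lborel)) \<le> ennreal (12 ^ CARD('n) * S)"
      proof (rule suminf_le_const)
        fix m
        have "(\<Sum>a<m. ennreal (w i a) * (\<integral>\<^sup>+t. indicator unit_cube t * ennreal (norm (G i a t) powr q) \<partial>lborel))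
           \<le> (\<Sum>a<m. ennreal (w i a) * ennreal S)"
          by (intro sum_mono mult_left_mono inner i) auto
        also have "\<dots> = ennreal ((\<Sum>a<m. w i a) * S)"
          using w0 S by (simp add: sum_distrib_right ennreal_mult less_imp_le flip: sum_ennreal)
        also have "\<dots> \<le> ennreal (12 ^ CARD('n) * S)"
          unfolding w_def using S by (intro ennreal_leI mult_right_mono sum_wt_minus_le)
        finally show "(\<Sum>a<m. ennreal (w i a) * (\<integral>\<^sup>+t. indicator unit_cube t * ennreal (norm (G i a t) powr q) \<partial>lborel)) \<le> ennreal (12 ^ CARD('n) * S)" .
      qed simp
    qed simp
    also have "\<dots> = ennreal ((K powr q * (3 * 12 ^ CARD('n))) * S)"
      using S by (simp add: ennreal_mult mult.assoc flip: ennreal_plus)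
    finally show ?thesis using S unfolding v_def by (subst (asm) ennreal_le_iff) (auto intro!: mult_nonneg_nonneg)
  qed
  moreover have "K powr q * (3 * 12 ^ CARD('n)) > 0" using K by simp
  ultimately show ?thesis using that by blast
qed

section \<open>Comparison of the quasi-norms\<close>

lemma epowr_ennreal [simp]: "0 \<le> x \<Longrightarrow> epowr (ennreal x) a = ennreal (x powr a)"
  by (simp add: epowr_def)

lemma epowr_top [simp]: "epowr top a = top"
  by (simp add: epowr_def)

lemma epowr_mono:
  assumes "x \<le> y" "0 \<le> a"
  shows "epowr x a \<le> epowr y a"
proof (cases y)
  case (real y')
  then obtain x' where "x = ennreal x'" "0 \<le> x'" "x' \<le> y'"
    using assms(1) by (cases x) (auto simp: top_unique)
  then show ?thesis using real assms(2) by (auto intro!: ennreal_leI powr_mono2)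
qed simp

lemma epowr_epowr_inverse: "0 < a \<Longrightarrow> epowr (epowr x (1 / a)) a = x"
  by (cases x) (simp_all add: powr_powr)

lemma epowr_root_leD:
  assumes "epowr X (1 / a) \<le> ennreal y" "0 < a" "0 \<le> y"
  shows "X \<le> ennreal (y powr a)"
  using epowr_mono[OF assms(1), of a] assms(2,3) by (simp add: epowr_epowr_inverse)

lemma epowr_root_leI:
  assumes "X \<le> ennreal (y powr a)" "0 < a" "0 \<le> y"
  shows "epowr X (1 / a) \<le> ennreal y"
  using epowr_mono[OF assms(1), of "1 / a"] assms(2,3) by (simp add: powr_powr)

lemma ennreal_mult_leD:
  assumes "ennreal v * E \<le> ennreal b" "0 < v" "0 \<le> b"
  shows "E \<le> ennreal (b / v)"
proof -
  have "ennreal v * E \<le> ennreal v * ennreal (b / v)"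
    using assms by (simp flip: ennreal_mult')
  then show ?thesis using assms(2) by (simp add: ennreal_mult_le_mult_iff)
qed

lemma nn_integral_count_space_atLeast:
  fixes f :: "int \<Rightarrow> ennreal"
  shows "(\<integral>\<^sup>+l. f l \<partial>count_space {j..}) = (\<Sum>m. f (j + int m))"
proof -
  have bij: "bij_betw (\<lambda>m. j + int m) UNIV {j..}"
  proof (rule bij_betwI[where g="\<lambda>l. nat (l - j)"])
  qed auto
  have "(\<integral>\<^sup>+l. f l \<partial>count_space {j..}) = (\<integral>\<^sup>+m. f (j + int m) \<partial>count_space UNIV)"
    by (rule nn_integral_bij_count_space[OF bij, symmetric])
  then show ?thesis by (simp add: nn_integral_count_space_nat)
qed

lemma nn_integral_geometric:
  assumes "\<beta> > 0" "c \<ge> 0"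
  shows "(\<integral>\<^sup>+l. ennreal (c * 2 powr (- (real_of_int l * \<beta>))) \<partial>count_space {j..})
    = ennreal (c * 2 powr (- (real_of_int j * \<beta>)) * (1 / (1 - 2 powr (- \<beta>))))"
proof -
  define \<rho> where "\<rho> = 2 powr (- \<beta>)"
  have \<rho>: "0 \<le> \<rho>" "\<rho> < 1"
    using assms(1) powr_less_mono[of "- \<beta>" 0 2] by (simp_all add: \<rho>_def)
  have eq: "c * 2 powr (- (real_of_int (j + int m) * \<beta>)) = c * 2 powr (- (real_of_int j * \<beta>)) * \<rho> ^ m" for m
    by (simp add: \<rho>_def powr_power algebra_simps flip: powr_add)
  have "(\<lambda>m. c * 2 powr (- (real_of_int j * \<beta>)) * \<rho> ^ m) sums (c * 2 powr (- (real_of_int j * \<beta>)) * (1 / (1 - \<rho>)))"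
    using \<rho> by (intro sums_mult geometric_sums) simp
  then show ?thesis
    unfolding nn_integral_count_space_atLeast \<rho>_def[symmetric] eq
    using assms(2) \<rho> by (intro suminf_ennreal_eq) auto
qed

lemma powr_shift_le:
  assumes "i \<in> {-1,0,1::int}"
  shows "2 powr (- (real_of_int (j + i) * \<sigma>)) \<le> 2 powr \<bar>\<sigma>\<bar> * 2 powr (- (real_of_int j * \<sigma>))"
proof -
  have "- (real_of_int i * \<sigma>) \<le> \<bar>\<sigma>\<bar>" using assms by auto
  then show ?thesis by (simp add: algebra_simps flip: powr_add)
qed

lemma volume_pos: "volume Q > 0"
  by (simp add: volume_powr)

lemma volume_powr_powr: "volume (Q :: 'n::finite dyadic) powr a = 2 powr (- (real_of_int (fst Q) * (real CARD('n) * a)))"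
  by (simp add: volume_powr powr_powr mult.assoc)

lemma nn_integral_const_cube:
  "0 \<le> c \<Longrightarrow> (\<integral>\<^sup>+x. ennreal c * indicator (cube P) x \<partial>lborel) = ennreal (c * volume P)"
  by (simp add: nn_integral_cmult_indicator emeasure_cube ennreal_mult flip: volume_eq)
    (simp add: ennreal_mult volume_pos less_imp_le)

section \<open>Reflection and the Carleson coefficients\<close>

definition reflect :: "(real^'n::finite \<Rightarrow> complex) \<Rightarrow> real^'n \<Rightarrow> complex" where
  "reflect \<phi> x = \<phi> (- x)"

lemma fourier_reflect: "rapid \<phi> \<Longrightarrow> fourier (reflect \<phi>) \<xi> = fourier \<phi> (- \<xi>)"
  using fourier_affine[of \<phi> "-1" 0 \<xi>] by (simp add: reflect_def[abs_def])

lemma band_limited_reflect: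
  assumes "band_limited \<phi>"
  shows "band_limited (reflect \<phi>)"
proof -
  have "\<phi> \<in> schwartz" using assms by (simp add: band_limited_def)
  moreover from affine_schwartz[OF this, of "-1" 1 0] have "reflect \<phi> \<in> schwartz"
    by (simp add: reflect_def[abs_def])
  moreover have "1/2 \<le> norm \<xi> \<and> norm \<xi> \<le> 2" if "fourier (reflect \<phi>) \<xi> \<noteq> 0" for \<xi>
  proof -
    have "fourier \<phi> (- \<xi>) \<noteq> 0" using that fourier_reflect[OF schwartz_rapid[OF \<open>\<phi> \<in> schwartz\<close>]] by simp
    then have "1/2 \<le> norm (- \<xi>) \<and> norm (- \<xi>) \<le> 2" using assms unfolding band_limited_def by blast
    then show ?thesis by simp
  qed
  ultimately show ?thesis unfolding band_limited_def by blast
qed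

text \<open>The two normalisations, in L2 for \<open>wavelet\<close> and in L1 for
  \<open>dilate\<close>, differ by the square root of the volume. This cancels the -1/2 in the
  exponent, and the remaining power of the volume is \<open>2 powr (j * s)\<close> at level
  j.\<close>

lemma wavelet_coefficient:
  fixes \<phi> :: "real^'n::finite \<Rightarrow> complex"
  assumes \<phi>: "band_limited \<phi>" and u: "u \<in> schwartz_inf_dual"
  shows "volume Q powr (- s / real CARD('n) - 1/2) * norm (u (wavelet \<phi> Q))
    = 2 powr (real_of_int (fst Q) * s) * norm (convolve (dilate (reflect \<phi>) (fst Q)) u (corner Q))"
proof -
  define V where "V = volume Q"
  have V: "V > 0" by (simp add: V_def volume_pos)
  let ?g = "\<lambda>y. dilate (reflect \<phi>) (fst Q) (corner Q - y)"
  have g: "?g \<in> schwartz_inf" by (rule dilate_shift_schwartz_inf[OF band_limited_reflect[OF \<phi>]])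
  have s: "1 / side Q = 2 powr real_of_int (fst Q)" by (simp add: side_def powr_minus_divide)
  have V_inv: "2 powr (real_of_int (fst Q) * real CARD('n)) = V powr (-1)"
    unfolding V_def volume_powr powr_powr by simp
  have "wavelet \<phi> Q = (\<lambda>y. of_real (V powr (1/2)) * ?g y)"
  proof
    fix y
    have "V powr (-1/2) = V powr (1/2) * V powr (-1)" unfolding powr_add[symmetric] by simp
    moreover have "- ((2 powr real_of_int (fst Q)) *\<^sub>R (corner Q - y)) = (2 powr real_of_int (fst Q)) *\<^sub>R (y - corner Q)"
      by (simp add: scaleR_right_diff_distrib)
    ultimately show "wavelet \<phi> Q y = of_real (V powr (1/2)) * ?g y"
      unfolding wavelet_def dilate_def reflect_def s V_inv V_def[symmetric] by simp
  qed
  then have "u (wavelet \<phi> Q) = of_real (V powr (1/2)) * u ?g"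
    using dual_lincomb[OF u g g, of "of_real (V powr (1/2))" 0] by simp
  then have nu: "norm (u (wavelet \<phi> Q)) = V powr (1/2) * norm (convolve (dilate (reflect \<phi>) (fst Q)) u (corner Q))"
    by (simp add: convolve_def norm_mult)
  have "V powr (- s / real CARD('n) - 1/2) * V powr (1/2) = 2 powr (real_of_int (fst Q) * s)"
  proof -
    have "V powr (- s / real CARD('n) - 1/2) * V powr (1/2) = V powr (- s / real CARD('n))"
      using V by (simp flip: powr_add)
    also have "\<dots> = 2 powr (real_of_int (fst Q) * s)"
      unfolding V_def volume_powr_powr by simp
    finally show ?thesis .
  qed
  then show ?thesis unfolding V_def[symmetric] nu by (simp only: mult.assoc[symmetric])
qed

lemma corner_eq: "corner (l, k) = (2 powr real_of_int (- l)) *\<^sub>R lat k"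
  by (simp add: corner_def side_def lat_def)

text \<open>The pair is \<open>\<phi>\<close> and its reflection: \<open>conv\<close> enters the
  Besov-type, Triebel-Lizorkin-type and endpoint norms, \<open>convr\<close> the Carleson
  coefficients.\<close>

locale band_pair =
  fixes \<phi> :: "real^'n::finite \<Rightarrow> complex"
  assumes adm: "admissible \<phi>"
begin

abbreviation conv where "conv j u \<equiv> convolve (dilate \<phi> j) u"
abbreviation convr where "convr j u \<equiv> convolve (dilate (reflect \<phi>) j) u"

lemma bl: "band_limited \<phi>"
  by (rule admissible_band_limited[OF adm])

lemma lower_reflect:
  assumes "3/5 \<le> norm \<xi>" "norm \<xi> \<le> 5/3"
  shows "fourier (reflect \<phi>) \<xi> \<noteq> 0"
proof -
  have "rapid \<phi>" using bl by (simp add: band_limited_def schwartz_rapid)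
  then show ?thesis using admissible_lower[OF adm, of "- \<xi>"] assms by (simp add: fourier_reflect)
qed

lemma kernels: "\<exists>M. sampling_kernels \<phi> (reflect \<phi>) M" "\<exists>M. sampling_kernels (reflect \<phi>) \<phi> M"
proof -
  show "\<exists>M. sampling_kernels \<phi> (reflect \<phi>) M"
    by (rule sampling_kernels_exist[OF bl band_limited_reflect[OF bl]]) (erule (1) admissible_lower[OF adm])
  show "\<exists>M. sampling_kernels (reflect \<phi>) \<phi> M"
    by (rule sampling_kernels_exist[OF band_limited_reflect[OF bl] bl]) (erule (1) lower_reflect)
qed

lemma conv_measurable: "u \<in> schwartz_inf_dual \<Longrightarrow> conv j u \<in> borel_measurable borel"
  using kernels(2) convolve_measurable by blast

text \<open>The weights at levels \<open>j - 1\<close>, \<open>j\<close> and \<open>j + 1\<close>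
  agree up to the factor \<open>2 powr \<bar>\<sigma>\<bar>\<close>, so the samples at all three
  levels share one bound. This leads from the Carleson norm to the endpoint norm.\<close>

lemma conv_bound_of_samples:
  obtains C where "C > 0" "\<And>u b. u \<in> schwartz_inf_dual \<Longrightarrow> 0 \<le> b \<Longrightarrow>
    (\<And>Q. norm (convr (fst Q) u (corner Q)) \<le> b * 2 powr (- (real_of_int (fst Q) * \<sigma>))) \<Longrightarrow>
    (\<And>j x. norm (conv j u x) \<le> C * b * 2 powr (- (real_of_int j * \<sigma>)))"
proof -
  obtain M where "sampling_kernels (reflect \<phi>) \<phi> M" using kernels(2) by blast
  then show ?thesis
  proof (rule sampled_bound, goal_cases)
    case C: (1 C)
  have main: "norm (conv j u x) \<le> (C * 2 powr \<bar>\<sigma>\<bar>) * b * 2 powr (- (real_of_int j * \<sigma>))"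
    if u: "u \<in> schwartz_inf_dual" and b: "0 \<le> b"
      and h: "\<And>Q. norm (convr (fst Q) u (corner Q)) \<le> b * 2 powr (- (real_of_int (fst Q) * \<sigma>))" for u b j x
  proof -
    have "norm (conv j u x) \<le> C * (b * (2 powr \<bar>\<sigma>\<bar> * 2 powr (- (real_of_int j * \<sigma>))))"
    proof (rule C(2)[OF u])
      fix i a assume i: "i \<in> {-1,0,1::int}"
      have "norm (convr (j + i) u (corner (j + i, lattice_enum a))) \<le> b * 2 powr (- (real_of_int (j + i) * \<sigma>))"
        using h[of "(j + i, lattice_enum a)"] by simp
      also have "\<dots> \<le> b * (2 powr \<bar>\<sigma>\<bar> * 2 powr (- (real_of_int j * \<sigma>)))"
        by (intro mult_left_mono powr_shift_le i b)
      finally show "norm (convr (j + i) u ((2 powr real_of_int (- (j + i))) *\<^sub>R lpt a)) \<le> b * (2 powr \<bar>\<sigma>\<bar> * 2 powr (- (real_of_int j * \<sigma>)))"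
        by (simp only: corner_eq lpt_def)
    qed (use b in simp)
    then show ?thesis by (simp add: mult_ac)
  qed
  have "C * 2 powr \<bar>\<sigma>\<bar> > 0" using C(1) by simp
  then show ?case by (rule that[OF _ main])
  qed
qed

text \<open>The way back to the reflected function. Each cube is tested only at its own level, so a
  single term of the Besov-type sum will provide the hypothesis; taking the q-th root produces
  \<open>C powr (1 / q)\<close>.\<close>

lemma convr_bound_of_averages:
  assumes q: "q > 0"
  obtains C where "C > 0" "\<And>u b. u \<in> schwartz_inf_dual \<Longrightarrow> 0 \<le> b \<Longrightarrow>
    (\<And>P. (\<integral>\<^sup>+y\<in>cube P. ennreal (norm (conv (fst P) u y) powr q) \<partial>lborel)
        \<le> ennreal (volume P * (b * 2 powr (- (real_of_int (fst P) * \<sigma>))) powr q)) \<Longrightarrow>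
    (\<And>j x. norm (convr j u x) \<le> C * b * 2 powr (- (real_of_int j * \<sigma>)))"
proof -
  obtain M where M: "sampling_kernels \<phi> (reflect \<phi>) M" using kernels(1) by blast
  obtain M' where M': "sampling_kernels (reflect \<phi>) \<phi> M'" using kernels(2) by blast
  show ?thesis
  proof (rule averaged_bound[OF M M' q], goal_cases)
    case C: (1 C)
  have main: "norm (convr j u x) \<le> (C powr (1 / q) * 2 powr \<bar>\<sigma>\<bar>) * b * 2 powr (- (real_of_int j * \<sigma>))"
    if u: "u \<in> schwartz_inf_dual" and b: "0 \<le> b"
      and h: "\<And>P. (\<integral>\<^sup>+y\<in>cube P. ennreal (norm (conv (fst P) u y) powr q) \<partial>lborel)
        \<le> ennreal (volume P * (b * 2 powr (- (real_of_int (fst P) * \<sigma>))) powr q)" for u b j x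
  proof -
    define T where "T = b * (2 powr \<bar>\<sigma>\<bar> * 2 powr (- (real_of_int j * \<sigma>)))"
    have T: "T \<ge> 0" using b by (simp add: T_def)
    have "norm (convr j u x) powr q \<le> C * T powr q"
    proof (rule C(2)[OF u])
      fix i k assume i: "i \<in> {-1,0,1::int}"
      have "b * 2 powr (- (real_of_int (j + i) * \<sigma>)) \<le> T"
        unfolding T_def by (intro mult_left_mono powr_shift_le i b)
      then have "(b * 2 powr (- (real_of_int (j + i) * \<sigma>))) powr q \<le> T powr q"
        using b q by (intro powr_mono2) auto
      then show "(\<integral>\<^sup>+y\<in>cube (j + i, k). ennreal (norm (conv (j + i) u y) powr q) \<partial>lborel) \<le> ennreal (volume (j + i, k) * T powr q)"
        using h[of "(j + i, k)"] volume_pos[of "(j + i, k)"]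
        by (simp, elim order_trans, intro ennreal_leI mult_left_mono) auto
    qed simp
    then have "(norm (convr j u x) powr q) powr (1 / q) \<le> (C * T powr q) powr (1 / q)"
      using q by (intro powr_mono2) auto
    then have "norm (convr j u x) \<le> C powr (1 / q) * T"
      using q T C(1) by (simp add: powr_mult powr_powr)
    then show ?thesis by (simp add: T_def mult_ac)
  qed
  have "C powr (1 / q) * 2 powr \<bar>\<sigma>\<bar> > 0" using C(1) by simp
  then show ?case by (rule that[OF _ main])
  qed
qed

lemma tl_inf_norm_le:
  assumes u: "u \<in> schwartz_inf_dual" and d: "0 \<le> d" and h: "\<And>j x. norm (conv j u x) \<le> d * 2 powr (- (real_of_int j * \<sigma>))"
  shows "tl_inf_norm \<phi> \<sigma> u \<le> ennreal d"
  unfolding tl_inf_norm_def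
proof (rule SUP_least)
  fix j :: int
  have "esssup lborel (\<lambda>x. ennreal (norm (conv j u x))) \<le> ennreal (d * 2 powr (- (real_of_int j * \<sigma>)))"
    using conv_measurable[OF u, of j] h by (intro esssup_I) (auto intro!: ennreal_leI)
  then have "ennreal (2 powr (real_of_int j * \<sigma>)) * esssup lborel (\<lambda>x. ennreal (norm (conv j u x)))
      \<le> ennreal (2 powr (real_of_int j * \<sigma>)) * ennreal (d * 2 powr (- (real_of_int j * \<sigma>)))"
    by (rule mult_left_mono) simp
  also have "\<dots> = ennreal d"
    using d by (simp add: mult.left_commute flip: ennreal_mult powr_add)
  finally show "ennreal (2 powr (real_of_int j * \<sigma>)) * esssup lborel (\<lambda>x. ennreal (norm (conv j u x))) \<le> ennreal d" .
qed

text \<open>An essential supremum yields only an almost-everywhere bound, which suffices because it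
  is then integrated over cubes or passed to another essential supremum.\<close>

lemma tl_inf_norm_AE:
  assumes "tl_inf_norm \<phi> \<sigma> u \<le> ennreal b" "0 \<le> b"
  shows "AE x in lborel. norm (conv j u x) \<le> b * 2 powr (- (real_of_int j * \<sigma>))"
proof -
  have "ennreal (2 powr (real_of_int j * \<sigma>)) * esssup lborel (\<lambda>x. ennreal (norm (conv j u x))) \<le> ennreal b"
    using assms(1) unfolding tl_inf_norm_def by (simp add: SUP_le_iff)
  then have le: "esssup lborel (\<lambda>x. ennreal (norm (conv j u x))) \<le> ennreal (b / 2 powr (real_of_int j * \<sigma>))"
    by (rule ennreal_mult_leD) (use assms in auto)
  have "AE x in lborel. ennreal (norm (conv j u x)) \<le> esssup lborel (\<lambda>x. ennreal (norm (conv j u x)))"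
    by (rule esssup_AE)
  then show ?thesis
  proof eventually_elim
    case (elim x)
    then have "ennreal (norm (conv j u x)) \<le> ennreal (b / 2 powr (real_of_int j * \<sigma>))" using le by (rule order_trans)
    then show ?case using assms(2) by (simp add: powr_minus_divide)
  qed
qed

section \<open>Sums over dyadic subcubes\<close>

lemma subcubes_fst_le:
  fixes P Q :: "'n dyadic"
  assumes "Q \<in> subcubes P"
  shows "fst P \<le> fst Q"
proof -
  have "emeasure lborel (cube Q) \<le> emeasure lborel (cube P)"
    using assms by (intro emeasure_mono) (simp_all add: subcubes_def)
  then have "side Q ^ CARD('n) \<le> side P ^ CARD('n)"
    unfolding emeasure_cube using less_imp_le[OF side_pos[of P]] by (subst (asm) ennreal_le_iff) simp_all
  then have "\<not> side P < side Q"
    using power_strict_mono[of "side P" "side Q" "CARD('n)"] less_imp_le[OF side_pos[of P]]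
    by (metis linorder_not_le zero_less_card_finite)
  then show ?thesis by (simp add: side_def not_less)
qed

lemma same_level_cube_eq:
  assumes "x \<in> cube Q" "x \<in> cube R" "fst Q = fst R"
  shows "Q = (R :: 'n dyadic)"
proof (rule prod_eqI[OF assms(3)])
  have s: "side Q = side R" using assms(3) by (simp add: side_def)
  have "snd Q $ i = snd R $ i" for i
  proof -
    let ?h = "side R"
    have h: "?h > 0" by (rule side_pos)
    have 1: "?h * real_of_int (snd Q $ i) \<le> x $ i" "x $ i < ?h * real_of_int (snd Q $ i) + ?h"
      using assms(1) unfolding cube_def s[symmetric] by (simp_all add: corner_def)
    have 2: "?h * real_of_int (snd R $ i) \<le> x $ i" "x $ i < ?h * real_of_int (snd R $ i) + ?h"
      using assms(2) unfolding cube_def by (simp_all add: corner_def)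
    have "?h * real_of_int (snd Q $ i) < ?h * (real_of_int (snd R $ i) + 1)"
      using 1(1) 2(2) unfolding distrib_left mult_1_right by linarith
    moreover have "?h * real_of_int (snd R $ i) < ?h * (real_of_int (snd Q $ i) + 1)"
      using 2(1) 1(2) unfolding distrib_left mult_1_right by linarith
    ultimately have "real_of_int (snd Q $ i) < real_of_int (snd R $ i) + 1" "real_of_int (snd R $ i) < real_of_int (snd Q $ i) + 1"
      unfolding mult_less_cancel_left_pos[OF h] .
    then show ?thesis by linarith
  qed
  then show "snd Q = snd R" by (simp add: vec_eq_iff)
qed

text \<open>At a fixed point each level contributes at most one cube, so a sum over subcubes of
  \<open>P\<close> collapses to a sum over the levels from that of \<open>P\<close> upwards.\<close>

lemma nn_integral_subcubes_le:
  fixes f :: "'n dyadic \<Rightarrow> ennreal" and e :: "int \<Rightarrow> ennreal"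
  assumes "\<And>Q. x \<in> cube Q \<Longrightarrow> f Q \<le> e (fst Q)" "\<And>Q. x \<notin> cube Q \<Longrightarrow> f Q = 0"
  shows "(\<integral>\<^sup>+Q. f Q \<partial>count_space (subcubes P)) \<le> (\<integral>\<^sup>+l. e l \<partial>count_space {fst P..})"
proof -
  define A where "A = {Q \<in> subcubes P. x \<in> cube Q}"
  have inj: "inj_on fst A"
    by (rule inj_onI) (rule same_level_cube_eq[of x], simp_all add: A_def)
  have sub: "fst ` A \<subseteq> {fst P..}" unfolding A_def using subcubes_fst_le by blast
  have "(\<integral>\<^sup>+Q. f Q \<partial>count_space (subcubes P)) = (\<integral>\<^sup>+Q. f Q \<partial>count_space A)"
    by (rule nn_integral_count_space_eq) (auto simp: A_def assms(2))
  also have "\<dots> \<le> (\<integral>\<^sup>+Q. e (fst Q) \<partial>count_space A)"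
    using assms(1) by (intro nn_integral_mono) (auto simp: A_def)
  also have "\<dots> = (\<integral>\<^sup>+l. e l \<partial>count_space (fst ` A))"
    by (rule nn_integral_bij_count_space[OF inj_on_imp_bij_betw[OF inj]])
  also have "\<dots> = (\<integral>\<^sup>+l. e l * indicator (fst ` A) l \<partial>count_space {fst P..})"
  proof -
    have "{fst P..} \<inter> fst ` A = fst ` A" using sub by blast
    then show ?thesis
      by (simp add: nn_integral_count_space_indicator mult.assoc Int_commute[of "fst ` A"] flip: indicator_inter_arith)
  qed
  also have "\<dots> \<le> (\<integral>\<^sup>+l. e l \<partial>count_space {fst P..})"
    by (intro nn_integral_mono) (auto simp: indicator_def)
  finally show ?thesis .
qed

text \<open>Finite exponent: \<open>Q\<close> denotes the value of q as a real number, not a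
  cube.\<close>

context
  fixes s r Q \<sigma> :: real
  assumes Q: "Q > 0" and r: "r > 1" and \<sigma>: "\<sigma> = s + real CARD('n) * (r - 1) / Q"
begin

lemma \<sigma>_Q: "\<sigma> * Q = s * Q + real CARD('n) * (r - 1)"
  using Q by (simp add: \<sigma> field_simps)

text \<open>The sum of the geometric series over the levels below a cube, relative to its first
  term; \<open>r > 1\<close> makes the ratio less than 1.\<close>

definition geom :: real where
  "geom = 1 / (1 - 2 powr (- (real CARD('n) * (r - 1))))"

lemma geom_pos: "geom > 0"
  using r powr_less_mono[of "- (real CARD('n) * (r - 1))" 0 2] by (simp add: geom_def)

text \<open>This is where the value of \<open>\<sigma>\<close> comes from: the weight and the bound
  combine to exactly the rate at which the volume to the power \<open>r - 1\<close> decreases with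
  the level.\<close>

lemma scale_powr: "(2 powr (real_of_int l * s) * (d * 2 powr (- (real_of_int l * \<sigma>)))) powr Q
    = d powr Q * 2 powr (- (real_of_int l * (real CARD('n) * (r - 1))))" if "d \<ge> 0"
proof -
  have "(2 powr (real_of_int l * s) * (d * 2 powr (- (real_of_int l * \<sigma>)))) powr Q
    = d powr Q * (2 powr (real_of_int l * s * Q) * 2 powr (- (real_of_int l * (\<sigma> * Q))))"
    using that by (simp add: powr_mult powr_powr mult_ac)
  also have "2 powr (real_of_int l * s * Q) * 2 powr (- (real_of_int l * (\<sigma> * Q))) = 2 powr (- (real_of_int l * (real CARD('n) * (r - 1))))"
    unfolding \<sigma>_Q powr_add[symmetric] by (simp add: algebra_simps)
  finally show ?thesis .
qed

text \<open>The first term of the geometric series, integrated over the cube, matches the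
  normalisation by \<open>volume P powr r\<close> with no loss.\<close>

lemma volume_r: "volume (P :: 'n dyadic) * 2 powr (- (real_of_int (fst P) * (real CARD('n) * (r - 1)))) = volume P powr r"
proof -
  have "2 powr (- (real_of_int (fst P) * (real CARD('n) * (r - 1)))) = volume P powr (r - 1)"
    by (simp add: volume_powr_powr)
  then show ?thesis using volume_pos[of P] by (simp add: powr_diff)
qed

text \<open>At every point of \<open>P\<close> the inner sum is at most a geometric series that
  starts at the level of \<open>P\<close>, so its integral is a constant multiple of
  \<open>volume P powr r\<close>.\<close>

lemma cmo_norm_le:
  assumes q: "q \<noteq> \<infinity>" "enn2real q = Q" and u: "u \<in> schwartz_inf_dual" and d: "0 \<le> d"
    and h: "\<And>j x. norm (convr j u x) \<le> d * 2 powr (- (real_of_int j * \<sigma>))"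
  shows "cmo_norm \<phi> s q r u \<le> ennreal (geom powr (1 / Q) * d)"
proof -
  have "epowr (ennreal (volume P powr (- r)) *
      (\<integral>\<^sup>+x\<in>cube P. (\<integral>\<^sup>+R. ennreal ((2 powr (real_of_int (fst R) * s) * norm (convr (fst R) u (corner R)) * indicator (cube R) x) powr Q)
         \<partial>count_space (subcubes P)) \<partial>lborel)) (1 / Q) \<le> ennreal (geom powr (1 / Q) * d)" (is "epowr (_ * ?I) _ \<le> _") for P :: "'n dyadic"
  proof (rule epowr_root_leI[OF _ Q])
    have "(\<integral>\<^sup>+R. ennreal ((2 powr (real_of_int (fst R) * s) * norm (convr (fst R) u (corner R)) * indicator (cube R) x) powr Q) \<partial>count_space (subcubes P))
        \<le> (\<integral>\<^sup>+l. ennreal (d powr Q * 2 powr (- (real_of_int l * (real CARD('n) * (r - 1))))) \<partial>count_space {fst P..})" for x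
    proof (rule nn_integral_subcubes_le)
      fix R :: "'n dyadic" assume "x \<in> cube R"
      have "(2 powr (real_of_int (fst R) * s) * norm (convr (fst R) u (corner R))) powr Q
          \<le> (2 powr (real_of_int (fst R) * s) * (d * 2 powr (- (real_of_int (fst R) * \<sigma>)))) powr Q"
        using Q h by (intro powr_mono2 mult_left_mono) auto
      then show "ennreal ((2 powr (real_of_int (fst R) * s) * norm (convr (fst R) u (corner R)) * indicator (cube R) x) powr Q)
          \<le> ennreal (d powr Q * 2 powr (- (real_of_int (fst R) * (real CARD('n) * (r - 1)))))"
        using \<open>x \<in> cube R\<close> unfolding scale_powr[OF d] by (simp add: ennreal_leI)
    qed simp
    then have "?I \<le> (\<integral>\<^sup>+x. ennreal (d powr Q * 2 powr (- (real_of_int (fst P) * (real CARD('n) * (r - 1)))) * geom) * indicator (cube P) x \<partial>lborel)"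
      using r by (intro nn_integral_mono mult_right_mono) (simp_all add: nn_integral_geometric geom_def)
    also have "\<dots> = ennreal (d powr Q * geom * volume P powr r)"
      using geom_pos volume_pos[of P]
      by (subst nn_integral_const_cube) (simp_all add: volume_r[symmetric] mult_ac)
    finally have "ennreal (volume P powr (- r)) * ?I \<le> ennreal (volume P powr (- r)) * ennreal (d powr Q * geom * volume P powr r)"
      by (rule mult_left_mono) simp
    also have "\<dots> = ennreal (d powr Q * geom)"
      using volume_pos[of P] geom_pos by (simp add: powr_minus_divide flip: ennreal_mult)
    also have "d powr Q * geom = (geom powr (1 / Q) * d) powr Q"
      using Q d geom_pos by (simp add: powr_mult powr_powr)
    finally show "ennreal (volume P powr (- r)) * ?I \<le> ennreal ((geom powr (1 / Q) * d) powr Q)" .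
  qed (use d in simp)
  then show ?thesis
    using q unfolding cmo_norm_def Let_def wavelet_coefficient[OF bl u] by (auto intro!: SUP_least)
qed

lemma cmo_norm_samples:
  assumes q: "q \<noteq> \<infinity>" "enn2real q = Q" and u: "u \<in> schwartz_inf_dual" and b: "0 \<le> b"
    and le: "cmo_norm \<phi> s q r u \<le> ennreal b"
  shows "norm (convr (fst P) u (corner P)) \<le> b * 2 powr (- (real_of_int (fst P) * \<sigma>))"
proof -
  define c where "c R = 2 powr (real_of_int (fst R) * s) * norm (convr (fst R) u (corner R))" for R :: "'n dyadic"
  let ?I = "\<integral>\<^sup>+x\<in>cube P. (\<integral>\<^sup>+R. ennreal ((c R * indicator (cube R) x) powr Q) \<partial>count_space (subcubes P)) \<partial>lborel"
  have c0: "c R \<ge> 0" for R by (simp add: c_def)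
  have "epowr (ennreal (volume P powr (- r)) * ?I) (1 / Q) \<le> ennreal b"
    using le q unfolding cmo_norm_def Let_def wavelet_coefficient[OF bl u] c_def by (simp add: SUP_le_iff del: split_paired_All)
  then have "ennreal (volume P powr (- r)) * ?I \<le> ennreal (b powr Q)"
    by (rule epowr_root_leD[OF _ Q b])
  then have 1: "?I \<le> ennreal (b powr Q / volume P powr (- r))"
    using volume_pos[of P] by (intro ennreal_mult_leD) auto
  have "ennreal (c P powr Q * volume P) = (\<integral>\<^sup>+x. ennreal (c P powr Q) * indicator (cube P) x \<partial>lborel)"
    by (rule nn_integral_const_cube[symmetric]) simp
  \<comment> \<open>All subcubes other than \<open>P\<close> itself are discarded from the inner
    sum.\<close>
  also have "\<dots> \<le> ?I"
  proof (intro nn_integral_mono)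
    fix x
    show "ennreal (c P powr Q) * indicator (cube P) x \<le> (\<integral>\<^sup>+R. ennreal ((c R * indicator (cube R) x) powr Q) \<partial>count_space (subcubes P)) * indicator (cube P) x"
    proof (cases "x \<in> cube P")
      case True
      have "ennreal ((c P * indicator (cube P) x) powr Q) \<le> (\<integral>\<^sup>+R. ennreal ((c R * indicator (cube R) x) powr Q) \<partial>count_space (subcubes P))"
        by (rule nn_integral_ge_point) (simp add: subcubes_def)
      then show ?thesis using True by simp
    qed simp
  qed
  also note 1
  finally have "c P powr Q * volume P \<le> b powr Q / volume P powr (- r)" by simp
  also have "\<dots> = b powr Q * 2 powr (- (real_of_int (fst P) * (real CARD('n) * (r - 1)))) * volume P"
    using volume_pos[of P] by (simp add: powr_minus_divide volume_r[symmetric] mult_ac)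
  finally have "c P powr Q \<le> (2 powr (real_of_int (fst P) * s) * (b * 2 powr (- (real_of_int (fst P) * \<sigma>)))) powr Q"
    using volume_pos[of P] unfolding scale_powr[OF b] by simp
  then have "c P \<le> 2 powr (real_of_int (fst P) * s) * (b * 2 powr (- (real_of_int (fst P) * \<sigma>)))"
    using Q b c0[of P] powr_less_mono2[of Q] by (metis linorder_not_le mult_nonneg_nonneg powr_ge_zero)
  then show ?thesis by (simp add: c_def)
qed

text \<open>One level of the Besov-type sum before any root is taken; for p = q the Besov-type and
  the Triebel-Lizorkin-type norm both reduce to sums of these.\<close>

definition level_energy :: "((real^'n \<Rightarrow> complex) \<Rightarrow> complex) \<Rightarrow> 'n dyadic \<Rightarrow> int \<Rightarrow> ennreal" where
  "level_energy u P l = (\<integral>\<^sup>+x\<in>cube P. ennreal ((2 powr (real_of_int l * s) * norm (conv l u x)) powr Q) \<partial>lborel)"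

lemma besov_norm_finite:
  assumes q: "q \<noteq> \<infinity>" "enn2real q = Q"
  shows "besov_norm \<phi> s (ediv r q) q q u = (SUP P. ennreal (volume P powr (- (r / Q))) *
    epowr (\<integral>\<^sup>+l. level_energy u P l \<partial>count_space {fst P..}) (1 / Q))"
  using q Q unfolding besov_norm_def lq_qnorm_def Lp_qnorm_def ediv_def band_def level_energy_def
  by (simp add: epowr_epowr_inverse)

lemma tl_norm_eq_besov_norm:
  assumes q: "q \<noteq> \<infinity>" "enn2real q = Q" and u: "u \<in> schwartz_inf_dual"
  shows "tl_norm \<phi> s (ediv r q) (enn2real q) q u = besov_norm \<phi> s (ediv r q) q q u"
proof -
  note [measurable] = conv_measurable[OF u]
  have "(\<integral>\<^sup>+x\<in>cube P. (\<integral>\<^sup>+l. ennreal ((2 powr (real_of_int l * s) * norm (conv l u x)) powr Q) \<partial>count_space {fst P..}) \<partial>lborel)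
      = (\<integral>\<^sup>+l. level_energy u P l \<partial>count_space {fst P..})" for P
    unfolding nn_integral_count_space_atLeast level_energy_def
    by (simp add: nn_integral_suminf[symmetric] flip: ennreal_suminf_multc)
  then have "tl_norm \<phi> s (ediv r q) (enn2real q) q u = (SUP P. ennreal (volume P powr (- (r / Q))) *
    epowr (\<integral>\<^sup>+l. level_energy u P l \<partial>count_space {fst P..}) (1 / Q))"
    using q Q unfolding tl_norm_def lq_qnorm_def Lp_qnorm_def ediv_def band_def
    by (simp add: epowr_epowr_inverse)
  then show ?thesis by (simp only: besov_norm_finite[OF q])
qed

lemma besov_norm_le:
  assumes q: "q \<noteq> \<infinity>" "enn2real q = Q" and u: "u \<in> schwartz_inf_dual" and d: "0 \<le> d"
    and h: "\<And>j. AE x in lborel. norm (conv j u x) \<le> d * 2 powr (- (real_of_int j * \<sigma>))"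
  shows "besov_norm \<phi> s (ediv r q) q q u \<le> ennreal (geom powr (1 / Q) * d)"
  unfolding besov_norm_finite[OF q]
proof (rule SUP_least)
  fix P :: "'n dyadic"
  have "level_energy u P l \<le> ennreal (d powr Q * volume P * 2 powr (- (real_of_int l * (real CARD('n) * (r - 1)))))" for l
  proof -
    have "level_energy u P l \<le> (\<integral>\<^sup>+x. ennreal (d powr Q * 2 powr (- (real_of_int l * (real CARD('n) * (r - 1))))) * indicator (cube P) x \<partial>lborel)"
      unfolding level_energy_def
    proof (rule nn_integral_mono_AE)
      show "AE x in lborel. ennreal ((2 powr (real_of_int l * s) * norm (conv l u x)) powr Q) * indicator (cube P) x
         \<le> ennreal (d powr Q * 2 powr (- (real_of_int l * (real CARD('n) * (r - 1))))) * indicator (cube P) x"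
        using h[of l]
      proof eventually_elim
        case (elim x)
        have "(2 powr (real_of_int l * s) * norm (conv l u x)) powr Q
            \<le> (2 powr (real_of_int l * s) * (d * 2 powr (- (real_of_int l * \<sigma>)))) powr Q"
          using Q elim by (intro powr_mono2 mult_left_mono) auto
        then show ?case unfolding scale_powr[OF d] by (intro mult_right_mono ennreal_leI) auto
      qed
    qed
    also have "\<dots> = ennreal (d powr Q * volume P * 2 powr (- (real_of_int l * (real CARD('n) * (r - 1)))))"
      by (subst nn_integral_const_cube) (simp_all add: mult_ac)
    finally show ?thesis .
  qed
  then have "(\<integral>\<^sup>+l. level_energy u P l \<partial>count_space {fst P..})
      \<le> (\<integral>\<^sup>+l. ennreal (d powr Q * volume P * 2 powr (- (real_of_int l * (real CARD('n) * (r - 1))))) \<partial>count_space {fst P..})"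
    by (intro nn_integral_mono) auto
  also have "\<dots> = ennreal (d powr Q * (volume P * 2 powr (- (real_of_int (fst P) * (real CARD('n) * (r - 1))))) * geom)"
    using r volume_pos[of P] by (subst nn_integral_geometric) (auto simp: geom_def mult_ac)
  also have "\<dots> = ennreal ((geom powr (1 / Q) * d * volume P powr (r / Q)) powr Q)"
    unfolding volume_r using Q d geom_pos volume_pos[of P] by (simp add: powr_mult powr_powr mult_ac)
  finally have "epowr (\<integral>\<^sup>+l. level_energy u P l \<partial>count_space {fst P..}) (1 / Q) \<le> ennreal (geom powr (1 / Q) * d * volume P powr (r / Q))"
    by (rule epowr_root_leI[OF _ Q]) (use d in simp)
  then have "ennreal (volume P powr (- (r / Q))) * epowr (\<integral>\<^sup>+l. level_energy u P l \<partial>count_space {fst P..}) (1 / Q)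
     \<le> ennreal (volume P powr (- (r / Q))) * ennreal (geom powr (1 / Q) * d * volume P powr (r / Q))"
    by (rule mult_left_mono) simp
  also have "\<dots> = ennreal (geom powr (1 / Q) * d)"
    using d volume_pos[of P] by (simp add: powr_minus_divide flip: ennreal_mult)
  finally show "ennreal (volume P powr (- (r / Q))) * epowr (\<integral>\<^sup>+l. level_energy u P l \<partial>count_space {fst P..}) (1 / Q)
     \<le> ennreal (geom powr (1 / Q) * d)" .
qed

lemma besov_norm_averages:
  assumes q: "q \<noteq> \<infinity>" "enn2real q = Q" and u: "u \<in> schwartz_inf_dual" and b: "0 \<le> b"
    and le: "besov_norm \<phi> s (ediv r q) q q u \<le> ennreal b"
  shows "(\<integral>\<^sup>+y\<in>cube P. ennreal (norm (conv (fst P) u y) powr Q) \<partial>lborel)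
        \<le> ennreal (volume P * (b * 2 powr (- (real_of_int (fst P) * \<sigma>))) powr Q)"
proof -
  let ?l = "fst P"
  let ?A = "\<integral>\<^sup>+y\<in>cube P. ennreal (norm (conv ?l u y) powr Q) \<partial>lborel"
  note [measurable] = conv_measurable[OF u]
  have "ennreal (volume P powr (- (r / Q))) * epowr (\<integral>\<^sup>+l. level_energy u P l \<partial>count_space {?l..}) (1 / Q) \<le> ennreal b"
    using le unfolding besov_norm_finite[OF q] by (simp add: SUP_le_iff del: split_paired_All)
  then have "epowr (\<integral>\<^sup>+l. level_energy u P l \<partial>count_space {?l..}) (1 / Q) \<le> ennreal (b / volume P powr (- (r / Q)))"
    using volume_pos[of P] b by (intro ennreal_mult_leD) auto
  then have "(\<integral>\<^sup>+l. level_energy u P l \<partial>count_space {?l..}) \<le> ennreal ((b / volume P powr (- (r / Q))) powr Q)"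
    by (rule epowr_root_leD[OF _ Q]) (use b in simp)
  \<comment> \<open>Only the first level of the sum, the one of \<open>P\<close> itself, is
    retained.\<close>
  moreover have "level_energy u P ?l \<le> (\<integral>\<^sup>+l. level_energy u P l \<partial>count_space {?l..})"
    by (rule nn_integral_ge_point) simp
  moreover have "(b / volume P powr (- (r / Q))) powr Q = b powr Q * volume P powr r"
    using b Q volume_pos[of P] by (simp add: powr_minus_divide powr_mult powr_powr)
  moreover have "level_energy u P ?l = ennreal ((2 powr (real_of_int ?l * s)) powr Q) * ?A"
    unfolding level_energy_def
    by (subst nn_integral_cmult[symmetric]) (simp_all add: powr_mult ennreal_mult mult.assoc)
  ultimately have "ennreal ((2 powr (real_of_int ?l * s)) powr Q) * ?A \<le> ennreal (b powr Q * volume P powr r)"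
    by (simp only:)
  then have "?A \<le> ennreal ((b powr Q * volume P powr r) / (2 powr (real_of_int ?l * s)) powr Q)"
    by (rule ennreal_mult_leD) auto
  also have "(b powr Q * volume P powr r) / (2 powr (real_of_int ?l * s)) powr Q
      = volume P * ((2 powr (real_of_int ?l * s) * (b * 2 powr (- (real_of_int ?l * \<sigma>)))) powr Q) / (2 powr (real_of_int ?l * s)) powr Q"
    unfolding scale_powr[OF b] volume_r[symmetric] by (simp add: mult_ac)
  also have "\<dots> = volume P * (b * 2 powr (- (real_of_int ?l * \<sigma>))) powr Q"
    using b by (simp add: powr_mult)
  finally show ?thesis .
qed

end

end

section \<open>From one-sided estimates to equality of the spaces\<close>

context band_pair
begin

text \<open>The estimate ranges over the whole dual, infinite values included, so that two opposite
  estimates give both the equality of the spaces and the equivalence of the norms.\<close>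

definition comparable where
  "comparable N L \<longleftrightarrow> (\<exists>C>0. \<forall>u\<in>(schwartz_inf_dual :: ((real^'n \<Rightarrow> complex) \<Rightarrow> complex) set). L u \<le> ennreal C * N u)"

lemma comparableI:
  assumes "C > 0" "\<And>u b. u \<in> schwartz_inf_dual \<Longrightarrow> 0 \<le> b \<Longrightarrow> N u \<le> ennreal b \<Longrightarrow> L u \<le> ennreal (C * b)"
  shows "comparable N L"
  unfolding comparable_def
proof (intro exI[of _ C] conjI ballI assms(1))
  fix u :: "(real^'n \<Rightarrow> complex) \<Rightarrow> complex" assume u: "u \<in> schwartz_inf_dual"
  show "L u \<le> ennreal C * N u"
  proof (cases "N u")
    case (real b)
    then show ?thesis using assms(2)[OF u, of b] assms(1) by (simp add: ennreal_mult')
  next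
    case top
    then show ?thesis using assms(1) by (simp add: ennreal_mult_top)
  qed
qed

lemma comparable_trans:
  assumes "comparable N L" "comparable L K"
  shows "comparable N K"
proof -
  obtain C D where C: "C > 0" "\<And>u. u \<in> schwartz_inf_dual \<Longrightarrow> L u \<le> ennreal C * N u"
    and D: "D > 0" "\<And>u. u \<in> schwartz_inf_dual \<Longrightarrow> K u \<le> ennreal D * L u"
    using assms unfolding comparable_def by blast
  show ?thesis
    unfolding comparable_def
  proof (intro exI[of _ "D * C"] conjI ballI)
    fix u :: "(real^'n \<Rightarrow> complex) \<Rightarrow> complex" assume u: "u \<in> schwartz_inf_dual"
    have "K u \<le> ennreal D * L u" by (rule D(2)[OF u])
    also have "\<dots> \<le> ennreal D * (ennreal C * N u)" by (rule mult_left_mono[OF C(2)[OF u]]) simp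
    finally show "K u \<le> ennreal (D * C) * N u"
      using C(1) D(1) by (simp add: ennreal_mult mult.assoc)
  qed (use C D in simp)
qed

lemma comparable_finite_eq:
  assumes "comparable N L" "comparable L N"
  shows "{u \<in> schwartz_inf_dual. N u < \<infinity>} = {u \<in> schwartz_inf_dual. L u < \<infinity>}"
    and "equivalent_norms_on {u \<in> schwartz_inf_dual. N u < \<infinity>} N L"
proof -
  obtain C D where C: "C > 0" "\<And>u. u \<in> schwartz_inf_dual \<Longrightarrow> L u \<le> ennreal C * N u"
    and D: "D > 0" "\<And>u. u \<in> schwartz_inf_dual \<Longrightarrow> N u \<le> ennreal D * L u"
    using assms unfolding comparable_def by blast
  have fin: "ennreal c * x < top" if "x < top" for c :: real and x
    using that by (simp add: ennreal_mult_less_top)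
  show "{u \<in> schwartz_inf_dual. N u < \<infinity>} = {u \<in> schwartz_inf_dual. L u < \<infinity>}"
  proof -
    have "N u < \<infinity> \<longleftrightarrow> L u < \<infinity>" if u: "u \<in> schwartz_inf_dual" for u
      using le_less_trans[OF C(2)[OF u] fin] le_less_trans[OF D(2)[OF u] fin] by auto
    then show ?thesis by blast
  qed
  show "equivalent_norms_on {u \<in> schwartz_inf_dual. N u < \<infinity>} N L"
    unfolding equivalent_norms_on_def
  proof (rule exI[of _ "1 / D"], rule exI[of _ C], intro conjI ballI)
    fix u assume "u \<in> {u \<in> schwartz_inf_dual. N u < \<infinity>}"
    then have u: "u \<in> schwartz_inf_dual" by simp
    show "L u \<le> ennreal C * N u" by (rule C(2)[OF u])
    have "ennreal (1 / D) * N u \<le> ennreal (1 / D) * (ennreal D * L u)"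
      by (rule mult_left_mono[OF D(2)[OF u]]) simp
    also have "\<dots> = L u" using D(1) by (simp add: mult.assoc[symmetric] flip: ennreal_mult)
    finally show "ennreal (1 / D) * N u \<le> L u" .
  qed (use C D in simp_all)
qed

lemma comparable_finite:
  fixes s r :: real and q :: ennreal
  assumes q: "0 < q" "q < \<infinity>" and r: "1 < r"
  defines "\<sigma> \<equiv> s + ediv (real CARD('n) * (r - 1)) q"
  shows "comparable (besov_norm \<phi> s (ediv r q) q q) (cmo_norm \<phi> s q r)"
    and "comparable (tl_inf_norm \<phi> \<sigma>) (besov_norm \<phi> s (ediv r q) q q)"
    and "comparable (cmo_norm \<phi> s q r) (tl_inf_norm \<phi> \<sigma>)"
proof -
  define Q where "Q = enn2real q"
  have q': "q \<noteq> \<infinity>" "enn2real q = Q" using q by (auto simp: Q_def)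
  have Q: "Q > 0" using q by (simp add: Q_def enn2real_positive_iff)
  have \<sigma>: "\<sigma> = s + real CARD('n) * (r - 1) / Q"
    using q' by (simp add: \<sigma>_def ediv_def)
  define g where "g = geom r powr (1 / Q)"
  have g: "g > 0" using geom_pos[OF Q r \<sigma>] by (simp add: g_def)
  show "comparable (besov_norm \<phi> s (ediv r q) q q) (cmo_norm \<phi> s q r)"
  proof (rule convr_bound_of_averages[OF Q, of \<sigma>], goal_cases)
    case C: (1 C)
    show ?case
    proof (rule comparableI[of "g * C"])
      fix u b assume u: "u \<in> schwartz_inf_dual" and b: "(0::real) \<le> b" and le: "besov_norm \<phi> s (ediv r q) q q u \<le> ennreal b"
      have "norm (convr j u x) \<le> C * b * 2 powr (- (real_of_int j * \<sigma>))" for j x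
        by (rule C(2)[OF u b besov_norm_averages[OF Q r \<sigma> q' u b le]])
      from cmo_norm_le[OF Q r \<sigma> q' u _ this] b C(1)
      show "cmo_norm \<phi> s q r u \<le> ennreal (g * C * b)" by (simp add: g_def mult.assoc)
    qed (use g C(1) in simp)
  qed
  show "comparable (tl_inf_norm \<phi> \<sigma>) (besov_norm \<phi> s (ediv r q) q q)"
  proof (rule comparableI[OF g])
    fix u b assume u: "u \<in> schwartz_inf_dual" and b: "(0::real) \<le> b" and le: "tl_inf_norm \<phi> \<sigma> u \<le> ennreal b"
    show "besov_norm \<phi> s (ediv r q) q q u \<le> ennreal (g * b)"
      unfolding g_def by (rule besov_norm_le[OF Q r \<sigma> q' u b tl_inf_norm_AE[OF le b]])
  qed
  show "comparable (cmo_norm \<phi> s q r) (tl_inf_norm \<phi> \<sigma>)"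
  proof (rule conv_bound_of_samples[of \<sigma>], goal_cases)
    case C: (1 C)
    show ?case
    proof (rule comparableI[OF C(1)])
      fix u b assume u: "u \<in> schwartz_inf_dual" and b: "(0::real) \<le> b" and le: "cmo_norm \<phi> s q r u \<le> ennreal b"
      have "norm (conv j u x) \<le> C * b * 2 powr (- (real_of_int j * \<sigma>))" for j x
        by (rule C(2)[OF u b cmo_norm_samples[OF Q r \<sigma> q' u b le]])
      then show "tl_inf_norm \<phi> \<sigma> u \<le> ennreal (C * b)"
        using b C(1) by (intro tl_inf_norm_le[OF u]) auto
    qed
  qed
qed

lemma scaled_le_iff: "2 powr (real_of_int l * s) * y \<le> b \<longleftrightarrow> y \<le> b * 2 powr (- (real_of_int l * s))"
  by (simp add: powr_minus_divide field_simps)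

text \<open>Suprema replace the sums over levels. An essential bound on a cube also bounds the mean
  over it, so the averaging estimate is applied with exponent 1.\<close>

lemma comparable_infinite:
  shows "comparable (besov_norm \<phi> s 0 \<infinity> \<infinity>) (cmo_norm \<phi> s \<infinity> r)"
    and "comparable (tl_inf_norm \<phi> s) (besov_norm \<phi> s 0 \<infinity> \<infinity>)"
    and "comparable (cmo_norm \<phi> s \<infinity> r) (tl_inf_norm \<phi> s)"
proof -
  have besov: "besov_norm \<phi> s 0 \<infinity> \<infinity> u = (SUP P. SUP l\<in>{fst P..}. esssup (restrict_space lborel (cube P)) (band \<phi> s u l))" for u
    by (simp add: besov_norm_def lq_qnorm_def Lp_qnorm_def less_imp_neq[OF volume_pos, symmetric])
  have AE_iff: "(AE x in restrict_space lborel (cube P). Pr x) \<longleftrightarrow> (AE x in lborel. x \<in> cube P \<longrightarrow> Pr x)" for P :: "'n dyadic" and Pr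
    by (simp add: AE_restrict_space_iff)
  show "comparable (besov_norm \<phi> s 0 \<infinity> \<infinity>) (cmo_norm \<phi> s \<infinity> r)"
  proof (rule convr_bound_of_averages[OF zero_less_one, of s], goal_cases)
    case C: (1 C)
    show ?case
    proof (rule comparableI[OF C(1)])
      fix u b assume u: "u \<in> schwartz_inf_dual" and b: "(0::real) \<le> b" and le: "besov_norm \<phi> s 0 \<infinity> \<infinity> u \<le> ennreal b"
      have avg: "(\<integral>\<^sup>+y\<in>cube P. ennreal (norm (conv (fst P) u y) powr 1) \<partial>lborel)
        \<le> ennreal (volume P * (b * 2 powr (- (real_of_int (fst P) * s))) powr 1)" for P
      proof -
        have "esssup (restrict_space lborel (cube P)) (band \<phi> s u (fst P)) \<le> besov_norm \<phi> s 0 \<infinity> \<infinity> u"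
          unfolding besov by (rule order_trans[OF _ SUP_upper[of P]]) (auto intro: SUP_upper)
        then have e: "esssup (restrict_space lborel (cube P)) (band \<phi> s u (fst P)) \<le> ennreal b" using le by (rule order_trans)
        have "AE x in restrict_space lborel (cube P). band \<phi> s u (fst P) x \<le> esssup (restrict_space lborel (cube P)) (band \<phi> s u (fst P))"
          by (rule esssup_AE)
        then have "AE x in lborel. x \<in> cube P \<longrightarrow> band \<phi> s u (fst P) x \<le> esssup (restrict_space lborel (cube P)) (band \<phi> s u (fst P))"
          unfolding AE_iff .
        then have "AE x in lborel. ennreal (norm (conv (fst P) u x) powr 1) * indicator (cube P) x
            \<le> ennreal (b * 2 powr (- (real_of_int (fst P) * s))) * indicator (cube P) x"
        proof eventually_elim
          case (elim x)
          show ?case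
          proof (cases "x \<in> cube P")
            case True
            then have "band \<phi> s u (fst P) x \<le> ennreal b" using elim e by (auto intro: order_trans)
            then have "norm (conv (fst P) u x) \<le> b * 2 powr (- (real_of_int (fst P) * s))"
              using b by (simp add: band_def scaled_le_iff)
            then show ?thesis using True by (simp add: ennreal_leI)
          qed simp
        qed
        then have "(\<integral>\<^sup>+y\<in>cube P. ennreal (norm (conv (fst P) u y) powr 1) \<partial>lborel)
            \<le> (\<integral>\<^sup>+x. ennreal (b * 2 powr (- (real_of_int (fst P) * s))) * indicator (cube P) x \<partial>lborel)"
          by (rule nn_integral_mono_AE)
        also have "\<dots> = ennreal (b * 2 powr (- (real_of_int (fst P) * s)) * volume P)"
          by (rule nn_integral_const_cube) (use b in simp)
        finally show ?thesis using b by (simp add: mult.commute)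
      qed
      have "norm (convr j u x) \<le> C * b * 2 powr (- (real_of_int j * s))" for j x
        by (rule C(2)[OF u b avg])
      then show "cmo_norm \<phi> s \<infinity> r u \<le> ennreal (C * b)"
        unfolding cmo_norm_def Let_def wavelet_coefficient[OF bl u]
        by (auto intro!: SUP_least ennreal_leI simp: scaled_le_iff)
    qed
  qed
  show "comparable (tl_inf_norm \<phi> s) (besov_norm \<phi> s 0 \<infinity> \<infinity>)"
  proof (rule comparableI[OF zero_less_one])
    fix u b assume u: "u \<in> schwartz_inf_dual" and b: "(0::real) \<le> b" and le: "tl_inf_norm \<phi> s u \<le> ennreal b"
    have "esssup (restrict_space lborel (cube P)) (band \<phi> s u l) \<le> ennreal b" for P :: "'n dyadic" and l
    proof (rule esssup_I)
      have "band \<phi> s u l \<in> borel_measurable lborel"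
        unfolding band_def[abs_def] using conv_measurable[OF u, of l] by simp
      then show "band \<phi> s u l \<in> borel_measurable (restrict_space lborel (cube P))"
        by (rule measurable_restrict_space1)
      show "AE x in restrict_space lborel (cube P). band \<phi> s u l x \<le> ennreal b"
        unfolding AE_iff using tl_inf_norm_AE[OF le b, of l]
      proof eventually_elim
        case (elim x)
        then show ?case by (simp add: band_def scaled_le_iff ennreal_leI)
      qed
    qed
    then show "besov_norm \<phi> s 0 \<infinity> \<infinity> u \<le> ennreal (1 * b)"
      unfolding besov by (auto intro!: SUP_least)
  qed
  show "comparable (cmo_norm \<phi> s \<infinity> r) (tl_inf_norm \<phi> s)"
  proof (rule conv_bound_of_samples[of s], goal_cases)
    case C: (1 C)
    show ?case
    proof (rule comparableI[OF C(1)])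
      fix u b assume u: "u \<in> schwartz_inf_dual" and b: "(0::real) \<le> b" and le: "cmo_norm \<phi> s \<infinity> r u \<le> ennreal b"
      have samples: "norm (convr (fst P) u (corner P)) \<le> b * 2 powr (- (real_of_int (fst P) * s))" for P
      proof -
        have "ennreal (2 powr (real_of_int (fst P) * s) * norm (convr (fst P) u (corner P))) \<le> cmo_norm \<phi> s \<infinity> r u"
          unfolding cmo_norm_def Let_def wavelet_coefficient[OF bl u]
          by (simp, rule order_trans[OF _ SUP_upper[of P]]) (auto intro!: SUP_upper2[of P] simp: subcubes_def)
        also note le
        finally show ?thesis using b by (simp add: scaled_le_iff)
      qed
      have "norm (conv j u x) \<le> C * b * 2 powr (- (real_of_int j * s))" for j x
        by (rule C(2)[OF u b samples])
      then show "tl_inf_norm \<phi> s u \<le> ennreal (C * b)"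
        using b C(1) by (intro tl_inf_norm_le[OF u]) auto
    qed
  qed
qed

end

theorem corollary3:
  fixes \<phi> :: "real^'n::finite \<Rightarrow> complex" and s r :: real and q :: ennreal
  assumes "admissible \<phi>"
    and "(0 < q \<and> q < \<infinity> \<and> 1 < r) \<or> (q = \<infinity> \<and> 1 \<le> r)"
  shows "CMO \<phi> s q r = Besov_type \<phi> s (ediv r q) q q
    \<and> equivalent_norms_on (CMO \<phi> s q r) (cmo_norm \<phi> s q r) (besov_norm \<phi> s (ediv r q) q q)
    \<and> CMO \<phi> s q r = TL_inf \<phi> (s + ediv (real CARD('n) * (r - 1)) q)
    \<and> equivalent_norms_on (CMO \<phi> s q r) (cmo_norm \<phi> s q r)
        (tl_inf_norm \<phi> (s + ediv (real CARD('n) * (r - 1)) q))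
    \<and> (q < \<infinity> \<longrightarrow>
        CMO \<phi> s q r = TL_type \<phi> s (ediv r q) (enn2real q) q
        \<and> equivalent_norms_on (CMO \<phi> s q r) (cmo_norm \<phi> s q r)
            (tl_norm \<phi> s (ediv r q) (enn2real q) q))"
proof -
  interpret band_pair \<phi> by standard (rule assms(1))
  let ?\<sigma> = "s + ediv (real CARD('n) * (r - 1)) q"
  let ?cmo = "cmo_norm \<phi> s q r" and ?besov = "besov_norm \<phi> s (ediv r q) q q"
    and ?tl_inf = "tl_inf_norm \<phi> ?\<sigma>" and ?tl = "tl_norm \<phi> s (ediv r q) (enn2real q) q"
  have cycle: "comparable ?besov ?cmo" "comparable ?tl_inf ?besov" "comparable ?cmo ?tl_inf"
  proof -
    show "comparable ?besov ?cmo"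
      using assms(2) comparable_finite(1)[of q r s] comparable_infinite(1)[of s r] by (auto simp: ediv_def)
    show "comparable ?tl_inf ?besov"
      using assms(2) comparable_finite(2)[of q r s] comparable_infinite(2)[of s] by (auto simp: ediv_def)
    show "comparable ?cmo ?tl_inf"
      using assms(2) comparable_finite(3)[of q r s] comparable_infinite(3)[of s r] by (auto simp: ediv_def)
  qed
  note besov = comparable_trans[OF cycle(3,2)] cycle(1)
  note tl_inf = cycle(3) comparable_trans[OF cycle(2,1)]
  have tl: "comparable ?cmo ?tl" "comparable ?tl ?cmo" if q: "q < \<infinity>"
  proof -
    have Q: "enn2real q > 0" and r: "r > 1" and q': "q \<noteq> \<infinity>"
      using assms(2) q by (auto simp: enn2real_positive_iff)
    \<comment> \<open>The two quasi-norms coincide on the dual, so both comparisons are inherited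
      with the same constants.\<close>
    have "?tl u = ?besov u" if "u \<in> schwartz_inf_dual" for u
      by (rule tl_norm_eq_besov_norm[OF Q r refl q' refl that])
    then show "comparable ?cmo ?tl" "comparable ?tl ?cmo"
      using besov unfolding comparable_def by simp_all
  qed
  show ?thesis
    unfolding CMO_def Besov_type_def TL_inf_def TL_type_def
    by (intro conjI impI comparable_finite_eq besov tl_inf tl)
qed

end
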